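(* Let $1<p<\infty$, let $\Omega\subset\mathbb{R}^d$ be open, let $u,v\in W^{1,p}(\mathbb{R}^d)$ and let $v_\varepsilon\in W^p_{\nu_\varepsilon}(\Omega|\mathbb{R}^d)$, $\varepsilon>0$, be such that $v_\varepsilon|_\Omega\to v|_\Omega$ in $L^p_{\mathrm{loc}}(\Omega)$ as $\varepsilon\to0$ and $$\sup_{\varepsilon>0}\big(\|v_\varepsilon\|_{L^p(\Omega)}^p+\mathcal{E}^\varepsilon(v_\varepsilon,v_\varepsilon)\big)<\infty.$$ Assume that one of the following conditions holds: (i) $\Omega$ is a $W^{1,p}$-extension domain; (ii) $\partial\Omega=\partial\overline\Omega$ and $\mathbb{R}^d\setminus\overline\Omega$ is a $W^{1,p}$-extension domain; (iii) $u\in W^{1,p}_0(\Omega)$ (extended by zero). Then $$\lim_{\varepsilon\to0}\mathcal{E}^\varepsilon(u,v_\varepsilon)=\lim_{\varepsilon\to0}\mathcal{E}^\varepsilon_+(u,v_\varepsilon)=K_{d,p}\,\mathcal{E}^0(u,v).$$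
   Context: Kernels: $(\nu_\varepsilon)_{\varepsilon>0}$ is a family of radial measurable functions $\nu_\varepsilon:\mathbb{R}^d\setminus\{0\}\to[0,\infty)$, $d\ge1$, with $\int_{\mathbb{R}^d}(1\wedge|h|^p)\nu_\varepsilon(h)\,dh=1$ and $\lim_{\varepsilon\to0}\int_{|h|>\delta}\nu_\varepsilon(h)\,dh=0$ for every $\delta>0$. $K_{d,p}=\frac{1}{|\mathbb{S}^{d-1}|}\int_{\mathbb{S}^{d-1}}|w_d|^p\,d\sigma_{d-1}(w)$, $\Omega^c=\mathbb{R}^d\setminus\Omega$. The forms $\mathcal{E}^\varepsilon(u,v)$ and $\mathcal{E}^\varepsilon_+(u,v)$ are the integrals of $|u(x)-u(y)|^{p-2}(u(x)-u(y))(v(x)-v(y))\nu_\varepsilon(x-y)$ with respect to $dy\,dx$ over $(\Omega^c\times\Omega^c)^c$ and over $\Omega\times\mathbb{R}^d$, respectively; $\mathcal{E}^0(u,v)=\int_\Omega|\nabla u|^{p-2}\nabla u\cdot\nabla v\,dx$. $W^p_{\nu_\varepsilon}(\Omega|\mathbb{R}^d)$ is the space of measurable $u:\mathbb{R}^d\to\mathbb{R}$ with $u|_\Omega\in L^p(\Omega)$ and $\mathcal{E}^\varepsilon(u,u)<\infty$. An open set $U$ is a $W^{1,p}$-extension domain if there is a bounded linear operator $E:W^{1,p}(U)\to W^{1,p}(\mathbb{R}^d)$ with $Eu|_U=u$. *)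

theory Defs
  imports "HOL-Analysis.Analysis"
begin

text \<open>
  All function spaces are spaces of representatives: a function on \<open>U\<close> is a total function of which
  only the values on \<open>U\<close> matter, and almost everywhere equal functions are not identified.
  Powers with real exponent are \<open>powr\<close>, where \<open>0 powr a = 0\<close> for every \<open>a\<close>; hence expressions such
  as \<open>\<bar>a\<bar>\<^sup>p\<^sup>-\<^sup>2 a\<close> take the value \<open>0\<close> at \<open>a = 0\<close>, also for \<open>p < 2\<close>.
\<close>

subsection \<open>Test functions and Sobolev spaces\<close>

primrec Ck :: "nat \<Rightarrow> ('a::euclidean_space \<Rightarrow> real) \<Rightarrow> bool" where
  "Ck 0 f \<longleftrightarrow> continuous_on UNIV f"
| "Ck (Suc n) f \<longleftrightarrow>
     (\<forall>x. f differentiable (at x)) \<and>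
     (\<forall>b\<in>Basis. Ck n (\<lambda>x. frechet_derivative f (at x) b))"

definition test_fun :: "'a::euclidean_space set \<Rightarrow> ('a \<Rightarrow> real) \<Rightarrow> bool" where
  "test_fun U \<phi> \<longleftrightarrow>
     (\<forall>n. Ck n \<phi>) \<and> compact (closure {x. \<phi> x \<noteq> 0}) \<and> closure {x. \<phi> x \<noteq> 0} \<subseteq> U"

definition Lp_on :: "real \<Rightarrow> 'a::euclidean_space set \<Rightarrow> ('a \<Rightarrow> 'b::euclidean_space) \<Rightarrow> bool" where
  "Lp_on p U f \<longleftrightarrow>
     set_borel_measurable lebesgue U f \<and> set_integrable lebesgue U (\<lambda>x. norm (f x) powr p)"

definition loc_integrable :: "'a::euclidean_space set \<Rightarrow> ('a \<Rightarrow> 'b::euclidean_space) \<Rightarrow> bool" where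
  "loc_integrable U f \<longleftrightarrow> (\<forall>K. compact K \<and> K \<subseteq> U \<longrightarrow> set_integrable lebesgue K f)"

definition is_weak_grad ::
  "'a::euclidean_space set \<Rightarrow> ('a \<Rightarrow> real) \<Rightarrow> ('a \<Rightarrow> 'a) \<Rightarrow> bool" where
  "is_weak_grad U u g \<longleftrightarrow>
     loc_integrable U u \<and> loc_integrable U g \<and>
     (\<forall>\<phi>. test_fun U \<phi> \<longrightarrow> (\<forall>b\<in>Basis.
        (LINT x:U|lebesgue. u x * frechet_derivative \<phi> (at x) b)
          = - (LINT x:U|lebesgue. (g x \<bullet> b) * \<phi> x)))"

text \<open>The weak gradient is unique up to a null subset of \<open>U\<close>, so integrals over \<open>U\<close> of expressions
  in \<open>weak_grad U u\<close> do not depend on the choice made here.\<close>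

definition weak_grad :: "'a::euclidean_space set \<Rightarrow> ('a \<Rightarrow> real) \<Rightarrow> 'a \<Rightarrow> 'a" where
  "weak_grad U u = (SOME g. is_weak_grad U u g)"

definition W1p :: "real \<Rightarrow> 'a::euclidean_space set \<Rightarrow> ('a \<Rightarrow> real) set" where
  "W1p p U = {u. Lp_on p U u \<and> (\<exists>g. is_weak_grad U u g \<and> Lp_on p U g)}"

definition W1p_norm :: "real \<Rightarrow> 'a::euclidean_space set \<Rightarrow> ('a \<Rightarrow> real) \<Rightarrow> real" where
  "W1p_norm p U u =
     ((LINT x:U|lebesgue. \<bar>u x\<bar> powr p)
        + (LINT x:U|lebesgue. norm (weak_grad U u x) powr p)) powr (1 / p)"

text \<open>The closure of the test functions in \<open>W1p p U\<close>, each element being extended by zero to the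
  whole space.\<close>

definition W1p0 :: "real \<Rightarrow> 'a::euclidean_space set \<Rightarrow> ('a \<Rightarrow> real) set" where
  "W1p0 p U = {u \<in> W1p p U.
     (\<exists>\<phi>. (\<forall>n. test_fun U (\<phi> n)) \<and> (\<lambda>n. W1p_norm p U (\<lambda>x. u x - \<phi> n x)) \<longlonglongrightarrow> 0) \<and>
     (AE x in lebesgue. x \<notin> U \<longrightarrow> u x = 0)}"

text \<open>Linearity of the extension operator is required almost everywhere. Together with boundedness
  it implies that \<open>E\<close> respects almost everywhere equality on \<open>U\<close>, i.e. that \<open>E\<close> is an operator on
  equivalence classes.\<close>

definition W1p_extension_domain :: "real \<Rightarrow> 'a::euclidean_space set \<Rightarrow> bool" where
  "W1p_extension_domain p U \<longleftrightarrow> open U \<and>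
     (\<exists>E :: ('a \<Rightarrow> real) \<Rightarrow> ('a \<Rightarrow> real).
        (\<forall>u\<in>W1p p U. E u \<in> W1p p UNIV) \<and>
        (\<forall>u\<in>W1p p U. \<forall>v\<in>W1p p U. AE x in lebesgue. E (\<lambda>y. u y + v y) x = E u x + E v x) \<and>
        (\<forall>u\<in>W1p p U. \<forall>c. AE x in lebesgue. E (\<lambda>y. c * u y) x = c * E u x) \<and>
        (\<exists>C. \<forall>u\<in>W1p p U. W1p_norm p UNIV (E u) \<le> C * W1p_norm p U u) \<and>
        (\<forall>u\<in>W1p p U. AE x in lebesgue. x \<in> U \<longrightarrow> E u x = u x))"

subsection \<open>Kernels and energy forms\<close>

text \<open>The value \<open>\<nu> \<epsilon> 0\<close> is arbitrary, as is \<open>\<nu> \<epsilon>\<close> for \<open>\<epsilon> \<le> 0\<close>.\<close>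

definition kernel_family :: "real \<Rightarrow> (real \<Rightarrow> 'a::euclidean_space \<Rightarrow> real) \<Rightarrow> bool" where
  "kernel_family p \<nu> \<longleftrightarrow>
     (\<forall>\<epsilon>>0.
        \<nu> \<epsilon> \<in> borel_measurable (lebesgue_on (UNIV - {0})) \<and>
        (\<forall>h. h \<noteq> 0 \<longrightarrow> 0 \<le> \<nu> \<epsilon> h) \<and>
        (\<forall>h k. h \<noteq> 0 \<and> k \<noteq> 0 \<and> norm h = norm k \<longrightarrow> \<nu> \<epsilon> h = \<nu> \<epsilon> k) \<and>
        has_bochner_integral lebesgue (\<lambda>h. min 1 (norm h powr p) * \<nu> \<epsilon> h) 1) \<and>
     (\<forall>\<delta>>0. ((\<lambda>\<epsilon>. LINT h:{h. norm h > \<delta>}|lebesgue. \<nu> \<epsilon> h) \<longlongrightarrow> 0) (at_right 0))"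

definition form_integrand ::
  "real \<Rightarrow> ('a::euclidean_space \<Rightarrow> real) \<Rightarrow> ('a \<Rightarrow> real) \<Rightarrow> ('a \<Rightarrow> real) \<Rightarrow> 'a \<times> 'a \<Rightarrow> real" where
  "form_integrand p \<nu> u v = (\<lambda>(x, y).
     \<bar>u x - u y\<bar> powr (p - 2) * (u x - u y) * (v x - v y) * \<nu> (x - y))"

definition form_E ::
  "real \<Rightarrow> ('a::euclidean_space \<Rightarrow> real) \<Rightarrow> 'a set \<Rightarrow> ('a \<Rightarrow> real) \<Rightarrow> ('a \<Rightarrow> real) \<Rightarrow> real" where
  "form_E p \<nu> \<Omega> u v = (LINT z:- ((- \<Omega>) \<times> (- \<Omega>))|lebesgue. form_integrand p \<nu> u v z)"

definition form_E_plus ::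
  "real \<Rightarrow> ('a::euclidean_space \<Rightarrow> real) \<Rightarrow> 'a set \<Rightarrow> ('a \<Rightarrow> real) \<Rightarrow> ('a \<Rightarrow> real) \<Rightarrow> real" where
  "form_E_plus p \<nu> \<Omega> u v = (LINT z:\<Omega> \<times> UNIV|lebesgue. form_integrand p \<nu> u v z)"

definition form_E0 ::
  "real \<Rightarrow> 'a::euclidean_space set \<Rightarrow> ('a \<Rightarrow> real) \<Rightarrow> ('a \<Rightarrow> real) \<Rightarrow> real" where
  "form_E0 p \<Omega> u v =
     (LINT x:\<Omega>|lebesgue.
        norm (weak_grad \<Omega> u x) powr (p - 2) * (weak_grad \<Omega> u x \<bullet> weak_grad \<Omega> v x))"

text \<open>The integrand of \<open>form_E p \<nu> \<Omega> u u\<close> is nonnegative, so its integrability expresses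
  that the energy of \<open>u\<close> is finite.\<close>

definition W_nu ::
  "real \<Rightarrow> ('a::euclidean_space \<Rightarrow> real) \<Rightarrow> 'a set \<Rightarrow> ('a \<Rightarrow> real) set" where
  "W_nu p \<nu> \<Omega> = {u. u \<in> borel_measurable lebesgue \<and> Lp_on p \<Omega> u \<and>
     set_integrable lebesgue (- ((- \<Omega>) \<times> (- \<Omega>))) (form_integrand p \<nu> u u)}"

definition Lp_loc_tendsto ::
  "real \<Rightarrow> 'a::euclidean_space set \<Rightarrow> (real \<Rightarrow> 'a \<Rightarrow> real) \<Rightarrow> ('a \<Rightarrow> real) \<Rightarrow> bool" where
  "Lp_loc_tendsto p \<Omega> f g \<longleftrightarrow> (\<forall>K. compact K \<and> K \<subseteq> \<Omega> \<longrightarrow>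
     ((\<lambda>\<epsilon>. LINT x:K|lebesgue. \<bar>f \<epsilon> x - g x\<bar> powr p) \<longlongrightarrow> 0) (at_right 0))"

subsection \<open>The constant \<open>K\<^sub>d\<^sub>,\<^sub>p\<close>\<close>

text \<open>Surface measure on the unit sphere as cone measure: a Borel set \<open>A\<close> of unit vectors has
  measure \<open>d\<close> times the volume of \<open>{r w | 0 < r < 1, w \<in> A}\<close>. For \<open>d = 1\<close> this is the counting
  measure on \<open>{-1, 1}\<close>.\<close>

definition sphere_measure :: "'a::euclidean_space measure" where
  "sphere_measure = scale_measure (of_nat DIM('a))
     (distr (restrict_space lborel (ball 0 1 - {0})) (restrict_space borel (sphere 0 1))
        (\<lambda>x. x /\<^sub>R norm x))"

text \<open>The index type \<open>'d\<close> has no distinguished last element, so the coordinate \<open>k\<close> that plays the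
  role of \<open>w\<^sub>d\<close> is a parameter; by rotation invariance the value does not depend on it.\<close>

definition K_const :: "real \<Rightarrow> 'd::finite \<Rightarrow> real" where
  "K_const p k =
     (1 / measure sphere_measure (sphere (0 :: real ^ 'd) 1)) *
     (LINT w|(sphere_measure :: (real ^ 'd) measure). \<bar>w $ k\<bar> powr p)"

end

theory Submission
  imports Defs
begin

text \<open>
  Write \<open>y = x - h\<close>. In the coordinates \<open>(x, h)\<close> the form \<open>\<E>\<^sub>+\<close> is the pairing of \<open>|Du|\<^sup>p\<^sup>-\<^sup>2 Du\<close> with
  \<open>Dv\<^sub>\<epsilon>\<close> over \<open>\<Omega> \<times> \<real>\<^sup>d\<close>, where \<open>Du (x, h) = u x - u (x - h)\<close> and the measure is \<open>dx \<otimes> \<nu>\<^sub>\<epsilon>(h) dh\<close>.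
  The kernels have mass one against \<open>min 1 |h|\<^sup>p\<close> and concentrate at \<open>h = 0\<close>.

  On the side of \<open>u\<close> there is strong convergence. A function in \<open>W\<^sup>1\<^sup>,\<^sup>p(\<real>\<^sup>d)\<close> satisfies
  \<open>u x - u (x - h) = \<integral>\<^sub>0\<^sup>1 \<nabla>u (x - t h) \<bullet> h dt\<close> for almost every \<open>x\<close> (\<open>difference_eq_line_integral\<close>); since
  translations are continuous in \<open>L\<^sup>p\<close>, the error of \<open>Du \<approx> \<nabla>u x \<bullet> h\<close> is \<open>o(|h|)\<close> in \<open>L\<^sup>p(dx)\<close>
  (\<open>W1p_strong_Lp_grad\<close>). As the kernels concentrate, \<open>Du\<close> may be replaced by the linear expression
  \<open>\<nabla>u x \<bullet> h\<close> for \<open>|h| \<le> 1\<close> and by \<open>0\<close> otherwise, with an error that tends to \<open>0\<close> in the \<open>L\<^sup>p\<close> space of the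
  product measure (\<open>increment_minus_tangent_tendsto\<close>). An inequality of Young type
  (\<open>duality_map_diff_young\<close>) transports this through the nonlinearity \<open>s \<mapsto> |s|\<^sup>p\<^sup>-\<^sup>2 s\<close>.

  On the side of \<open>v\<^sub>\<epsilon>\<close> weak convergence suffices. Split \<open>v\<^sub>\<epsilon> = v + w\<^sub>\<epsilon>\<close>. The increment of \<open>v\<close> is again
  replaced by \<open>\<nabla>v x \<bullet> h\<close>. The increments of \<open>w\<^sub>\<epsilon>\<close> are bounded in \<open>L\<^sup>p\<close>, so \<open>\<nabla>u\<close> may be approximated by a
  simple function and its level sets by Lipschitz cutoffs \<open>\<phi>\<close> with compact support in \<open>\<Omega>\<close>. For those the
  difference is moved from \<open>w\<^sub>\<epsilon>\<close> to \<open>\<phi>\<close>, which costs a factor \<open>|h|\<close> and leaves \<open>\<integral> |w\<^sub>\<epsilon>|\<close> over a compact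
  subset of \<open>\<Omega>\<close>; this tends to \<open>0\<close> (\<open>weak_limit_vector\<close>). The nonlinear operator is thus never evaluated in
  strong form, and there is no distinction between \<open>p < 2\<close> and \<open>p \<ge> 2\<close>.

  What remains is the integral of \<open>|a \<bullet> h|\<^sup>p\<^sup>-\<^sup>2 (a \<bullet> h) (b \<bullet> h)\<close> against a radial weight, which is
  \<open>K |a|\<^sup>p\<^sup>-\<^sup>2 a \<bullet> b\<close> times the \<open>p\<close>-th moment of the weight: a reflection kills the part of \<open>b\<close> orthogonal to \<open>a\<close>,
  a rotation moves \<open>a\<close> to a coordinate axis, and polar coordinates separate radius and direction
  (\<open>radial_duality_moment\<close>).

  The two forms differ by the integral over \<open>x \<notin> \<Omega>\<close>, \<open>x - h \<in> \<Omega>\<close>. There, up to \<open>o(|h|\<^sup>p)\<close>, the energy of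
  \<open>u\<close> is at most a constant times \<open>|h|\<^sup>p\<close> times the integral of \<open>|\<nabla>u|\<^sup>p\<close> over the points of \<open>\<Omega>\<close> that the
  translation by \<open>h\<close> moves out of \<open>\<Omega>\<close>. These layers shrink to the empty set because \<open>\<Omega>\<close> is open, so the
  difference vanishes in the limit (\<open>outer_increment_tendsto_0\<close>).
\<close>

section \<open>The map \<open>s \<mapsto> |s|\<^sup>p\<^sup>-\<^sup>2 s\<close> and inequalities of Young type\<close>

definition duality_map :: "real \<Rightarrow> real \<Rightarrow> real" where
  "duality_map p s = \<bar>s\<bar> powr (p - 2) * s"

lemma abs_duality_map: "\<bar>duality_map p s\<bar> = \<bar>s\<bar> powr (p - 1)"
proof (cases "s = 0")
  case False
  have "\<bar>s\<bar> powr (p - 2) * \<bar>s\<bar> powr 1 = \<bar>s\<bar> powr (p - 1)"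
    by (simp only: powr_add[symmetric]) simp
  then have "\<bar>s\<bar> powr (p - 2) * \<bar>s\<bar> = \<bar>s\<bar> powr (p - 1)" using False by simp
  then show ?thesis using False by (simp add: duality_map_def abs_mult)
qed (simp add: duality_map_def)

lemma duality_map_mult_self: "duality_map p s * s = \<bar>s\<bar> powr p"
proof (cases "s = 0")
  case False
  have "duality_map p s * s = \<bar>duality_map p s\<bar> * \<bar>s\<bar> powr 1"
    by (simp add: duality_map_def abs_mult abs_mult_self_eq mult.assoc)
  also have "\<dots> = \<bar>s\<bar> powr p" unfolding abs_duality_map using False by (simp only: powr_add[symmetric]) simp
  finally show ?thesis .
qed (simp add: duality_map_def)

lemma duality_map_0 [simp]: "duality_map p 0 = 0" by (simp add: duality_map_def)

lemma duality_map_mult: "duality_map p (c * s) = duality_map p c * duality_map p s"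
  by (simp add: duality_map_def abs_mult powr_mult)

lemma continuous_on_duality_map: "1 < p \<Longrightarrow> continuous_on UNIV (duality_map p)"
proof -
  assume p: "1 < p"
  have eq: "duality_map p s = max s 0 powr (p - 1) - max (-s) 0 powr (p - 1)" for s
  proof -
    consider "s = 0" | "s > 0" | "s < 0" by linarith
    then show ?thesis
    proof cases
      case 2 then have "\<bar>duality_map p s\<bar> = duality_map p s" by (simp add: duality_map_def)
      with 2 abs_duality_map[of p s] show ?thesis by simp
    next
      case 3 then have "\<bar>duality_map p s\<bar> = - duality_map p s" by (simp add: duality_map_def abs_mult)
      with 3 abs_duality_map[of p s] show ?thesis by simp
    qed simp
  qed
  show ?thesis unfolding eq using p
    by (intro continuous_intros continuous_on_powr') auto
qed

lemma borel_measurable_duality_map [measurable]: "duality_map p \<in> borel_measurable borel"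
  unfolding duality_map_def by measurable

lemma abs_add_powr_le: 
  fixes a b :: real assumes "0 \<le> p" shows "\<bar>a + b\<bar> powr p \<le> 2 powr p * (\<bar>a\<bar> powr p + \<bar>b\<bar> powr p)"
proof -
  have "\<bar>a + b\<bar> powr p \<le> (2 * max \<bar>a\<bar> \<bar>b\<bar>) powr p" using assms by (intro powr_mono2) auto
  also have "\<dots> = 2 powr p * max \<bar>a\<bar> \<bar>b\<bar> powr p" by (simp add: powr_mult)
  also have "max \<bar>a\<bar> \<bar>b\<bar> powr p \<le> \<bar>a\<bar> powr p + \<bar>b\<bar> powr p" by (simp add: max_def)
  finally show ?thesis by simp
qed

lemma norm_diff_powr_le: 
  fixes a b :: "'a::real_normed_vector" 
  assumes "0 \<le> p" shows "norm (a - b) powr p \<le> 2 powr p * (norm a powr p + norm b powr p)"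
proof -
  have "norm (a - b) powr p \<le> \<bar>norm a + norm b\<bar> powr p" using assms by (intro powr_mono2) (auto intro: norm_triangle_ineq4)
  also have "\<dots> \<le> 2 powr p * (norm a powr p + norm b powr p)" using abs_add_powr_le[OF assms, of "norm a" "norm b"] by simp
  finally show ?thesis .
qed

text \<open>Inserting \<open>w \<le> s a\<close> or \<open>a \<le> w / s\<close> into \<open>a\<^sup>p\<^sup>-\<^sup>1 w\<close> gives one of the two terms. A small \<open>s\<close> makes the
  first coefficient small, a large \<open>s\<close> the second, so this serves both arguments of the pairing and
  replaces the inequality of Hoelder in all limits below.\<close>

lemma young_scaled:
  fixes a w s :: real
  assumes p: "1 < p" and s: "0 < s" and "0 \<le> a" "0 \<le> w"
  shows "a powr (p - 1) * w \<le> s * a powr p + s powr (1 - p) * w powr p"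
proof (cases "w \<le> s * a")
  case True
  have "a powr (p - 1) * w \<le> a powr (p - 1) * (s * a)" using True by (intro mult_left_mono) auto
  also have "\<dots> = s * a powr p" using assms by (cases "a = 0") (auto simp: powr_diff)
  finally show ?thesis by (simp add: add_increasing2)
next
  case False
  then have w: "w > 0" using assms by (smt (verit) mult_nonneg_nonneg)
  have "a powr (p - 1) * w \<le> (w / s) powr (p - 1) * w"
    using False assms by (intro mult_right_mono powr_mono2) (auto simp: field_simps)
  also have "\<dots> = s powr (1 - p) * w powr p" using s w
    by (simp add: powr_divide powr_diff field_simps)
  finally show ?thesis using s by (simp add: add_increasing)
qed

lemma duality_map_young_left:
  assumes "1 < p" "0 < t"
  shows "\<exists>C\<ge>0. \<forall>a w. \<bar>duality_map p a\<bar> * \<bar>w\<bar> \<le> t * \<bar>a\<bar> powr p + C * \<bar>w\<bar> powr p"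
  using young_scaled[of p t "\<bar>_\<bar>" "\<bar>_\<bar>"] assms
  by (intro exI[of _ "t powr (1 - p)"]) (auto simp: abs_duality_map)

lemma duality_map_young_right:
  assumes "1 < p" "0 < t"
  shows "\<exists>C\<ge>0. \<forall>a w. \<bar>duality_map p a\<bar> * \<bar>w\<bar> \<le> t * \<bar>w\<bar> powr p + C * \<bar>a\<bar> powr p"
proof -
  define s where "s = t powr (1 / (1 - p))"
  have "s > 0" "s powr (1 - p) = t" using assms by (auto simp: s_def powr_powr)
  then show ?thesis using young_scaled[of p s "\<bar>_\<bar>" "\<bar>_\<bar>"] assms
    by (intro exI[of _ s]) (auto simp: abs_duality_map add.commute)
qed

text \<open>By homogeneity it suffices to know \<open>s \<mapsto> |s|\<^sup>p\<^sup>-\<^sup>2 s\<close> on \<open>[-1, 1]\<close>, where it is uniformly continuous.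
  With the modulus \<open>\<sigma>\<close> for the accuracy \<open>t\<close>: if \<open>a\<close> and \<open>b\<close> are \<open>\<sigma>\<close>-close relative to their size \<open>M\<close>, the difference
  of the images is at most \<open>t M\<^sup>p\<^sup>-\<^sup>1\<close>; otherwise \<open>M\<close> itself is controlled by \<open>|a - b|\<close>. This covers \<open>p < 2\<close> and
  \<open>p \<ge> 2\<close> at once.\<close>

lemma duality_map_diff_young:
  assumes p: "1 < p" and t: "0 < t"
  shows "\<exists>C\<ge>0. \<forall>a b w. \<bar>duality_map p a - duality_map p b\<bar> * \<bar>w\<bar> 
     \<le> t * (\<bar>a\<bar> powr p + \<bar>b\<bar> powr p + \<bar>w\<bar> powr p) + C * \<bar>a - b\<bar> powr p"
proof -
  have "uniformly_continuous_on {-1..1} (duality_map p)"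
    using continuous_on_duality_map[OF p] by (intro compact_uniformly_continuous) (auto intro: continuous_on_subset)
  then obtain \<sigma> where \<sigma>: "\<sigma> > 0" and uc: "\<And>x y. x \<in> {-1..1} \<Longrightarrow> y \<in> {-1..1} \<Longrightarrow> \<bar>x - y\<bar> < \<sigma> \<Longrightarrow> \<bar>duality_map p x - duality_map p y\<bar> < t"
    unfolding uniformly_continuous_on_def dist_real_def using t by (metis abs_minus_commute)
  define c where "c = 2 * (1 / \<sigma>) powr (p - 1)"
  have c: "c > 0" using \<sigma> by (simp add: c_def)
  from duality_map_young_right[OF p, of "t / c"] t c obtain C where C: "C \<ge> 0" 
    and CC: "\<And>a w. \<bar>duality_map p a\<bar> * \<bar>w\<bar> \<le> t / c * \<bar>w\<bar> powr p + C * \<bar>a\<bar> powr p" by auto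
  have "\<bar>duality_map p a - duality_map p b\<bar> * \<bar>w\<bar> 
     \<le> t * (\<bar>a\<bar> powr p + \<bar>b\<bar> powr p + \<bar>w\<bar> powr p) + (c * C) * \<bar>a - b\<bar> powr p" for a b w
  proof -
    define M where "M = max \<bar>a\<bar> \<bar>b\<bar>"
    have Mp: "M powr p \<le> \<bar>a\<bar> powr p + \<bar>b\<bar> powr p" by (simp add: M_def max_def)
    consider "M = 0" | "M > 0" "\<bar>a - b\<bar> < \<sigma> * M" | "M > 0" "\<bar>a - b\<bar> \<ge> \<sigma> * M" by (fastforce simp: M_def)
    then show ?thesis
    proof cases
      case 1 then have "a = 0" "b = 0" by (auto simp: M_def max_def split: if_splits)
      then show ?thesis using t by simp
    next
      case 2
      have M1: "M powr (p - 1) > 0" using 2 by simp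
      have ab: "\<bar>a\<bar> \<le> M" "\<bar>b\<bar> \<le> M" by (auto simp: M_def)
      then have "a / M \<in> {-1..1}" "b / M \<in> {-1..1}" using 2 by (auto simp: field_simps)
      moreover have "\<bar>a / M - b / M\<bar> < \<sigma>" 
      proof -
        have "\<bar>a / M - b / M\<bar> = \<bar>a - b\<bar> / M" using 2 by (simp add: diff_divide_distrib[symmetric])
        then show ?thesis using 2 by (simp add: field_simps)
      qed
      ultimately have "\<bar>duality_map p (a / M) - duality_map p (b / M)\<bar> < t" by (rule uc)
      moreover have "duality_map p a = duality_map p M * duality_map p (a / M)" "duality_map p b = duality_map p M * duality_map p (b / M)"
        using 2 by (simp_all flip: duality_map_mult)
      ultimately have "\<bar>duality_map p a - duality_map p b\<bar> \<le> t * M powr (p - 1)"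
        using abs_duality_map[of p M] 2 by (simp flip: right_diff_distrib add: abs_mult mult_right_mono mult.commute)
      then have "\<bar>duality_map p a - duality_map p b\<bar> * \<bar>w\<bar> \<le> t * (M powr (p - 1) * \<bar>w\<bar>)" 
        by (metis abs_ge_zero mult.assoc mult_right_mono)
      also have "M powr (p - 1) * \<bar>w\<bar> \<le> M powr p + \<bar>w\<bar> powr p"
        using young_scaled[of p 1 M "\<bar>w\<bar>"] p 2 by simp
      also have "\<dots> \<le> \<bar>a\<bar> powr p + \<bar>b\<bar> powr p + \<bar>w\<bar> powr p" using Mp by simp
      finally have "\<bar>duality_map p a - duality_map p b\<bar> * \<bar>w\<bar> \<le> t * (\<bar>a\<bar> powr p + \<bar>b\<bar> powr p + \<bar>w\<bar> powr p)" using t by simp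
      then show ?thesis using c C by (simp add: add_increasing2)
    next
      \<comment> \<open>Here \<open>M \<le> |a - b| / \<sigma>\<close>.\<close>
      case 3
      have "\<bar>duality_map p a - duality_map p b\<bar> \<le> M powr (p - 1) + M powr (p - 1)"
        using abs_triangle_ineq4[of "duality_map p a" "duality_map p b"] powr_mono2[of "p-1" "\<bar>a\<bar>" M]  powr_mono2[of "p-1" "\<bar>b\<bar>" M] p
        unfolding abs_duality_map by (fastforce simp: M_def)
      also have "\<dots> \<le> 2 * (\<bar>a - b\<bar> / \<sigma>) powr (p - 1)"
        using powr_mono2[of "p - 1" M "\<bar>a - b\<bar> / \<sigma>"] p 3 \<sigma> by (simp add: field_simps)
      also have "\<dots> = c * \<bar>duality_map p (a - b)\<bar>" using \<sigma> by (simp add: c_def abs_duality_map powr_divide)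
      finally have "\<bar>duality_map p a - duality_map p b\<bar> * \<bar>w\<bar> \<le> c * (\<bar>duality_map p (a - b)\<bar> * \<bar>w\<bar>)"
        by (metis abs_ge_zero mult.assoc mult_right_mono)
      also have "\<dots> \<le> c * (t / c * \<bar>w\<bar> powr p + C * \<bar>a - b\<bar> powr p)" using c by (intro mult_left_mono CC) auto
      also have "\<dots> = t * \<bar>w\<bar> powr p + c * C * \<bar>a - b\<bar> powr p" using c by (simp add: field_simps)
      also have "\<dots> \<le> t * (\<bar>a\<bar> powr p + \<bar>b\<bar> powr p + \<bar>w\<bar> powr p) + (c * C) * \<bar>a - b\<bar> powr p"
        using t by (simp add: mult_left_mono)
      finally show ?thesis .
    qed
  qed
  then show ?thesis using c C by (intro exI[of _ "c * C"]) auto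
qed

section \<open>Test functions below indicators of boxes\<close>

lemma Ck_Suc_imp: "Ck (Suc n) f \<Longrightarrow> Ck n f"
proof (induction n arbitrary: f)
  case 0
  then have "f differentiable (at x)" for x by simp
  then show ?case by (simp add: differentiable_imp_continuous_on differentiable_on_def)
next
  case (Suc n) 
  from Suc.prems[unfolded Ck.simps(2)[of "Suc n"]]
  show ?case unfolding Ck.simps(2)[of n f] using Suc.IH by blast
qed

lemma frechet_derivative_eqI: "(f has_derivative f') (at x) \<Longrightarrow> frechet_derivative f (at x) = f'"
  by (rule frechet_derivative_at[symmetric])

lemma Ck_const: "Ck n (\<lambda>x::'a::euclidean_space. c)"
  by (induction n arbitrary: c) auto

lemma Ck_add: "Ck n f \<Longrightarrow> Ck n g \<Longrightarrow> Ck n (\<lambda>x::'a::euclidean_space. f x + g x)"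
proof (induction n arbitrary: f g)
  case 0 then show ?case by (auto intro: continuous_intros)
next
  case (Suc n)
  have df: "(f has_derivative frechet_derivative f (at x)) (at x)" "(g has_derivative frechet_derivative g (at x)) (at x)" for x
    using Suc.prems by (auto simp: frechet_derivative_works)
  have d: "((\<lambda>x. f x + g x) has_derivative (\<lambda>h. frechet_derivative f (at x) h + frechet_derivative g (at x) h)) (at x)" for x
    by (intro derivative_intros df)
  then show ?case using Suc by (auto simp: frechet_derivative_eqI[OF d] intro: differentiableI)
qed

lemma Ck_mult: "Ck n f \<Longrightarrow> Ck n g \<Longrightarrow> Ck n (\<lambda>x::'a::euclidean_space. f x * g x)"
proof (induction n arbitrary: f g)
  case 0 then show ?case by (auto intro: continuous_intros)
next
  case (Suc n)
  have df: "(f has_derivative frechet_derivative f (at x)) (at x)" "(g has_derivative frechet_derivative g (at x)) (at x)" for x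
    using Suc.prems by (auto simp: frechet_derivative_works)
  have d: "((\<lambda>x. f x * g x) has_derivative (\<lambda>h. f x * frechet_derivative g (at x) h + frechet_derivative f (at x) h * g x)) (at x)" for x
    by (intro derivative_intros df)
  have "Ck n f" "Ck n g" using Suc.prems Ck_Suc_imp by auto
  then show ?case using Suc.prems by (auto simp: frechet_derivative_eqI[OF d] intro!: differentiableI[OF d] Ck_add Suc.IH)
qed

lemma Ck_prod: "finite I \<Longrightarrow> (\<And>i. i \<in> I \<Longrightarrow> Ck n (f i)) \<Longrightarrow> Ck n (\<lambda>x::'a::euclidean_space. \<Prod>i\<in>I. f i x)"
  by (induction I rule: finite_induct) (auto intro: Ck_const Ck_mult)

lemma Ck_exp: "Ck n f \<Longrightarrow> Ck n (\<lambda>x::'a::euclidean_space. exp (f x))"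
proof (induction n arbitrary: f)
  case 0 then show ?case by (auto intro: continuous_intros)
next
  case (Suc n)
  have df: "(f has_derivative frechet_derivative f (at x)) (at x)" for x
    using Suc.prems by (auto simp: frechet_derivative_works)
  have d: "((\<lambda>x. exp (f x)) has_derivative (\<lambda>h. exp (f x) * frechet_derivative f (at x) h)) (at x)" for x
    using has_derivative_exp[OF df] by (simp add: mult.commute)
  have "Ck n f" using Suc.prems Ck_Suc_imp by auto
  then show ?case using Suc by (auto simp: frechet_derivative_eqI[OF d] intro!: differentiableI[OF d] Ck_mult)
qed

lemma Ck_inner_compose:
  fixes F :: "nat \<Rightarrow> real \<Rightarrow> real" and i :: "'a::euclidean_space"
  assumes "\<And>n s. (F n has_real_derivative F (Suc n) s) (at s)"
  shows "Ck n (\<lambda>x. F m (c * (x \<bullet> i) + d))"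
proof (induction n arbitrary: m)
  have d: "((\<lambda>x. F m (c * (x \<bullet> i) + d)) has_derivative (\<lambda>h. F (Suc m) (c * (x \<bullet> i) + d) * (c * (h \<bullet> i)))) (at x)" for x m
  proof -
    have "((\<lambda>x. c * (x \<bullet> i) + d) has_derivative (\<lambda>h. c * (h \<bullet> i))) (at x)" 
      by (auto intro!: derivative_eq_intros)
    from has_derivative_compose[OF this assms[unfolded has_field_derivative_def]] show ?thesis .
  qed
  { case 0 show ?case using differentiableI[OF d] 
     by (auto intro!: differentiable_imp_continuous_on simp: differentiable_on_def intro: differentiable_at_withinI) }
  { case (Suc n) 
    show ?case 
      by (auto simp: frechet_derivative_eqI[OF d] intro!: differentiableI[OF d] Ck_mult Suc.IH Ck_const) }
qed

text \<open>The functions \<open>e\<^sup>-\<^sup>1\<^sup>/\<^sup>s / s\<^sup>m\<close>, extended by zero to \<open>s \<le> 0\<close>: their span contains \<open>e\<^sup>-\<^sup>1\<^sup>/\<^sup>s\<close> and is closed under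
  differentiation.\<close>

definition flat_exp :: "nat \<Rightarrow> real \<Rightarrow> real" where
  "flat_exp m s = (if s > 0 then exp (- 1 / s) / s ^ m else 0)"

lemma flat_exp_tendsto: "(flat_exp m \<longlongrightarrow> 0) (at_right 0)"
proof -
  have "((\<lambda>x::real. x ^ m / exp x) \<longlongrightarrow> 0) at_top" by (rule tendsto_power_div_exp_0)
  then have "((\<lambda>s::real. inverse s ^ m / exp (inverse s)) \<longlongrightarrow> 0) (at_right 0)"
    by (rule filterlim_compose) (rule filterlim_inverse_at_top_right)
  moreover have "eventually (\<lambda>s::real. s > 0) (at_right 0)" by (simp add: eventually_at_right_less)
  ultimately show ?thesis
    by (elim Lim_transform_eventually)
       (auto elim!: eventually_mono simp: flat_exp_def exp_minus field_simps)
qed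

lemma flat_exp_deriv: "(flat_exp m has_real_derivative flat_exp (m + 2) s - m * flat_exp (Suc m) s) (at s)"
proof -
  consider "s > 0" | "s < 0" | "s = 0" by linarith
  then show ?thesis
  proof cases
    case 1
    have "((\<lambda>s. exp (- 1 / s) / s ^ m) has_real_derivative flat_exp (m + 2) s - m * flat_exp (Suc m) s) (at s)"
    proof (cases m)
      case 0 then show ?thesis using 1 by (auto intro!: derivative_eq_intros simp: flat_exp_def field_simps power2_eq_square)
    next
      case (Suc k)
      have h: "j = 0 \<or> s ^ j = s * s ^ (j - Suc 0)" for j by (cases j) auto
      from Suc show ?thesis using 1
        by (auto intro!: derivative_eq_intros simp: flat_exp_def field_simps power2_eq_square) (metis h)
    qed
    then show ?thesis
      by (rule has_field_derivative_transform_within_open[where S="{0<..}"]) (use 1 in \<open>auto simp: flat_exp_def\<close>)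
  next
    case 2
    have "((\<lambda>s. 0) has_real_derivative 0) (at s)" by simp
    then have "(flat_exp m has_real_derivative 0) (at s)" 
      by (rule has_field_derivative_transform_within_open[where S="{..<0}"]) (use 2 in \<open>auto simp: flat_exp_def\<close>)
    then show ?thesis using 2 by (simp add: flat_exp_def)
  next
    case 3
    have q: "((\<lambda>h. (flat_exp m (0 + h) - flat_exp m 0) / h) \<longlongrightarrow> 0) (at 0)"
    proof (rule filterlim_split_at)
      show "((\<lambda>h. (flat_exp m (0 + h) - flat_exp m 0) / h) \<longlongrightarrow> 0) (at_left 0)"
        by (rule tendsto_eventually) (auto simp: flat_exp_def eventually_at_left_field intro!: exI[of _ "-1"])
      show "((\<lambda>h. (flat_exp m (0 + h) - flat_exp m 0) / h) \<longlongrightarrow> 0) (at_right 0)"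
        using flat_exp_tendsto[of "Suc m"]
        by (rule Lim_transform_eventually) (auto simp: flat_exp_def eventually_at_right_less field_simps intro!: eventually_mono[OF eventually_at_right_less])
    qed
    then have "(flat_exp m has_real_derivative 0) (at 0)" by (simp add: DERIV_def)
    then show ?thesis using 3 by (simp add: flat_exp_def)
  qed
qed

lemma flat_exp_smooth: "\<exists>F. F 0 = flat_exp 0 \<and> (\<forall>n s. (F n has_real_derivative F (Suc n) s) (at s))"
proof -
  define S where "S = {f. \<exists>N c. f = (\<lambda>s. \<Sum>m<N::nat. c m * flat_exp m s)}"
  have step: "\<exists>g. g \<in> S \<and> (\<forall>s. (f has_real_derivative g s) (at s))" if fS: "f \<in> S" for f
  proof -
    from fS obtain N c where f: "f = (\<lambda>s. \<Sum>m<N. c m * flat_exp m s)" by (auto simp: S_def)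
    define g where "g = (\<lambda>s. \<Sum>m<N. c m * (flat_exp (m + 2) s - m * flat_exp (Suc m) s))"
    have "(f has_real_derivative g s) (at s)" for s
      unfolding f g_def by (rule DERIV_sum) (rule DERIV_cmult[OF flat_exp_deriv])
    moreover have "g \<in> S"
    proof -
      have mono: "(\<lambda>s. a * flat_exp m s) \<in> S" for a m
        unfolding S_def
        by (auto intro!: exI[of _ "Suc m"] exI[of _ "\<lambda>k. if k = m then a else 0"] simp: if_distrib[of "\<lambda>x. x * _"] sum.delta cong: if_cong)
      have add: "(\<lambda>s. h s + k s) \<in> S" if "h \<in> S" "k \<in> S" for h k
      proof -
        from that obtain N c M d where "h = (\<lambda>s. \<Sum>m<N. c m * flat_exp m s)" "k = (\<lambda>s. \<Sum>m<M. d m * flat_exp m s)" by (auto simp: S_def)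
        moreover have "(\<Sum>m<N. c m * flat_exp m s) = (\<Sum>m<max N M. (if m < N then c m else 0) * flat_exp m s)" for s
          by (rule sum.mono_neutral_cong_left) auto
        moreover have "(\<Sum>m<M. d m * flat_exp m s) = (\<Sum>m<max N M. (if m < M then d m else 0) * flat_exp m s)" for s
          by (rule sum.mono_neutral_cong_left) auto
        ultimately show ?thesis unfolding S_def
          by (auto intro!: exI[of _ "max N M"] exI[of _ "\<lambda>m. (if m < N then c m else 0) + (if m < M then d m else 0)"] simp: distrib_right sum.distrib)
      qed
      have zero: "(\<lambda>s. 0) \<in> S" using mono[of 0 0] by simp
      have sum: "(\<lambda>s. \<Sum>m<n. h m s) \<in> S" if "\<And>m. h m \<in> S" for h and n :: nat
        by (induction n) (auto intro: zero add that)
      have "c m * (flat_exp (m + 2) s - m * flat_exp (Suc m) s) = c m * flat_exp (m + 2) s + (- c m * m) * flat_exp (Suc m) s" for m s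
        by (simp add: algebra_simps)
      then show ?thesis unfolding g_def by (simp only:) (intro sum add mono)
    qed
    ultimately show ?thesis by blast
  qed
  have "flat_exp 0 \<in> S" unfolding S_def by (auto intro!: exI[of _ "Suc 0"] exI[of _ "\<lambda>_. 1"])
  then obtain F where "\<And>n. F n \<in> S" "F 0 = flat_exp 0" "\<And>n s. (F n has_real_derivative F (Suc n) s) (at s)"
    using dependent_nat_choice[of "\<lambda>n f. f \<in> S \<and> (n = 0 \<longrightarrow> f = flat_exp 0)" "\<lambda>n f g. \<forall>s. (f has_real_derivative g s) (at s)"] step
    by (metis Zero_not_Suc)
  then show ?thesis by auto
qed

text \<open>A product of one-dimensional bumps gives a smooth \<open>B \<ge> 0\<close> that is positive exactly on the open box.
  The functions \<open>1 - exp (- n B)\<close> have the same support and increase to the indicator of the box.\<close>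

lemma test_fun_box_approx:
  fixes a b :: "'a::euclidean_space"
  assumes "cbox a b \<subseteq> U"
  shows "\<exists>\<phi>. (\<forall>n::nat. test_fun U (\<phi> n)) \<and> (\<forall>n x. 0 \<le> \<phi> n x \<and> \<phi> n x \<le> indicator (box a b) x)
     \<and> (\<forall>x. (\<lambda>n. \<phi> n x) \<longlonglongrightarrow> indicator (box a b) x)"
proof -
  obtain F where F0: "F 0 = flat_exp 0" and F: "\<And>n s. (F n has_real_derivative F (Suc n) s) (at s)"
    using flat_exp_smooth by auto
  define B where "B x = (\<Prod>i\<in>Basis. flat_exp 0 (1 * (x \<bullet> i) + (- a \<bullet> i)) * flat_exp 0 (-1 * (x \<bullet> i) + b \<bullet> i))" for x
  have CB: "Ck n B" for n
    unfolding B_def[abs_def] F0[symmetric] by (intro Ck_prod Ck_mult Ck_inner_compose[of F] F finite_Basis)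
  have B0: "B x = 0" if "x \<notin> box a b" for x
  proof -
    from that obtain i where i: "i \<in> Basis" "x \<bullet> i \<le> a \<bullet> i \<or> b \<bullet> i \<le> x \<bullet> i" unfolding mem_box by force
    have "flat_exp 0 (1 * (x \<bullet> i) + (- a \<bullet> i)) * flat_exp 0 (-1 * (x \<bullet> i) + b \<bullet> i) = 0" using i by (auto simp: flat_exp_def)
    then show ?thesis unfolding B_def using i(1) by (intro prod_zero bexI[of _ i]) auto
  qed
  have B1: "B x > 0" if "x \<in> box a b" for x
    unfolding B_def using that by (intro prod_pos) (auto simp: flat_exp_def mem_box)
  have Bnn: "B x \<ge> 0" for x using B0[of x] B1[of x] by (cases "x \<in> box a b") auto
  define \<phi> where "\<phi> n x = 1 + (- 1) * exp ((- real n) * B x)" for n x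
  have "Ck m (\<phi> n)" for m n 
    unfolding \<phi>_def[abs_def] by (intro Ck_add Ck_mult Ck_exp Ck_const CB)
  moreover have z: "\<phi> n x = 0" if "x \<notin> box a b" for n x using B0[OF that] by (simp add: \<phi>_def)
  moreover have cl: "closure {x. \<phi> n x \<noteq> 0} \<subseteq> cbox a b" for n
    using z box_subset_cbox by (intro closure_minimal) blast+
  moreover have "compact (closure {x. \<phi> n x \<noteq> 0})" for n
    using compact_cbox cl by (meson bounded_cbox bounded_subset closed_closure compact_eq_bounded_closed)
  ultimately have tf: "test_fun U (\<phi> n)" for n using assms unfolding test_fun_def by blast
  have "0 \<le> \<phi> n x \<and> \<phi> n x \<le> indicator (box a b) x" for n x
    using z[of x n] Bnn[of x] by (cases "x \<in> box a b") (auto simp: \<phi>_def)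
  moreover have "(\<lambda>n. \<phi> n x) \<longlonglongrightarrow> indicator (box a b) x" for x
  proof (cases "x \<in> box a b")
    case True
    have "norm (exp (- B x)) < 1" using B1[OF True] by (simp only: norm_exp real_norm_def abs_exp_cancel) simp
    then have "(\<lambda>n. exp (- B x) ^ n) \<longlonglongrightarrow> 0" by (rule LIMSEQ_power_zero)
    then have "(\<lambda>n. 1 + (- 1) * exp (- B x) ^ n) \<longlonglongrightarrow> 1 + (- 1) * 0" by (intro tendsto_add tendsto_mult tendsto_const)
    then show ?thesis using True by (simp add: \<phi>_def exp_of_nat_mult[symmetric])
  qed (simp add: z)
  ultimately show ?thesis using tf by (intro exI[of _ \<phi>]) auto
qed

section \<open>Test functions separate locally integrable functions\<close>

lemma ennreal_enn2real_eq: "a \<noteq> top \<Longrightarrow> b \<noteq> top \<Longrightarrow> enn2real a = enn2real b \<Longrightarrow> a = b"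
  by (metis ennreal_enn2real less_top)

lemma ennreal_eq_ennreal_minus_iff: "ennreal a = ennreal (- a) \<longleftrightarrow> a = 0"
  by (cases "a \<ge> 0") (auto simp: ennreal_neg)

text \<open>The measures with densities \<open>max 0 F\<close> and \<open>max 0 (- F)\<close> agree on boxes, hence everywhere, and
  densities are unique almost everywhere.\<close>

lemma box_integrals_zero_imp_AE_zero:
  fixes F :: "'a::euclidean_space \<Rightarrow> real"
  assumes F: "integrable lborel F" and box: "\<And>a b. (\<integral>x. indicator (box a b) x * F x \<partial>lborel) = 0"
  shows "AE x in lborel. F x = 0"
proof -
  have [measurable]: "F \<in> borel_measurable borel" using F by auto
  have fin: "(\<integral>\<^sup>+x. ennreal (F x) \<partial>lborel) < \<infinity>" "(\<integral>\<^sup>+x. ennreal (- F x) \<partial>lborel) < \<infinity>"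
    using F integrableD(2)[OF F] integrableD(3)[OF F] by (simp_all add: less_top)
  have "density lborel (\<lambda>x. ennreal (F x)) = density lborel (\<lambda>x. ennreal (- F x))"
  proof (rule measure_eqI_generator_eq)
    let ?E = "range (\<lambda>(a, b). box a b::'a set)"
    show "Int_stable ?E"
      by (auto simp: Int_stable_def box_Int_box)
    show "?E \<subseteq> Pow UNIV" "sets (density lborel (\<lambda>x. ennreal (F x))) = sigma_sets UNIV ?E" 
         "sets (density lborel (\<lambda>x. ennreal (- F x))) = sigma_sets UNIV ?E"
      by (simp_all add: borel_eq_box)
    let ?A = "\<lambda>n::nat. box (- (real n *\<^sub>R One)) (real n *\<^sub>R One) :: 'a set"
    show "range ?A \<subseteq> ?E" "(\<Union>i. ?A i) = UNIV"
      unfolding UN_box_eq_UNIV by auto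
    show "emeasure (density lborel (\<lambda>x. ennreal (F x))) (?A i) \<noteq> \<infinity>" for i 
    proof -
      have "emeasure (density lborel (\<lambda>x. ennreal (F x))) (?A i) \<le> (\<integral>\<^sup>+x. ennreal (F x) \<partial>lborel)"
        by (subst emeasure_density) (auto intro!: nn_integral_mono split: split_indicator)
      then show ?thesis using fin by auto
    qed
    show "emeasure (density lborel (\<lambda>x. ennreal (F x))) X = emeasure (density lborel (\<lambda>x. ennreal (- F x))) X" if "X \<in> ?E" for X
    proof -
      from that obtain a b where X: "X = box a b" by auto
      let ?G = "\<lambda>x. indicator X x * F x"
      have G: "integrable lborel ?G" using integrable_real_mult_indicator[OF _ F, of X] X by (simp add: mult.commute)
      have "integral\<^sup>L lborel ?G = enn2real (\<integral>\<^sup>+x. ennreal (?G x) \<partial>lborel) - enn2real (\<integral>\<^sup>+x. ennreal (- ?G x) \<partial>lborel)"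
        by (rule real_lebesgue_integral_def[OF G])
      moreover have "(\<integral>\<^sup>+x. ennreal (?G x) \<partial>lborel) \<noteq> \<infinity>" "(\<integral>\<^sup>+x. ennreal (- ?G x) \<partial>lborel) \<noteq> \<infinity>"
        using integrableD(2)[OF G] integrableD(3)[OF G] by auto
      ultimately have "(\<integral>\<^sup>+x. ennreal (?G x) \<partial>lborel) = (\<integral>\<^sup>+x. ennreal (- ?G x) \<partial>lborel)"
        using box[of a b] unfolding X[symmetric] by (simp add: ennreal_enn2real_eq)
      moreover have "ennreal (?G x) = ennreal (F x) * indicator X x" "ennreal (- ?G x) = ennreal (- F x) * indicator X x" for x
        by (auto split: split_indicator)
      ultimately show ?thesis using X by (simp add: emeasure_density)
    qed
  qed
  then have "AE x in lborel. ennreal (F x) = ennreal (- F x)"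
    by (intro sigma_finite_measure.density_unique[OF sigma_finite_lborel]) auto
  then show ?thesis
    by (simp add: ennreal_eq_ennreal_minus_iff)
qed

text \<open>The fundamental lemma of the calculus of variations. Test functions increasing to the indicator of a
  box turn the hypothesis into vanishing integrals of \<open>f\<close> over boxes; countably many closed boxes exhaust \<open>U\<close>.\<close>

lemma test_funs_separate:
  fixes f :: "'a::euclidean_space \<Rightarrow> real"
  assumes U: "open U" and f: "loc_integrable U f"
    and orth: "\<And>\<phi>. test_fun U \<phi> \<Longrightarrow> (LINT x:U|lebesgue. f x * \<phi> x) = 0"
  shows "AE x in lebesgue. x \<in> U \<longrightarrow> f x = 0"
proof -
  have *: "AE x in lebesgue. x \<in> cbox a b \<longrightarrow> f x = 0" if ab: "cbox a b \<subseteq> U" for a b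
  proof -
    let ?F = "\<lambda>x. indicator (box a b) x * f x"
    have int: "set_integrable lebesgue (cbox a b) f" using f ab by (auto simp: loc_integrable_def)
    then have F: "integrable lebesgue ?F"
    proof -
      have "set_integrable lebesgue (box a b) f" using int by (rule set_integrable_subset) (auto simp: box_subset_cbox)
      then show ?thesis by (simp add: set_integrable_def)
    qed
    then obtain G where G[measurable]: "G \<in> borel_measurable lborel" and FG: "AE x in lborel. ?F x = G x"
      using completion_ex_borel_measurable_real[of ?F lborel] by auto
    have FG': "AE x in lebesgue. ?F x = G x" using FG by (rule AE_completion)
    have Gl: "G \<in> borel_measurable lebesgue" using G by (rule measurable_completion)
    have Gi: "integrable lborel G"
      using integrable_cong_AE[OF borel_measurable_integrable[OF F] Gl FG'] F integrable_completion[OF G] by simp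
    have "(\<integral>x. indicator (box c d) x * G x \<partial>lborel) = 0" for c d
    proof -
      \<comment> \<open>The intersection of two boxes is the box from \<open>c'\<close> to \<open>d'\<close>, whose closure stays in \<open>U\<close>.\<close>
      define c' where "c' = (\<Sum>i\<in>Basis. max (a \<bullet> i) (c \<bullet> i) *\<^sub>R i)"
      define d' where "d' = (\<Sum>i\<in>Basis. min (b \<bullet> i) (d \<bullet> i) *\<^sub>R i)"
      have i: "box a b \<inter> box c d = box c' d'" unfolding c'_def d'_def box_Int_box ..
      have ind: "indicator (box c d) x * ?F x = indicator (box c' d') x * f x" for x
        using i by (auto split: split_indicator)
      have "(\<integral>x. indicator (box c d) x * G x \<partial>lborel) = (\<integral>x. indicator (box c d) x * G x \<partial>lebesgue)"
        by (rule integral_completion[symmetric]) measurable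
      also have "\<dots> = (\<integral>x. indicator (box c d) x * ?F x \<partial>lebesgue)"
      proof (rule integral_cong_AE)
        have mI: "(\<lambda>x. indicator (box c d) x :: real) \<in> borel_measurable lebesgue" by (intro borel_measurable_indicator) simp
        show "(\<lambda>x. indicator (box c d) x * G x) \<in> borel_measurable lebesgue" by (intro borel_measurable_times mI Gl)
        show "(\<lambda>x. indicator (box c d) x * ?F x) \<in> borel_measurable lebesgue" 
          by (intro borel_measurable_times[OF mI borel_measurable_integrable[OF F]])
        show "AE x in lebesgue. indicator (box c d) x * G x = indicator (box c d) x * ?F x" using FG' by eventually_elim simp
      qed
      also have "\<dots> = (\<integral>x. indicator (box c' d') x * f x \<partial>lebesgue)" by (simp only: ind)
      also have "\<dots> = 0"
      proof (cases "box c' d' = {}")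
        case False
        have "cbox c' d' = closure (box c' d')" using False by (simp add: closure_box)
        also have "\<dots> \<subseteq> cbox a b" using i box_subset_cbox by (intro closure_minimal) blast+
        finally have sub: "cbox c' d' \<subseteq> cbox a b" .
        then have "cbox c' d' \<subseteq> U" using ab by blast
        from test_fun_box_approx[OF this] obtain \<phi> where \<phi>: "\<And>n::nat. test_fun U (\<phi> n)" 
          "\<And>n x. 0 \<le> \<phi> n x" "\<And>n x. \<phi> n x \<le> indicator (box c' d') x" "\<And>x. (\<lambda>n. \<phi> n x) \<longlonglongrightarrow> indicator (box c' d') x" by auto
        have out: "\<phi> n x = 0" if "x \<notin> box c' d'" for n x using \<phi>(2)[of n x] \<phi>(3)[of n x] that by simp
        have cont: "continuous_on UNIV (\<phi> n)" for n using \<phi>(1)[of n] unfolding test_fun_def by (metis Ck.simps(1))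
        have eq: "(LINT x:U|lebesgue. f x * \<phi> n x) = (\<integral>x. \<phi> n x * (indicator (box c' d') x * f x) \<partial>lebesgue)" for n
          unfolding set_lebesgue_integral_def 
          using out[of _ n] \<open>cbox c' d' \<subseteq> U\<close> box_subset_cbox[of c' d']
          by (intro Bochner_Integration.integral_cong) (auto split: split_indicator)
        have Fi: "integrable lebesgue (\<lambda>x. indicator (box c' d') x * f x)"
        proof -
          have "set_integrable lebesgue (box c' d') f" using int by (rule set_integrable_subset) (use sub box_subset_cbox in auto)
          then show ?thesis by (simp add: set_integrable_def)
        qed
        have "(\<lambda>n. \<integral>x. \<phi> n x * (indicator (box c' d') x * f x) \<partial>lebesgue) \<longlonglongrightarrow> (\<integral>x. indicator (box c' d') x * (indicator (box c' d') x * f x) \<partial>lebesgue)"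
        proof (rule integral_dominated_convergence[where w = "\<lambda>x. norm (indicator (box c' d') x * f x)"])
          show "AE x in lebesgue. (\<lambda>n. \<phi> n x * (indicator (box c' d') x * f x)) \<longlonglongrightarrow> indicator (box c' d') x * (indicator (box c' d') x * f x)"
            by (intro AE_I2 tendsto_intros \<phi>)
          show "AE x in lebesgue. norm (\<phi> n x * (indicator (box c' d') x * f x)) \<le> norm (indicator (box c' d') x * f x)" for n
          proof (intro AE_I2)
            fix x
            have "\<bar>\<phi> n x\<bar> \<le> 1" using \<phi>(2)[of n x] \<phi>(3)[of n x] by (auto split: split_indicator_asm)
            then show "norm (\<phi> n x * (indicator (box c' d') x * f x)) \<le> norm (indicator (box c' d') x * f x)"
              by (simp add: abs_mult mult_left_le_one_le)
          qed
          show "(\<lambda>x. \<phi> n x * (indicator (box c' d') x * f x)) \<in> borel_measurable lebesgue" for n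
            by (intro borel_measurable_times borel_measurable_integrable[OF Fi] measurable_completion) 
              (auto intro!: borel_measurable_continuous_onI cont)
          show "(\<lambda>x. indicator (box c' d') x * (indicator (box c' d') x * f x)) \<in> borel_measurable lebesgue"
            by (intro borel_measurable_times borel_measurable_integrable[OF Fi] borel_measurable_indicator) simp
        qed (use Fi in auto)
        then have "(\<integral>x. indicator (box c' d') x * (indicator (box c' d') x * f x) \<partial>lebesgue) = 0"
          using orth[OF \<phi>(1)] by (simp add: eq[symmetric] LIMSEQ_const_iff)
        then show ?thesis by (simp add: mult.assoc[symmetric] indicator_inter_arith[symmetric])
      qed simp
      finally show ?thesis .
    qed
    then have "AE x in lborel. G x = 0" by (intro box_integrals_zero_imp_AE_zero Gi)
    then have "AE x in lebesgue. G x = 0" by (rule AE_completion)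
    moreover have "AE x in lebesgue. x \<notin> cbox a b - box a b"
      using negligible_frontier_interval[of a b] by (intro AE_not_in) (simp add: negligible_iff_null_sets)
    ultimately show ?thesis using FG' by eventually_elim (auto split: split_indicator_asm)
  qed
  obtain \<D> where D: "countable \<D>" "\<D> \<subseteq> Pow U" "\<And>X. X \<in> \<D> \<Longrightarrow> \<exists>a b. X = cbox a b" "\<Union>\<D> = U"
    by (rule open_countable_Union_open_cbox[OF U]) blast
  have "AE x in lebesgue. \<forall>X\<in>\<D>. x \<in> X \<longrightarrow> f x = 0"
    using D(2,3) * by (subst AE_ball_countable[OF D(1)]) blast
  then show ?thesis by eventually_elim (use D(4) in blast)
qed

section \<open>Increments as line integrals of the weak gradient\<close>

lemma cball_borel [measurable]: "cball a r \<in> sets (borel :: 'a::euclidean_space measure)"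
  by simp

lemma nn_integral_lborel_shift:
  fixes f :: "'a::euclidean_space \<Rightarrow> ennreal"
  assumes [measurable]: "f \<in> borel_measurable borel"
  shows "(\<integral>\<^sup>+x. f (x + c) \<partial>lborel) = (\<integral>\<^sup>+x. f x \<partial>lborel)"
  by (subst lborel_distr_plus[of c, symmetric]) (simp add: nn_integral_distr add.commute)

lemma integral_lborel_shift:
  fixes f :: "'a::euclidean_space \<Rightarrow> real"
  assumes [measurable]: "f \<in> borel_measurable borel"
  shows "(\<integral>x. f (x + c) \<partial>lborel) = (\<integral>x. f x \<partial>lborel)"
  by (subst lborel_distr_plus[of c, symmetric]) (simp add: integral_distr add.commute)

lemma integrable_lborel_shift:
  fixes f :: "'a::euclidean_space \<Rightarrow> real"
  assumes f: "integrable lborel f"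
  shows "integrable lborel (\<lambda>x. f (x + c))"
proof -
  have [measurable]: "f \<in> borel_measurable borel" using f by auto
  have "(\<integral>\<^sup>+x. norm (f (x + c)) \<partial>lborel) = (\<integral>\<^sup>+x. norm (f x) \<partial>lborel)"
    by (rule nn_integral_lborel_shift[of "\<lambda>x. ennreal (norm (f x))"]) simp
  then show ?thesis using f unfolding integrable_iff_bounded by simp
qed

lemma frechet_derivative_shift:
  assumes "\<And>x. f differentiable (at x)"
  shows "frechet_derivative (\<lambda>x. f (x + c)) (at x) = frechet_derivative f (at (x + c))"
    and "(\<lambda>x. f (x + c)) differentiable (at x)"
proof -
  have "((\<lambda>x. x + c) has_derivative (\<lambda>h. h)) (at x)" by (auto intro!: derivative_eq_intros)
  from has_derivative_compose[OF this frechet_derivative_works[THEN iffD1, OF assms[of "x + c"]]]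
  have d: "((\<lambda>x. f (x + c)) has_derivative frechet_derivative f (at (x + c))) (at x)" .
  show "frechet_derivative (\<lambda>x. f (x + c)) (at x) = frechet_derivative f (at (x + c))"
    by (rule frechet_derivative_eqI[OF d])
  show "(\<lambda>x. f (x + c)) differentiable (at x)" by (rule differentiableI[OF d])
qed

lemma Ck_shift: "Ck n f \<Longrightarrow> Ck n (\<lambda>x. f (x + c))"
proof (induction n arbitrary: f)
  case 0 then show ?case by (auto intro!: continuous_on_compose2[of UNIV f] continuous_intros)
next
  case (Suc n) 
  then have d: "\<And>x. f differentiable (at x)" by simp
  have "Ck n (\<lambda>x. frechet_derivative f (at (x + c)) b)" if "b \<in> Basis" for b
    using Suc.IH[of "\<lambda>x. frechet_derivative f (at x) b"] Suc.prems that by simp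
  then show ?case by (simp add: frechet_derivative_shift[OF d])
qed

lemma test_fun_shift:
  assumes "test_fun UNIV \<phi>" shows "test_fun UNIV (\<lambda>x. \<phi> (x + c))"
proof -
  have "bounded (closure {x. \<phi> x \<noteq> 0})" using assms by (auto simp: test_fun_def compact_imp_bounded)
  then have "bounded {x. \<phi> x \<noteq> 0}" by (rule bounded_subset) (rule closure_subset)
  then have "bounded ((\<lambda>x. - c + x) ` {x. \<phi> x \<noteq> 0})" by (rule bounded_translation)
  moreover have "{x. \<phi> (x + c) \<noteq> 0} \<subseteq> (\<lambda>x. - c + x) ` {x. \<phi> x \<noteq> 0}"
    by (auto intro!: image_eqI[of _ _ "_ + c"])
  ultimately have "bounded {x. \<phi> (x + c) \<noteq> 0}" by (rule bounded_subset)
  then show ?thesis using assms by (auto simp: test_fun_def Ck_shift compact_eq_bounded_closed)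
qed

lemma test_fun_differentiable: "test_fun U \<phi> \<Longrightarrow> \<phi> differentiable (at x)"
  unfolding test_fun_def by (metis Ck.simps(2))

lemma test_fun_continuous: "test_fun U \<phi> \<Longrightarrow> continuous_on UNIV \<phi>"
  unfolding test_fun_def by (metis Ck.simps(1))

lemma frechet_derivative_zero_outside_support:
  assumes "x \<notin> closure {x. \<phi> x \<noteq> 0}"
  shows "frechet_derivative \<phi> (at x) = (\<lambda>_. 0)"
proof -
  have "((\<lambda>x. 0) has_derivative (\<lambda>_. 0)) (at x)" by simp
  then have "(\<phi> has_derivative (\<lambda>_. 0)) (at x)"
    by (rule has_derivative_transform_within_open[where s="- closure {x. \<phi> x \<noteq> 0}"])
       (use assms closure_subset[of "{x. \<phi> x \<noteq> 0}"] in auto)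
  then show ?thesis by (rule frechet_derivative_eqI)
qed

lemma test_fun_frechet_derivative_expand:
  assumes "test_fun U \<phi>"
  shows "frechet_derivative \<phi> (at x) h = (\<Sum>b\<in>Basis. (h \<bullet> b) * frechet_derivative \<phi> (at x) b)"
proof -
  interpret linear "frechet_derivative \<phi> (at x)"
    by (rule linear_frechet_derivative) (rule test_fun_differentiable[OF assms])
  have "frechet_derivative \<phi> (at x) (\<Sum>b\<in>Basis. (h \<bullet> b) *\<^sub>R b) = (\<Sum>b\<in>Basis. (h \<bullet> b) * frechet_derivative \<phi> (at x) b)"
    by (simp only: sum scaleR real_scaleR_def)
  then show ?thesis by (simp only: euclidean_representation)
qed

lemma test_fun_derivative_continuous:
  assumes "test_fun U \<phi>"
  shows "continuous_on UNIV (\<lambda>x. frechet_derivative \<phi> (at x) h)"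
proof -
  have "Ck 1 \<phi>" using assms by (auto simp: test_fun_def)
  then have "continuous_on UNIV (\<lambda>x. frechet_derivative \<phi> (at x) b)" if "b \<in> Basis" for b using that by simp
  then show ?thesis unfolding test_fun_frechet_derivative_expand[OF assms, of _ h]
    by (intro continuous_on_sum continuous_on_mult continuous_on_const)
qed

lemma continuous_zero_off_ball_bounded:
  fixes f :: "'a::euclidean_space \<Rightarrow> real"
  assumes "continuous_on UNIV f" "\<And>x. R < norm x \<Longrightarrow> f x = 0"
  obtains B where "B \<ge> 0" "\<And>x. \<bar>f x\<bar> \<le> B"
proof -
  have "bounded (f ` cball 0 R)"
    using assms(1) by (intro compact_imp_bounded compact_continuous_image) (auto intro: continuous_on_subset)
  then obtain B where B: "\<And>x. norm x \<le> R \<Longrightarrow> \<bar>f x\<bar> \<le> B" by (fastforce simp: bounded_iff)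
  have "\<bar>f x\<bar> \<le> max B 0" for x using B[of x] assms(2)[of x] by (cases "norm x \<le> R") auto
  then show ?thesis using that[of "max B 0"] by auto
qed

lemma test_fun_support_ball:
  fixes \<phi> :: "'a::euclidean_space \<Rightarrow> real"
  assumes "test_fun UNIV \<phi>"
  obtains R where "R > 0" "\<And>x. R < norm x \<Longrightarrow> \<phi> x = 0" "\<And>x v. R < norm x \<Longrightarrow> frechet_derivative \<phi> (at x) v = 0"
proof -
  have "bounded (closure {x. \<phi> x \<noteq> 0})" using assms by (auto simp: test_fun_def compact_imp_bounded)
  then obtain R where R: "R > 0" "closure {x. \<phi> x \<noteq> 0} \<subseteq> cball 0 R" 
    by (auto simp: bounded_pos subset_eq)
  then have "x \<notin> closure {x. \<phi> x \<noteq> 0}" if "R < norm x" for x using that by auto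
  moreover then have "\<phi> x = 0" if "R < norm x" for x using that closure_subset[of "{x. \<phi> x \<noteq> 0}"] by blast
  ultimately show ?thesis using that[of R] R(1) frechet_derivative_zero_outside_support[of _ \<phi>] by metis
qed

text \<open>The form in which local integrability is used: products with bounded functions that vanish outside a
  ball are integrable.\<close>

lemma integrable_times_bounded_on_ball:
  fixes u f :: "'a::euclidean_space \<Rightarrow> real"
  assumes [measurable]: "u \<in> borel_measurable borel" "f \<in> borel_measurable borel"
    and u: "set_integrable lborel (cball 0 R) u"
    and f: "\<And>x. R < norm x \<Longrightarrow> f x = 0" "\<And>x. \<bar>f x\<bar> \<le> B"
  shows "integrable lborel (\<lambda>x. u x * f x)"
proof (rule Bochner_Integration.integrable_bound)
  show "integrable lborel (\<lambda>x. B * (indicator (cball 0 R) x *\<^sub>R u x))"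
    using u by (intro integrable_mult_right) (simp add: set_integrable_def)
  show "AE x in lborel. norm (u x * f x) \<le> norm (B * (indicator (cball 0 R) x *\<^sub>R u x))"
  proof (rule AE_I2)
    fix x show "norm (u x * f x) \<le> norm (B * (indicator (cball 0 R) x *\<^sub>R u x))"
      using f(1)[of x] f(2)[of x] 
      by (cases "R < norm x") (auto simp: abs_mult mult.commute intro!: mult_right_mono)
  qed
qed measurable

text \<open>A weakly differentiable function on the whole space with its gradient, given by Borel representatives
  and Lebesgue-Borel integrals, so that Fubini and translations apply directly.\<close>

locale borel_weak_gradient =
  fixes u :: "'a::euclidean_space \<Rightarrow> real" and g :: "'a \<Rightarrow> 'a"
  assumes u_borel [measurable]: "u \<in> borel_measurable borel"
    and g_borel [measurable]: "g \<in> borel_measurable borel"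
    and u_loc: "\<And>R. set_integrable lborel (cball 0 R) u"
    and g_loc: "\<And>R. set_integrable lborel (cball 0 R) g"
    and weak: "\<And>\<phi> b. test_fun UNIV \<phi> \<Longrightarrow> b \<in> Basis \<Longrightarrow> 
       (\<integral>x. u x * frechet_derivative \<phi> (at x) b \<partial>lborel) = - (\<integral>x. (g x \<bullet> b) * \<phi> x \<partial>lborel)"
begin

lemma gradient_component_integrable_on_ball: "set_integrable lborel (cball 0 R) (\<lambda>x. g x \<bullet> b)"
proof -
  have "integrable lborel (\<lambda>x. (indicator (cball 0 R) x *\<^sub>R g x) \<bullet> b)"
    using g_loc[of R] unfolding set_integrable_def by (rule integrable_inner_left)
  then show ?thesis by (simp add: set_integrable_def)
qed

text \<open>Test functions are linear in the direction of differentiation, so the defining identity extends from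
  basis vectors to all directions.\<close>

lemma weak_directional:
  assumes \<phi>: "test_fun UNIV \<phi>"
  shows "(\<integral>x. u x * frechet_derivative \<phi> (at x) h \<partial>lborel) = - (\<integral>x. (g x \<bullet> h) * \<phi> x \<partial>lborel)"
proof -
  obtain R where R: "R > 0" "\<And>x. R < norm x \<Longrightarrow> \<phi> x = 0" "\<And>x v. R < norm x \<Longrightarrow> frechet_derivative \<phi> (at x) v = 0"
    using test_fun_support_ball[OF \<phi>] by blast
  have i1: "integrable lborel (\<lambda>x. u x * frechet_derivative \<phi> (at x) b)" for b
  proof -
    obtain B where "\<And>x. \<bar>frechet_derivative \<phi> (at x) b\<bar> \<le> B"
      using continuous_zero_off_ball_bounded[OF test_fun_derivative_continuous[OF \<phi>] R(3)] by metis
    then show ?thesis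
      by (intro integrable_times_bounded_on_ball[OF u_borel _ u_loc R(3)] borel_measurable_continuous_onI test_fun_derivative_continuous[OF \<phi>])
  qed
  have i2: "integrable lborel (\<lambda>x. (g x \<bullet> b) * \<phi> x)" for b
  proof -
    obtain B where "\<And>x. \<bar>\<phi> x\<bar> \<le> B"
      using continuous_zero_off_ball_bounded[OF test_fun_continuous[OF \<phi>] R(2)] by metis
    then show ?thesis
      by (intro integrable_times_bounded_on_ball[OF _ borel_measurable_continuous_onI[OF test_fun_continuous[OF \<phi>]] gradient_component_integrable_on_ball R(2)]) auto
  qed
  have "(\<integral>x. u x * frechet_derivative \<phi> (at x) h \<partial>lborel) 
      = (\<integral>x. (\<Sum>b\<in>Basis. (h \<bullet> b) * (u x * frechet_derivative \<phi> (at x) b)) \<partial>lborel)"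
    unfolding test_fun_frechet_derivative_expand[OF \<phi>, of _ h] by (simp add: sum_distrib_left mult.left_commute)
  also have "\<dots> = (\<Sum>b\<in>Basis. (h \<bullet> b) * (\<integral>x. u x * frechet_derivative \<phi> (at x) b \<partial>lborel))"
    by (subst Bochner_Integration.integral_sum) (auto intro: i1)
  also have "\<dots> = (\<Sum>b\<in>Basis. (h \<bullet> b) * - (\<integral>x. (g x \<bullet> b) * \<phi> x \<partial>lborel))"
    by (intro sum.cong refl) (simp add: weak[OF \<phi>])
  also have "\<dots> = - (\<integral>x. (\<Sum>b\<in>Basis. (h \<bullet> b) * ((g x \<bullet> b) * \<phi> x)) \<partial>lborel)"
    by (subst Bochner_Integration.integral_sum) (auto intro: i2 simp: sum_negf)
  also have "(\<lambda>x. \<Sum>b\<in>Basis. (h \<bullet> b) * ((g x \<bullet> b) * \<phi> x)) = (\<lambda>x. (g x \<bullet> h) * \<phi> x)"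
    by (rule ext, subst (3) euclidean_inner) (simp add: sum_distrib_left sum_distrib_right mult_ac)
  finally show ?thesis .
qed

lemma integrable_along_segments:
  "integrable (lborel \<Otimes>\<^sub>M lborel) (\<lambda>(x, t::real). indicator {0..1} t * (indicator (cball 0 R) x * (g (x - t *\<^sub>R h) \<bullet> h)))"
   (is "integrable _ ?A")
proof (rule integrableI_bounded)
  show "?A \<in> borel_measurable (lborel \<Otimes>\<^sub>M lborel)" by measurable
  let ?K = "cball 0 (R + norm h) :: 'a set"
  let ?I = "\<integral>\<^sup>+x. ennreal (norm (indicator ?K x *\<^sub>R (g x \<bullet> h))) \<partial>lborel"
  have I: "?I < \<infinity>" using gradient_component_integrable_on_ball[of "R + norm h" h] by (simp add: set_integrable_def integrable_iff_bounded)
  have "(\<integral>\<^sup>+z. ennreal (norm (?A z)) \<partial>(lborel \<Otimes>\<^sub>M lborel)) 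
      = (\<integral>\<^sup>+t. \<integral>\<^sup>+x. ennreal (norm (?A (x, t))) \<partial>lborel \<partial>lborel)"
    by (rule lborel_pair.nn_integral_snd[symmetric]) measurable
  also have "\<dots> \<le> (\<integral>\<^sup>+t. indicator {0..1} (t::real) * ?I \<partial>lborel)"
  proof (rule nn_integral_mono)
    fix t :: real
    show "(\<integral>\<^sup>+x. ennreal (norm (?A (x, t))) \<partial>lborel) \<le> indicator {0..1} t * ?I"
    proof (cases "t \<in> {0..1}")
      case True
      have *: "norm (?A (x, t)) \<le> norm (indicator ?K (x - t *\<^sub>R h) *\<^sub>R (g (x - t *\<^sub>R h) \<bullet> h))" for x
      proof (cases "x \<in> cball 0 R")
        case T2: True
        have "norm (t *\<^sub>R h) \<le> norm h" using True by (simp add: mult_left_le_one_le)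
        then have "norm (x - t *\<^sub>R h) \<le> R + norm h" using T2 norm_triangle_ineq4[of x "t *\<^sub>R h"] by simp
        then show ?thesis using True T2 by simp
      qed simp
      have "(\<integral>\<^sup>+x. ennreal (norm (?A (x, t))) \<partial>lborel) \<le> (\<integral>\<^sup>+x. ennreal (norm (indicator ?K (x + - t *\<^sub>R h) *\<^sub>R (g (x + - t *\<^sub>R h) \<bullet> h))) \<partial>lborel)"
        by (intro nn_integral_mono ennreal_leI) (use * in simp)
      also have "\<dots> = ?I" by (rule nn_integral_lborel_shift[of "\<lambda>x. ennreal (norm (indicator ?K x *\<^sub>R (g x \<bullet> h)))"]) measurable
      finally show ?thesis using True by simp
    qed simp
  qed
  also have "\<dots> = ?I" by (simp add: nn_integral_multc)
  finally show "(\<integral>\<^sup>+z. ennreal (norm (?A z)) \<partial>(lborel \<Otimes>\<^sub>M lborel)) < \<infinity>" using I by (rule le_less_trans)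
qed

lemma integrable_on_segment_AE:
  "AE x in lborel. integrable lborel (\<lambda>t::real. indicator {0..1} t * (g (x - t *\<^sub>R h) \<bullet> h))"
proof -
  have "AE x in lborel. \<forall>n::nat. integrable lborel (\<lambda>t::real. indicator {0..1} t * (indicator (cball 0 (real n)) x * (g (x - t *\<^sub>R h) \<bullet> h)))"
    unfolding AE_all_countable using lborel_pair.AE_integrable_fst[OF integrable_along_segments] by simp
  then show ?thesis
  proof eventually_elim
    case (elim x)
    obtain n :: nat where "norm x \<le> n" using real_arch_simple by blast
    then show ?case using elim[rule_format, of n] by simp
  qed
qed

text \<open>Test both sides with \<open>\<phi>\<close>. The fundamental theorem of calculus for \<open>t \<mapsto> \<phi> (x + t h)\<close>, Fubini and the weak
  derivative of \<open>u\<close> turn \<open>\<integral> u (x) (\<phi> (x + h) - \<phi> x) dx\<close> into \<open>- \<integral> \<phi> x \<integral>\<^sub>0\<^sup>1 g (x - t h) \<bullet> h dt dx\<close>, and test functions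
  separate locally integrable functions. This gives information about increments without approximating \<open>u\<close>
  by smooth functions.\<close>

lemma difference_eq_line_integral:
  "AE x in lborel. u x - u (x - h) = (\<integral>t. indicator {0..1} t * (g (x - t *\<^sub>R h) \<bullet> h) \<partial>lborel)"
proof -
  define J where "J x = (\<integral>t. indicator {0..1::real} t * (g (x - t *\<^sub>R h) \<bullet> h) \<partial>lborel)" for x
  have Jm[measurable]: "J \<in> borel_measurable borel" unfolding J_def[abs_def] by measurable
  have Jint: "set_integrable lborel (cball 0 R) J" for R
  proof -
    have "integrable lborel (\<lambda>x. \<integral>t. indicator {0..1} t * (indicator (cball 0 R) x * (g (x - t *\<^sub>R h) \<bullet> h)) \<partial>lborel)"
      using lborel_pair.integrable_fst[OF integrable_along_segments] by simp
    moreover have "(\<integral>t. indicator {0..1} t * (indicator (cball 0 R) x * (g (x - t *\<^sub>R h) \<bullet> h)) \<partial>lborel) = indicator (cball 0 R) x *\<^sub>R J x" for x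
      unfolding J_def by (simp only: mult.left_commute[of _ "indicator (cball 0 R) x"] integral_mult_right_zero real_scaleR_def)
    ultimately show ?thesis by (simp add: set_integrable_def)
  qed
  define d where "d x = u x - u (x - h) - J x" for x
  have dm[measurable]: "d \<in> borel_measurable borel" unfolding d_def by measurable
  have us: "set_integrable lborel (cball 0 R) (\<lambda>x. u (x - h))" for R
  proof -
    have "integrable lborel (\<lambda>x. indicator (cball 0 (R + norm h)) (x + - h) *\<^sub>R u (x + - h))"
      using u_loc[of "R + norm h"] unfolding set_integrable_def by (rule integrable_lborel_shift)
    then have "set_integrable lborel {x. x - h \<in> cball 0 (R + norm h)} (\<lambda>x. u (x - h))"
      unfolding set_integrable_def by (rule Bochner_Integration.integrable_cong[THEN iffD1, rotated -1]) (auto split: split_indicator)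
    then show ?thesis
      by (rule set_integrable_subset) (auto intro: order_trans[OF norm_triangle_ineq4])
  qed
  have dint: "set_integrable lborel (cball 0 R) d" for R
    unfolding d_def by (intro set_integral_diff u_loc us Jint)
  have "loc_integrable UNIV d"
    unfolding loc_integrable_def
  proof (intro allI impI)
    fix K :: "'a set" assume K: "compact K \<and> K \<subseteq> UNIV"
    then obtain R where "K \<subseteq> cball 0 R" by (metis bounded_pos compact_imp_bounded mem_cball_0 subsetI)
    moreover have "set_integrable lebesgue (cball 0 R) d" 
      using dint[of R] unfolding set_integrable_def by (subst integrable_completion) auto
    moreover have "K \<in> sets lebesgue" using K by (simp add: borel_compact sets_completionI_sets)
    ultimately show "set_integrable lebesgue K d" by (metis set_integrable_subset)
  qed
  moreover have "(LINT x:UNIV|lebesgue. d x * \<phi> x) = 0" if \<phi>: "test_fun UNIV \<phi>" for \<phi>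
  proof -
    obtain R where R: "R > 0" "\<And>x. R < norm x \<Longrightarrow> \<phi> x = 0" "\<And>x v. R < norm x \<Longrightarrow> frechet_derivative \<phi> (at x) v = 0"
      using test_fun_support_ball[OF \<phi>] by blast
    obtain B where B: "B \<ge> 0" "\<And>x. \<bar>\<phi> x\<bar> \<le> B"
      using continuous_zero_off_ball_bounded[OF test_fun_continuous[OF \<phi>] R(2)] by metis
    obtain B' where B': "B' \<ge> 0" "\<And>x. \<bar>frechet_derivative \<phi> (at x) h\<bar> \<le> B'"
      using continuous_zero_off_ball_bounded[OF test_fun_derivative_continuous[OF \<phi>] R(3)] by metis
    have [measurable]: "\<phi> \<in> borel_measurable borel" 
      by (rule borel_measurable_continuous_onI[OF test_fun_continuous[OF \<phi>]])
    have [measurable]: "(\<lambda>x. frechet_derivative \<phi> (at x) h) \<in> borel_measurable borel" 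
      by (rule borel_measurable_continuous_onI[OF test_fun_derivative_continuous[OF \<phi>]])
    let ?I = "indicator {0..1} :: real \<Rightarrow> real"
    have i1: "integrable (lborel \<Otimes>\<^sub>M lborel) (\<lambda>(x, t). ?I t * (\<phi> x * (g (x - t *\<^sub>R h) \<bullet> h)))"
    proof (rule Bochner_Integration.integrable_bound)
      show "integrable (lborel \<Otimes>\<^sub>M lborel) (\<lambda>z. B * (case z of (x, t) \<Rightarrow> ?I t * (indicator (cball 0 R) x * (g (x - t *\<^sub>R h) \<bullet> h))))"
        by (intro integrable_mult_right integrable_along_segments)
      show "AE z in lborel \<Otimes>\<^sub>M lborel. norm (case z of (x, t) \<Rightarrow> ?I t * (\<phi> x * (g (x - t *\<^sub>R h) \<bullet> h)))
          \<le> norm (B * (case z of (x, t) \<Rightarrow> ?I t * (indicator (cball 0 R) x * (g (x - t *\<^sub>R h) \<bullet> h))))"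
      proof (rule AE_I2, clarsimp)
        fix x t show "\<bar>?I t * (\<phi> x * (g (x - t *\<^sub>R h) \<bullet> h))\<bar> \<le> \<bar>B * (?I t * (indicator (cball 0 R) x * (g (x - t *\<^sub>R h) \<bullet> h)))\<bar>"
          using R(2)[of x] B(1) B(2)[of x] by (cases "R < norm x") (auto simp: abs_mult split: split_indicator intro!: mult_right_mono)
      qed
    qed measurable
    have i2: "integrable (lborel \<Otimes>\<^sub>M lborel) (\<lambda>(x, t). ?I t * (u x * frechet_derivative \<phi> (at (x + t *\<^sub>R h)) h))"
    proof (rule integrableI_bounded)
      let ?C = "\<integral>\<^sup>+x. ennreal (B' * norm (indicator (cball 0 (R + norm h)) x *\<^sub>R u x)) \<partial>lborel"
      have C: "?C < \<infinity>" using u_loc[of "R + norm h"] B'(1)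
        by (simp add: set_integrable_def integrable_iff_bounded ennreal_mult nn_integral_cmult ennreal_mult_less_top)
      have "(\<integral>\<^sup>+z. ennreal (norm (case z of (x, t) \<Rightarrow> ?I t * (u x * frechet_derivative \<phi> (at (x + t *\<^sub>R h)) h))) \<partial>(lborel \<Otimes>\<^sub>M lborel))
         = (\<integral>\<^sup>+t. \<integral>\<^sup>+x. ennreal (norm (?I t * (u x * frechet_derivative \<phi> (at (x + t *\<^sub>R h)) h))) \<partial>lborel \<partial>lborel)"
        by (subst lborel_pair.nn_integral_snd[symmetric]) auto
      also have "\<dots> \<le> (\<integral>\<^sup>+t. indicator {0..1} (t::real) * ?C \<partial>lborel)"
      proof (rule nn_integral_mono)
        fix t :: real
        show "(\<integral>\<^sup>+x. ennreal (norm (?I t * (u x * frechet_derivative \<phi> (at (x + t *\<^sub>R h)) h))) \<partial>lborel) \<le> indicator {0..1} t * ?C"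
        proof (cases "t \<in> {0..1}")
          case True
          have "\<bar>u x * frechet_derivative \<phi> (at (x + t *\<^sub>R h)) h\<bar> \<le> B' * norm (indicator (cball 0 (R + norm h)) x *\<^sub>R u x)" for x
          proof (cases "norm (x + t *\<^sub>R h) > R")
            case False
            have "norm (t *\<^sub>R h) \<le> norm h" using True by (simp add: mult_left_le_one_le)
            then have "norm x \<le> R + norm h" using False norm_triangle_ineq4[of "x + t *\<^sub>R h" "t *\<^sub>R h"] by simp
            then show ?thesis using B'(2)[of "x + t *\<^sub>R h"] by (simp add: abs_mult mult.commute[of "\<bar>u x\<bar>"] mult_right_mono)
          qed (simp add: R(3) B'(1))
          then show ?thesis using True by (auto intro!: nn_integral_mono ennreal_leI)
        qed simp
      qed
      also have "\<dots> = ?C" by (simp add: nn_integral_multc)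
      finally show "(\<integral>\<^sup>+z. ennreal (norm (case z of (x, t) \<Rightarrow> ?I t * (u x * frechet_derivative \<phi> (at (x + t *\<^sub>R h)) h))) \<partial>(lborel \<Otimes>\<^sub>M lborel)) < \<infinity>" 
        using C by (rule le_less_trans)
    qed measurable
    \<comment> \<open>Only here is \<open>\<phi>\<close> differentiated along the segment.\<close>
    have FTC: "(\<integral>t. ?I t * frechet_derivative \<phi> (at (x + t *\<^sub>R h)) h \<partial>lborel) = \<phi> (x + h) - \<phi> x" for x
    proof -
      have 1: "DERIV (\<lambda>t. \<phi> (x + t *\<^sub>R h)) t :> frechet_derivative \<phi> (at (x + t *\<^sub>R h)) h" for t
      proof -
        have "((\<lambda>t. x + t *\<^sub>R h) has_derivative (\<lambda>s. s *\<^sub>R h)) (at t)" by (auto intro!: derivative_eq_intros)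
        from has_derivative_compose[OF this frechet_derivative_works[THEN iffD1, OF test_fun_differentiable[OF \<phi>]]]
        have d: "((\<lambda>t. \<phi> (x + t *\<^sub>R h)) has_derivative (\<lambda>s. frechet_derivative \<phi> (at (x + t *\<^sub>R h)) (s *\<^sub>R h))) (at t)" .
        have "frechet_derivative \<phi> (at (x + t *\<^sub>R h)) (s *\<^sub>R h) = s * frechet_derivative \<phi> (at (x + t *\<^sub>R h)) h" for s
          using linear_frechet_derivative[OF test_fun_differentiable[OF \<phi>]] by (simp add: linear_cmul)
        with d show ?thesis by (simp add: has_field_derivative_def mult.commute[of _ "frechet_derivative \<phi> _ h"])
      qed
      have 2: "isCont (\<lambda>t. frechet_derivative \<phi> (at (x + t *\<^sub>R h)) h) t" for t
      proof -
        have "continuous_on UNIV (\<lambda>t. frechet_derivative \<phi> (at (x + t *\<^sub>R h)) h)"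
          by (rule continuous_on_compose2[OF test_fun_derivative_continuous[OF \<phi>]]) (auto intro!: continuous_intros)
        then show ?thesis by (simp add: continuous_on_eq_continuous_at)
      qed
      show ?thesis using integral_FTC_Icc_real[of 0 1, OF _ 1 2] by (simp add: mult.commute)
    qed
    have bg: "integrable lborel (\<lambda>x. f x * \<phi> x)" if "set_integrable lborel (cball 0 R) f" "f \<in> borel_measurable borel" for f
      by (rule integrable_times_bounded_on_ball[OF that(2) _ that(1) R(2) B(2)]) auto
    have "(\<integral>x. J x * \<phi> x \<partial>lborel) = (\<integral>x. \<integral>t. ?I t * (\<phi> x * (g (x - t *\<^sub>R h) \<bullet> h)) \<partial>lborel \<partial>lborel)"
    proof -
      have "(\<integral>t. ?I t * (\<phi> x * (g (x - t *\<^sub>R h) \<bullet> h)) \<partial>lborel) = J x * \<phi> x" for x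
        unfolding J_def by (simp only: mult.left_commute[of _ "\<phi> x"] integral_mult_right_zero mult.commute)
      then show ?thesis by simp
    qed
    also have "\<dots> = (\<integral>t. \<integral>x. ?I t * (\<phi> x * (g (x - t *\<^sub>R h) \<bullet> h)) \<partial>lborel \<partial>lborel)"
      by (rule lborel_pair.Fubini_integral[symmetric]) (use i1 in simp)
    also have "\<dots> = (\<integral>t. \<integral>x. - (?I t * (u x * frechet_derivative \<phi> (at (x + t *\<^sub>R h)) h)) \<partial>lborel \<partial>lborel)"
    proof (rule Bochner_Integration.integral_cong[OF refl])
      fix t :: real
      have "(\<integral>x. \<phi> x * (g (x - t *\<^sub>R h) \<bullet> h) \<partial>lborel) = (\<integral>x. \<phi> (x + t *\<^sub>R h) * (g (x + t *\<^sub>R h - t *\<^sub>R h) \<bullet> h) \<partial>lborel)"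
        by (rule integral_lborel_shift[symmetric, of "\<lambda>x. \<phi> x * (g (x - t *\<^sub>R h) \<bullet> h)"]) measurable
      also have "\<dots> = (\<integral>x. (g x \<bullet> h) * \<phi> (x + t *\<^sub>R h) \<partial>lborel)" by (simp add: mult.commute)
      also have "\<dots> = - (\<integral>x. u x * frechet_derivative (\<lambda>x. \<phi> (x + t *\<^sub>R h)) (at x) h \<partial>lborel)"
        using weak_directional[OF test_fun_shift[OF \<phi>]] by simp
      finally have *: "(\<integral>x. \<phi> x * (g (x - t *\<^sub>R h) \<bullet> h) \<partial>lborel) = - (\<integral>x. u x * frechet_derivative \<phi> (at (x + t *\<^sub>R h)) h \<partial>lborel)"
        by (simp add: frechet_derivative_shift(1)[OF test_fun_differentiable[OF \<phi>]])
      then show "(\<integral>x. ?I t * (\<phi> x * (g (x - t *\<^sub>R h) \<bullet> h)) \<partial>lborel) = (\<integral>x. - (?I t * (u x * frechet_derivative \<phi> (at (x + t *\<^sub>R h)) h)) \<partial>lborel)"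
        by (simp only: Bochner_Integration.integral_minus integral_mult_right_zero)
    qed
    also have "\<dots> = - (\<integral>t. \<integral>x. ?I t * (u x * frechet_derivative \<phi> (at (x + t *\<^sub>R h)) h) \<partial>lborel \<partial>lborel)"
      by (simp only: Bochner_Integration.integral_minus)
    also have "\<dots> = - (\<integral>x. \<integral>t. ?I t * (u x * frechet_derivative \<phi> (at (x + t *\<^sub>R h)) h) \<partial>lborel \<partial>lborel)"
      by (subst lborel_pair.Fubini_integral) (use i2 in simp_all)
    also have "\<dots> = - (\<integral>x. u x * \<phi> (x + h) - u x * \<phi> x \<partial>lborel)"
      by (simp only: mult.left_commute[of _ "u _"] integral_mult_right_zero FTC right_diff_distrib)
    also have "\<dots> = - ((\<integral>x. u x * \<phi> (x + h) \<partial>lborel) - (\<integral>x. u x * \<phi> x \<partial>lborel))"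
    proof (subst Bochner_Integration.integral_diff)
      have "integrable lborel (\<lambda>x. u (x + h - h) * \<phi> (x + h))" 
        by (rule integrable_lborel_shift[of "\<lambda>x. u (x - h) * \<phi> x"]) (auto intro!: bg us)
      then show "integrable lborel (\<lambda>x. u x * \<phi> (x + h))" by simp
    qed (auto intro!: bg u_loc)
    also have "(\<integral>x. u x * \<phi> (x + h) \<partial>lborel) = (\<integral>x. u (x - h) * \<phi> x \<partial>lborel)"
      using integral_lborel_shift[of "\<lambda>x. u (x - h) * \<phi> x" h] by simp
    finally have "(\<integral>x. J x * \<phi> x \<partial>lborel) = (\<integral>x. u x * \<phi> x \<partial>lborel) - (\<integral>x. u (x - h) * \<phi> x \<partial>lborel)" by simp
    moreover have "(\<integral>x. d x * \<phi> x \<partial>lborel) = (\<integral>x. u x * \<phi> x \<partial>lborel) - (\<integral>x. u (x - h) * \<phi> x \<partial>lborel) - (\<integral>x. J x * \<phi> x \<partial>lborel)"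
      unfolding d_def left_diff_distrib by (subst Bochner_Integration.integral_diff, auto intro!: bg u_loc us Jint Bochner_Integration.integrable_diff)+
    ultimately have "(\<integral>x. d x * \<phi> x \<partial>lborel) = 0" by simp
    then show ?thesis by (simp add: set_lebesgue_integral_def integral_completion)
  qed
  ultimately have "AE x in lebesgue. x \<in> UNIV \<longrightarrow> d x = 0" by (intro test_funs_separate) auto
  then have "AE x in lborel. d x = 0" by (simp add: AE_completion_iff)
  then show ?thesis by eventually_elim (simp add: d_def J_def)
qed

end

section \<open>Remainders of first order in Lp and Lipschitz cutoffs\<close>

text \<open>With \<open>A = \<integral>\<^sub>0\<^sup>1 f\<close>, integrate the inequality of Young \<open>f A\<^sup>p\<^sup>-\<^sup>1 \<le> f\<^sup>p / p + A\<^sup>p / q\<close> over the unit interval; the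
  left side becomes \<open>A\<^sup>p\<close> and can absorb \<open>A\<^sup>p / q\<close>.\<close>

lemma unit_interval_jensen_powr:
  fixes f :: "real \<Rightarrow> real"
  assumes p: "1 < p" and [measurable]: "f \<in> borel_measurable borel" and nn: "\<And>t. 0 \<le> f t"
    and int: "integrable lborel (\<lambda>t. indicator {0..1} t * f t)"
  shows "ennreal ((\<integral>t. indicator {0..1} t * f t \<partial>lborel) powr p) \<le> (\<integral>\<^sup>+t. indicator {0..1} t * ennreal (f t powr p) \<partial>lborel)"
proof (cases "(\<integral>\<^sup>+t. indicator {0..1} t * ennreal (f t powr p) \<partial>lborel) = \<infinity>")
  case False
  let ?I = "indicator {0..1} :: real \<Rightarrow> real"
  define A where "A = (\<integral>t. ?I t * f t \<partial>lborel)"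
  define q where "q = p / (p - 1)"
  have A0: "A \<ge> 0" unfolding A_def by (intro integral_nonneg_AE) (simp add: nn)
  have eq: "indicator {0..1} t * ennreal (f t powr p) = ennreal (?I t * f t powr p)" for t by (simp split: split_indicator)
  have fp: "integrable lborel (\<lambda>t. ?I t * f t powr p)"
    using False unfolding eq by (intro integrableI_nonneg) (auto simp: less_top)
  have q: "q > 1" "1 / p + 1 / q = 1" "(p - 1) * q = p" using p by (auto simp: q_def field_simps)
  have y: "?I t * f t * A powr (p - 1) \<le> ?I t * f t powr p / p + ?I t * (A powr p / q)" for t
    using Youngs_inequality[OF p q(1,2) nn[of t], of "A powr (p - 1)"] q(3) by (auto simp: powr_powr split: split_indicator)
  have "A * A powr (p - 1) = (\<integral>t. ?I t * f t * A powr (p - 1) \<partial>lborel)" by (simp add: A_def)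
  also have "\<dots> \<le> (\<integral>t. ?I t * f t powr p / p + ?I t * (A powr p / q) \<partial>lborel)"
    by (intro integral_mono y Bochner_Integration.integrable_add integrable_mult_left integrable_divide int fp) auto
  also have "\<dots> = (\<integral>t. ?I t * f t powr p \<partial>lborel) / p + A powr p / q"
    by (subst Bochner_Integration.integral_add) (auto intro!: fp integrable_divide)
  also have "A * A powr (p - 1) = A powr p" using A0 by (cases "A = 0") (auto simp: powr_diff)
  finally have "A powr p - A powr p / q \<le> (\<integral>t. ?I t * f t powr p \<partial>lborel) / p" by simp
  moreover have "A powr p - A powr p / q = A powr p / p" 
  proof -
    have "1 / p = 1 - 1 / q" using q by simp
    then have "A powr p * (1 / p) = A powr p * (1 - 1 / q)" by simp
    then show ?thesis by (simp add: algebra_simps)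
  qed
  ultimately have "A powr p \<le> (\<integral>t. ?I t * f t powr p \<partial>lborel)" using p by (simp add: divide_right_mono field_simps)
  then have "ennreal (A powr p) \<le> ennreal (\<integral>t. ?I t * f t powr p \<partial>lborel)" by (rule ennreal_leI)
  also have "\<dots> = (\<integral>\<^sup>+t. ennreal (?I t * f t powr p) \<partial>lborel)"
    by (rule nn_integral_eq_integral[symmetric]) (auto intro: fp)
  finally show ?thesis by (simp only: A_def eq)
qed simp

lemma powr_norm_inner_le: "0 \<le> p \<Longrightarrow> \<bar>a \<bullet> h\<bar> powr p \<le> norm h powr p * norm a powr p"
  using Cauchy_Schwarz_ineq2[of a h] by (simp add: powr_mono2 mult.commute flip: powr_mult)

text \<open>The remainder is the mean of \<open>(g (x - t h) - g x) \<bullet> h\<close> over \<open>t\<close>, so it is controlled by translation differences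
  of the gradient along the segment.\<close>

lemma (in borel_weak_gradient) difference_remainder_bound:
  assumes p: "1 < p"
  shows "(\<integral>\<^sup>+x. ennreal (\<bar>u x - u (x - h) - g x \<bullet> h\<bar> powr p) \<partial>lborel)
   \<le> ennreal (norm h powr p) * (\<integral>\<^sup>+t. indicator {0..1::real} t * (\<integral>\<^sup>+x. ennreal (norm (g (x - t *\<^sub>R h) - g x) powr p) \<partial>lborel) \<partial>lborel)"
proof -
  let ?I = "indicator {0..1} :: real \<Rightarrow> real"
  have "AE x in lborel. ennreal (\<bar>u x - u (x - h) - g x \<bullet> h\<bar> powr p)
     \<le> (\<integral>\<^sup>+t. indicator {0..1::real} t * ennreal (norm h powr p * norm (g (x - t *\<^sub>R h) - g x) powr p) \<partial>lborel)"
    using difference_eq_line_integral[of h] integrable_on_segment_AE[of h]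
  proof eventually_elim
    case (elim x)
    have i0: "integrable lborel (\<lambda>t. ?I t * (g x \<bullet> h))" by (intro integrable_mult_left) simp
    have i: "integrable lborel (\<lambda>t. ?I t * ((g (x - t *\<^sub>R h) - g x) \<bullet> h))"
      using Bochner_Integration.integrable_diff[OF elim(2) i0] by (simp add: inner_diff_left right_diff_distrib)
    have "(\<integral>t. ?I t * (g (x - t *\<^sub>R h) \<bullet> h) - ?I t * (g x \<bullet> h) \<partial>lborel) = u x - u (x - h) - g x \<bullet> h"
      by (subst Bochner_Integration.integral_diff[OF elim(2) i0]) (simp add: elim(1))
    then have "u x - u (x - h) - g x \<bullet> h = (\<integral>t. ?I t * ((g (x - t *\<^sub>R h) - g x) \<bullet> h) \<partial>lborel)"
      by (simp add: inner_diff_left right_diff_distrib)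
    then have le: "\<bar>u x - u (x - h) - g x \<bullet> h\<bar> \<le> (\<integral>t. ?I t * \<bar>(g (x - t *\<^sub>R h) - g x) \<bullet> h\<bar> \<partial>lborel)"
      using integral_abs_bound[of lborel "\<lambda>t. ?I t * ((g (x - t *\<^sub>R h) - g x) \<bullet> h)"] by (simp add: abs_mult)
    have i': "integrable lborel (\<lambda>t. ?I t * \<bar>(g (x - t *\<^sub>R h) - g x) \<bullet> h\<bar>)" using integrable_abs[OF i] by (simp add: abs_mult)
    have "ennreal (\<bar>u x - u (x - h) - g x \<bullet> h\<bar> powr p) \<le> ennreal ((\<integral>t. ?I t * \<bar>(g (x - t *\<^sub>R h) - g x) \<bullet> h\<bar> \<partial>lborel) powr p)"
      using p le by (intro ennreal_leI powr_mono2) auto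
    also have "\<dots> \<le> (\<integral>\<^sup>+t. indicator {0..1} t * ennreal (\<bar>(g (x - t *\<^sub>R h) - g x) \<bullet> h\<bar> powr p) \<partial>lborel)"
      by (rule unit_interval_jensen_powr[OF p _ _ i']) auto
    also have "\<dots> \<le> (\<integral>\<^sup>+t. indicator {0..1} t * ennreal (norm h powr p * norm (g (x - t *\<^sub>R h) - g x) powr p) \<partial>lborel)"
      using p by (intro nn_integral_mono mult_left_mono ennreal_leI powr_norm_inner_le) auto
    finally show ?case .
  qed
  then have "(\<integral>\<^sup>+x. ennreal (\<bar>u x - u (x - h) - g x \<bullet> h\<bar> powr p) \<partial>lborel) \<le>
     (\<integral>\<^sup>+x. \<integral>\<^sup>+t. indicator {0..1::real} t * ennreal (norm h powr p * norm (g (x - t *\<^sub>R h) - g x) powr p) \<partial>lborel \<partial>lborel)"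
    by (rule nn_integral_mono_AE)
  also have "\<dots> = (\<integral>\<^sup>+t. \<integral>\<^sup>+x. indicator {0..1::real} t * ennreal (norm h powr p * norm (g (x - t *\<^sub>R h) - g x) powr p) \<partial>lborel \<partial>lborel)"
    by (rule lborel_pair.Fubini'[symmetric]) measurable
  also have "\<dots> = (\<integral>\<^sup>+t. ennreal (norm h powr p) * (indicator {0..1::real} t * (\<integral>\<^sup>+x. ennreal (norm (g (x - t *\<^sub>R h) - g x) powr p) \<partial>lborel)) \<partial>lborel)"
    by (simp add: ennreal_mult nn_integral_cmult ac_simps)
  also have "\<dots> = ennreal (norm h powr p) * (\<integral>\<^sup>+t. indicator {0..1::real} t * (\<integral>\<^sup>+x. ennreal (norm (g (x - t *\<^sub>R h) - g x) powr p) \<partial>lborel) \<partial>lborel)"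
    by (rule nn_integral_cmult) measurable
  finally show ?thesis .
qed

text \<open>Squeeze: a compact \<open>C \<subseteq> A\<close> and an open \<open>U \<supseteq> C\<close> with small \<open>A - C\<close> and \<open>U - C\<close>; then \<open>1 - infdist x C / e\<close>,
  cut at zero, is one on \<open>C\<close> and lives in a compact neighbourhood of \<open>C\<close> inside \<open>U \<inter> \<Omega>\<close>. These cutoffs serve
  twice, for the continuity of translations and for the weak limit.\<close>

lemma lipschitz_cutoff:
  fixes A :: "'a::euclidean_space set"
  assumes \<Omega>: "open \<Omega>" "A \<subseteq> \<Omega>" and A: "A \<in> sets borel" "emeasure lborel A < \<infinity>" and t: "0 < t"
  obtains \<phi> :: "'a \<Rightarrow> real" and K L where "compact K" "K \<subseteq> \<Omega>" "\<And>x. x \<notin> K \<Longrightarrow> \<phi> x = 0"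
    "\<And>x. 0 \<le> \<phi> x" "\<And>x. \<phi> x \<le> 1" "0 \<le> L" "\<And>x y. \<bar>\<phi> x - \<phi> y\<bar> \<le> L * norm (x - y)"
    "(\<integral>\<^sup>+x. ennreal \<bar>indicator A x - \<phi> x\<bar> \<partial>lborel) \<le> ennreal t"
proof -
  obtain T where T: "closed T" "T \<subseteq> A" "emeasure lebesgue (A - T) < ennreal (t / 4)"
    using sets_lebesgue_inner_closed[of A "t / 4"] A t by (metis sets_completionI_sets sets_lborel zero_less_divide_iff zero_less_numeral)
  have Tb[measurable]: "T \<in> sets borel" using T(1) by (rule borel_closed)
  note A(1)[measurable]
  have "(\<lambda>n. emeasure lborel (T - cball 0 (real n))) \<longlonglongrightarrow> emeasure lborel (\<Inter>n. T - cball 0 (real n))"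
  proof (rule Lim_emeasure_decseq)
    show "emeasure lborel (T - cball 0 (real n)) \<noteq> \<infinity>" for n
    proof -
      have "emeasure lborel (T - cball 0 (real n)) \<le> emeasure lborel A" using T(2) A(1) by (intro emeasure_mono) auto
      then show ?thesis using A(2) by (auto simp: top_unique)
    qed
    show "decseq (\<lambda>n. T - cball 0 (real n))" by (auto simp: decseq_def)
  qed auto
  moreover have "(\<Inter>n. T - cball 0 (real n)) = {}"
    using real_arch_simple by (auto simp: set_eq_iff)
  ultimately have "(\<lambda>n. emeasure lborel (T - cball 0 (real n))) \<longlonglongrightarrow> 0" by (simp only: emeasure_empty)
  then have "eventually (\<lambda>n. emeasure lborel (T - cball 0 (real n)) < ennreal (t / 4)) sequentially"
    using t by (intro order_tendstoD) auto
  then obtain n where n: "emeasure lborel (T - cball 0 (real n)) < ennreal (t / 4)" by (auto simp: eventually_sequentially)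
  define C where "C = T \<inter> cball 0 (real n)"
  have C: "compact C" "C \<subseteq> A" using T by (auto simp: C_def closed_Int_compact)
  have Cb[measurable]: "C \<in> sets borel" unfolding C_def by measurable
  have AC: "emeasure lborel (A - C) \<le> ennreal (t / 2)"
  proof -
    have "emeasure lborel (A - C) \<le> emeasure lborel ((A - T) \<union> (T - cball 0 (real n)))" by (intro emeasure_mono) (auto simp: C_def)
    also have "\<dots> \<le> emeasure lborel (A - T) + emeasure lborel (T - cball 0 (real n))" by (intro emeasure_subadditive) auto
    also have "\<dots> \<le> ennreal (t / 4) + ennreal (t / 4)" using T(3) n by (intro add_mono) auto
    also have "\<dots> = ennreal (t / 2)" using t by (simp flip: ennreal_plus)
    finally show ?thesis .
  qed
  show ?thesis
  \<comment> \<open>The distance to the empty set is \<open>0\<close> by convention, so the formula for the cutoff needs \<open>C\<close> nonempty.\<close>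
  proof (cases "C = {}")
    case True
    have "(\<integral>\<^sup>+x. ennreal \<bar>indicator A x - 0\<bar> \<partial>lborel) = emeasure lborel A" 
      by (simp add: ennreal_indicator)
    also have "\<dots> \<le> ennreal t" using AC True t by (auto elim!: order_trans intro!: ennreal_leI)
    finally show ?thesis using that[of "{}" "\<lambda>_. 0" 0] by simp
  next
    case False
    obtain U where U: "open U" "C \<subseteq> U" "emeasure lebesgue (U - C) < ennreal (t / 2)"
      using sets_lebesgue_outer_open[of C "t / 2"] Cb t by (metis sets_completionI_sets sets_lborel zero_less_divide_iff zero_less_numeral)
    have [measurable]: "U \<in> sets borel" using U(1) by (rule borel_open)
    obtain e where e: "e > 0" "(\<Union>x\<in>C. cball x e) \<subseteq> U \<inter> \<Omega>"
      using compact_subset_open_imp_cball_epsilon_subset[of C "U \<inter> \<Omega>"] C U \<Omega> by blast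
    define K where "K = {x. infdist x C \<le> e}"
    have K: "compact K" unfolding K_def by (rule compact_infdist_le[OF False C(1) e(1)])
    have KU: "K \<subseteq> U \<inter> \<Omega>"
    proof
      fix x assume "x \<in> K"
      moreover obtain c where "c \<in> C" "infdist x C = dist x c" 
        using infdist_attains_inf[OF compact_imp_closed[OF C(1)] False] by metis
      ultimately have "x \<in> cball c e" by (simp add: K_def dist_commute)
      then show "x \<in> U \<inter> \<Omega>" using e(2) \<open>c \<in> C\<close> by blast
    qed
    define \<phi> where "\<phi> x = max 0 (1 - infdist x C / e)" for x
    have p0: "\<phi> x = 0" if "x \<notin> K" for x using that e(1) by (simp add: \<phi>_def K_def max_def field_simps)
    have p1: "0 \<le> \<phi> x" "\<phi> x \<le> 1" for x using e(1) by (auto simp: \<phi>_def infdist_nonneg)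
    have pC: "\<phi> x = 1" if "x \<in> C" for x using that by (simp add: \<phi>_def)
    have lip: "\<bar>\<phi> x - \<phi> y\<bar> \<le> (1 / e) * norm (x - y)" for x y
    proof -
      have "\<bar>\<phi> x - \<phi> y\<bar> \<le> \<bar>(1 - infdist x C / e) - (1 - infdist y C / e)\<bar>" unfolding \<phi>_def by linarith
      also have "\<dots> = \<bar>infdist x C - infdist y C\<bar> / e" using e(1) by (simp add: abs_minus_commute diff_divide_distrib[symmetric])
      also have "\<dots> \<le> norm (x - y) / e" 
        using infdist_triangle_abs[of x C y] e(1) by (intro divide_right_mono) (auto simp: dist_norm)
      finally show ?thesis by simp
    qed
    have "(\<integral>\<^sup>+x. ennreal \<bar>indicator A x - \<phi> x\<bar> \<partial>lborel) \<le> (\<integral>\<^sup>+x. indicator (A - C) x + indicator (U - C) x \<partial>lborel)"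
    proof (rule nn_integral_mono)
      fix x
      consider "x \<in> C" | "x \<notin> C" "x \<in> A" | "x \<notin> C" "x \<notin> A" "x \<in> U" | "x \<notin> A" "x \<notin> U" using C U by blast
      then show "ennreal \<bar>indicator A x - \<phi> x\<bar> \<le> indicator (A - C) x + indicator (U - C) x"
      proof cases
        case 1 then show ?thesis using C by (auto simp: pC)
      next
        case 2 
        have "ennreal \<bar>indicator A x - \<phi> x\<bar> \<le> ennreal 1" using p1[of x] 2 by (intro ennreal_leI) auto
        then show ?thesis using 2 by (auto intro: order_trans simp: add_increasing2)
      next
        case 3
        have "ennreal \<bar>indicator A x - \<phi> x\<bar> \<le> ennreal 1" using p1[of x] 3 by (intro ennreal_leI) auto
        then show ?thesis using 3 by auto
      next
        case 4 then show ?thesis using p0[of x] KU by auto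
      qed
    qed
    also have "\<dots> = emeasure lborel (A - C) + emeasure lborel (U - C)" by (subst nn_integral_add) auto
    also have "\<dots> \<le> ennreal (t / 2) + ennreal (t / 2)" using AC U(3) by (intro add_mono) auto
    also have "\<dots> = ennreal t" using t by (simp flip: ennreal_plus)
    finally show ?thesis using that[OF K _ p0 p1 _ lip] KU e(1) by auto
  qed
qed

section \<open>Differentiability in Lp and uniqueness of weak gradients\<close>

lemma eventually_nhds_0_norm:
  fixes P :: "'a::real_normed_vector \<Rightarrow> bool"
  shows "(\<forall>\<^sub>F k in nhds 0. P k) \<longleftrightarrow> (\<exists>d>0. \<forall>k. norm k < d \<longrightarrow> P k)"
  by (simp add: eventually_nhds_metric)

lemma lipschitz_borel_measurable:
  fixes \<phi> :: "'a::euclidean_space \<Rightarrow> real"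
  assumes "0 \<le> L" "\<And>x y. \<bar>\<phi> x - \<phi> y\<bar> \<le> L * norm (x - y)"
  shows "\<phi> \<in> borel_measurable borel"
proof (rule borel_measurable_continuous_onI, rule lipschitz_on_continuous_on)
  show "L-lipschitz_on UNIV \<phi>" using assms by (auto intro!: lipschitz_onI simp: dist_norm)
qed

lemma indicator_shift_L1_continuous:
  fixes A :: "'a::euclidean_space set"
  assumes A[measurable]: "A \<in> sets borel" and fin: "emeasure lborel A < \<infinity>" and t: "0 < t"
  shows "\<forall>\<^sub>F k in nhds 0. (\<integral>\<^sup>+x. ennreal \<bar>indicator A (x - k) - indicator A x :: real\<bar> \<partial>lborel) \<le> ennreal t"
proof -
  obtain \<phi> :: "'a \<Rightarrow> real" and K L where K: "compact K" "\<And>x. x \<notin> K \<Longrightarrow> \<phi> x = 0"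
    and p01: "\<And>x. 0 \<le> \<phi> x" "\<And>x. \<phi> x \<le> 1" and L: "0 \<le> L" "\<And>x y. \<bar>\<phi> x - \<phi> y\<bar> \<le> L * norm (x - y)"
    and ap: "(\<integral>\<^sup>+x. ennreal \<bar>indicator A x - \<phi> x\<bar> \<partial>lborel) \<le> ennreal (t / 4)"
    by (rule lipschitz_cutoff[OF open_UNIV subset_UNIV A fin, of "t / 4"]) (use t in simp, rule that)
  obtain R where R: "R > 0" "\<And>x. x \<in> K \<Longrightarrow> norm x \<le> R" using compact_imp_bounded[OF K(1)] by (auto simp: bounded_pos)
  have [measurable]: "\<phi> \<in> borel_measurable borel" by (rule lipschitz_borel_measurable[OF L])
  define m where "m = measure lborel (cball (0::'a) (R + 1))"
  have m: "emeasure lborel (cball (0::'a) (R + 1)) = ennreal m" unfolding m_def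
    by (intro emeasure_eq_ennreal_measure) (use emeasure_lborel_cball_finite[of 0 "R+1"] in \<open>simp add: less_top\<close>)
  have m0: "m \<ge> 0" by (simp add: m_def)
  define d where "d = min 1 (t / (2 * (L * m + 1)))"
  have d: "d > 0" using t L m0 by (auto simp: d_def intro!: divide_pos_pos add_nonneg_pos)
  have "(\<integral>\<^sup>+x. ennreal \<bar>indicator A (x - k) - indicator A x :: real\<bar> \<partial>lborel) \<le> ennreal t" if k: "norm k < d" for k
  proof -
    have "(\<integral>\<^sup>+x. ennreal \<bar>indicator A (x - k) - indicator A x :: real\<bar> \<partial>lborel)
      \<le> (\<integral>\<^sup>+x. ennreal \<bar>indicator A (x + - k) - \<phi> (x + - k)\<bar> + (ennreal (L * norm k) * indicator (cball 0 (R + 1)) x + ennreal \<bar>indicator A x - \<phi> x\<bar>) \<partial>lborel)"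
    proof (rule nn_integral_mono)
      fix x
      have "\<bar>\<phi> (x - k) - \<phi> x\<bar> \<le> L * norm k * indicator (cball 0 (R + 1)) x"
      proof (cases "norm x \<le> R + 1")
        case True then show ?thesis using L(2)[of "x - k" x] by simp
      next
        case False
        then have "norm (x - k) > R" using k norm_triangle_ineq2[of x k] by (simp add: d_def)
        then have "x - k \<notin> K" "x \<notin> K" using False R(2)[of x] R(2)[of "x - k"] by auto
        then show ?thesis using L(1) by (simp add: K(2))
      qed
      then have "\<bar>indicator A (x - k) - indicator A x :: real\<bar> \<le> \<bar>indicator A (x - k) - \<phi> (x - k)\<bar> + (L * norm k * indicator (cball 0 (R + 1)) x + \<bar>indicator A x - \<phi> x\<bar>)"
        by linarith
      then have "ennreal \<bar>indicator A (x - k) - indicator A x :: real\<bar> \<le> ennreal (\<bar>indicator A (x - k) - \<phi> (x - k)\<bar> + (L * norm k * indicator (cball 0 (R + 1)) x + \<bar>indicator A x - \<phi> x\<bar>))"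
        by (rule ennreal_leI)
      also have "\<dots> = ennreal \<bar>indicator A (x + - k) - \<phi> (x + - k)\<bar> + (ennreal (L * norm k) * indicator (cball 0 (R + 1)) x + ennreal \<bar>indicator A x - \<phi> x\<bar>)"
        using L(1) by (simp add: ennreal_plus ennreal_mult' ennreal_indicator[symmetric])
      finally show "ennreal \<bar>indicator A (x - k) - indicator A x :: real\<bar> \<le> \<dots>" .
    qed
    also have "\<dots> = (\<integral>\<^sup>+x. ennreal \<bar>indicator A (x + - k) - \<phi> (x + - k)\<bar> \<partial>lborel) + (ennreal (L * norm k) * ennreal m + (\<integral>\<^sup>+x. ennreal \<bar>indicator A x - \<phi> x\<bar> \<partial>lborel))"
      by (simp add: nn_integral_add nn_integral_cmult_indicator m)
    also have "(\<integral>\<^sup>+x. ennreal \<bar>indicator A (x + - k) - \<phi> (x + - k)\<bar> \<partial>lborel) = (\<integral>\<^sup>+x. ennreal \<bar>indicator A x - \<phi> x\<bar> \<partial>lborel)"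
      by (rule nn_integral_lborel_shift[of "\<lambda>x. ennreal \<bar>indicator A x - \<phi> x\<bar>"]) measurable
    also have "(\<integral>\<^sup>+x. ennreal \<bar>indicator A x - \<phi> x\<bar> \<partial>lborel) + (ennreal (L * norm k) * ennreal m + (\<integral>\<^sup>+x. ennreal \<bar>indicator A x - \<phi> x\<bar> \<partial>lborel))
      \<le> ennreal (t / 4) + (ennreal (t / 2) + ennreal (t / 4))"
    proof (intro add_mono ap)
      have "L * norm k * m \<le> L * (t / (2 * (L * m + 1))) * m" using k L m0 by (intro mult_right_mono mult_left_mono) (auto simp: d_def)
      also have "\<dots> = (t / 2) * (L * m / (L * m + 1))" by (simp add: field_simps)
      also have "\<dots> \<le> (t / 2) * 1" using t L m0 by (intro mult_left_mono) (auto simp: divide_le_eq_1 add_nonneg_pos)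
      finally show "ennreal (L * norm k) * ennreal m \<le> ennreal (t / 2)" using L m0 by (simp add: ennreal_mult[symmetric] ennreal_leI)
    qed
    also have "\<dots> = ennreal t" using t by (simp flip: ennreal_plus)
    finally show ?thesis .
  qed
  then show ?thesis using d unfolding eventually_nhds_0_norm by blast
qed

abbreviation Lp_power :: "real \<Rightarrow> ('a::euclidean_space \<Rightarrow> 'b::real_normed_vector) \<Rightarrow> ennreal" where
  "Lp_power p g \<equiv> \<integral>\<^sup>+x. ennreal (norm (g x) powr p) \<partial>lborel"

text \<open>Simple functions converging pointwise to \<open>g\<close> with \<open>|s| \<le> 2 |g|\<close> converge in \<open>L\<^sup>p\<close> by dominated convergence;
  the same bound makes the level sets of nonzero values finite in measure.\<close>

lemma simple_Lp_approx:
  fixes g :: "'a::euclidean_space \<Rightarrow> 'a"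
  assumes [measurable]: "g \<in> borel_measurable borel" and p: "0 < p" 
    and fin: "Lp_power p g < \<infinity>" and t: "0 < t"
  obtains s where "simple_function borel s" "Lp_power p (\<lambda>x. g x - s x) \<le> ennreal t"
    "\<And>y. y \<noteq> 0 \<Longrightarrow> emeasure lborel (s -` {y}) < \<infinity>"
proof -
  obtain F where F: "\<And>i. simple_function borel (F i)" "\<And>x. (\<lambda>i. F i x) \<longlonglongrightarrow> g x" "\<And>i x. norm (F i x) \<le> 2 * norm (g x)"
    using borel_measurable_implies_sequence_metric[OF assms(1), of 0] by auto
  have Fm[measurable]: "F i \<in> borel_measurable borel" for i using F(1) by (rule borel_measurable_simple_function)
  have w: "(\<integral>\<^sup>+x. ennreal ((3 * norm (g x)) powr p) \<partial>lborel) < \<infinity>" 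
    using fin by (simp add: powr_mult ennreal_mult nn_integral_cmult ennreal_mult_less_top)
  have "(\<lambda>i. \<integral>\<^sup>+x. norm (0 - norm (g x - F i x) powr p) \<partial>lborel) \<longlonglongrightarrow> 0"
  proof (rule nn_integral_dominated_convergence_norm[OF _ _ _ _ w])
    show "AE x in lborel. norm (norm (g x - F j x) powr p) \<le> (3 * norm (g x)) powr p" for j
      using F(3)[of j] norm_triangle_ineq4[of "g _" "F j _"] p by (intro AE_I2) (auto intro!: powr_mono2 order_trans[OF norm_triangle_ineq4])
    show "AE x in lborel. (\<lambda>i. norm (g x - F i x) powr p) \<longlonglongrightarrow> 0"
    proof (rule AE_I2)
      fix x
      have "(\<lambda>i. norm (g x - F i x)) \<longlonglongrightarrow> norm (g x - g x)" by (intro tendsto_intros F)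
      then show "(\<lambda>i. norm (g x - F i x) powr p) \<longlonglongrightarrow> 0" using p by (intro tendsto_zero_powrI[of _ _ _ p]) auto
    qed
  qed measurable
  then have "eventually (\<lambda>i. (\<integral>\<^sup>+x. norm (0 - norm (g x - F i x) powr p) \<partial>lborel) < ennreal t) sequentially"
    using t by (intro order_tendstoD) auto
  then obtain i where "(\<integral>\<^sup>+x. norm (0 - norm (g x - F i x) powr p) \<partial>lborel) < ennreal t" by (auto simp: eventually_sequentially)
  then have 1: "(\<integral>\<^sup>+x. ennreal (norm (g x - F i x) powr p) \<partial>lborel) \<le> ennreal t" by simp
  have 2: "emeasure lborel (F i -` {y}) < \<infinity>" if "y \<noteq> 0" for y
  proof -
    have [measurable]: "F i -` {y} \<in> sets borel" using measurable_sets[OF Fm[of i], of "{y}"] by simp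
    have "ennreal (norm y powr p) * emeasure lborel (F i -` {y}) = (\<integral>\<^sup>+x. ennreal (norm y powr p) * indicator (F i -` {y}) x \<partial>lborel)"
      by (simp add: nn_integral_cmult_indicator)
    also have "\<dots> \<le> (\<integral>\<^sup>+x. ennreal ((3 * norm (g x)) powr p) \<partial>lborel)"
    proof (rule nn_integral_mono)
      fix x 
      have "norm (F i x) \<le> 3 * norm (g x)" using F(3)[of i x] norm_ge_zero[of "g x"] by linarith
      then show "ennreal (norm y powr p) * indicator (F i -` {y}) x \<le> ennreal ((3 * norm (g x)) powr p)"
        using p by (auto split: split_indicator intro!: ennreal_leI powr_mono2)
    qed
    finally have "ennreal (norm y powr p) * emeasure lborel (F i -` {y}) < \<infinity>" using w by (rule le_less_trans)
    then show ?thesis using that by (auto simp: ennreal_mult_less_top)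
  qed
  show ?thesis using that[OF F(1) 1 2] by blast
qed

text \<open>For a simple function \<open>s\<close> the translation difference is bounded and nonzero only where the indicator of
  some level set of a nonzero value changes, so its \<open>p\<close>-th power is at most a constant times the sum of
  the changes of these indicators; a simple approximation then gives the general case.\<close>

lemma Lp_translation_continuous:
  fixes g :: "'a::euclidean_space \<Rightarrow> 'a"
  assumes [measurable]: "g \<in> borel_measurable borel" and p: "0 < p" 
    and fin: "Lp_power p g < \<infinity>" and t: "0 < t"
  shows "\<forall>\<^sub>F k in nhds 0. Lp_power p (\<lambda>x. g (x - k) - g x) \<le> ennreal t"
proof -
  define c where "c = (2::real) powr p"
  have c: "c > 0" by (simp add: c_def)
  define t1 where "t1 = t / (4 * c * c)"
  have t1: "t1 > 0" using t c by (simp add: t1_def)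
  obtain s where s: "simple_function borel s" "Lp_power p (\<lambda>x. g x - s x) \<le> ennreal t1"
    "\<And>y. y \<noteq> 0 \<Longrightarrow> emeasure lborel (s -` {y}) < \<infinity>"
    using simple_Lp_approx[OF assms(1) p fin t1] by blast
  have sm[measurable]: "s \<in> borel_measurable borel" using s(1) by (rule borel_measurable_simple_function)
  have finY: "finite (range s)" using s(1) by (simp add: simple_function_def)
  define Y where "Y = range s - {0}"
  have Y: "finite Y" using finY by (simp add: Y_def)
  have lev[measurable]: "s -` {y} \<in> sets borel" for y using measurable_sets[OF sm, of "{y}"] by simp
  define B where "B = (\<Sum>y\<in>range s. norm y)"
  have B: "norm (s x) \<le> B" for x unfolding B_def by (rule member_le_sum) (auto simp: finY)
  define M where "M = (2 * B) powr p"
  have M: "M \<ge> 0" by (simp add: M_def)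
  define t2 where "t2 = t / (2 * c * (M + 1) * (real (card Y) + 1))"
  have t2: "t2 > 0" using t c M by (simp add: t2_def)
  have "\<forall>\<^sub>F k in nhds 0. \<forall>y\<in>Y. (\<integral>\<^sup>+x. ennreal \<bar>indicator (s -` {y}) (x - k) - indicator (s -` {y}) x :: real\<bar> \<partial>lborel) \<le> ennreal t2"
    using Y s(3) t2 by (intro eventually_ball_finite ballI indicator_shift_L1_continuous) (auto simp: Y_def)
  then show ?thesis
  proof eventually_elim
    case (elim k)
    let ?D = "\<lambda>y x. \<bar>indicator (s -` {y}) (x - k) - indicator (s -` {y}) x :: real\<bar>"
    have sd: "norm (s x - s (x - k)) powr p \<le> M * (\<Sum>y\<in>Y. ?D y x)" for x
    proof (cases "s x = s (x - k)")
      case False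
      obtain y where y: "y \<in> Y" "?D y x = 1"
      proof (cases "s x = 0")
        case True then show ?thesis using that[of "s (x - k)"] False by (auto simp: Y_def)
      next
        case f2: False then show ?thesis using that[of "s x"] False by (auto simp: Y_def)
      qed
      have "norm (s x - s (x - k)) powr p \<le> M * 1"
        using norm_triangle_ineq4[of "s x" "s (x - k)"] B[of x] B[of "x - k"] p unfolding M_def by (simp add: powr_mono2)
      also have "\<dots> \<le> M * (\<Sum>y\<in>Y. ?D y x)"
        using y Y M member_le_sum[of y Y "\<lambda>y. ?D y x"] by (intro mult_left_mono) auto
      finally show ?thesis .
    qed (simp add: sum_nonneg M)
    have "Lp_power p (\<lambda>x. g (x - k) - g x)
      \<le> (\<integral>\<^sup>+x. ennreal (c * c) * ennreal (norm (g (x + - k) - s (x + - k)) powr p) + (ennreal (c * c) * ennreal (norm (g x - s x) powr p)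
           + ennreal (c * M) * (\<Sum>y\<in>Y. ennreal (?D y x))) \<partial>lborel)"
    proof (rule nn_integral_mono)
      fix x
      let ?a = "norm (g (x - k) - s (x - k)) powr p" and ?b = "norm (g x - s x) powr p"
      have "norm (g (x - k) - g x) powr p = norm (((g (x - k) - s (x - k)) - (g x - s x)) - (s x - s (x - k))) powr p"
        by (simp add: algebra_simps)
      also have "\<dots> \<le> c * (norm ((g (x - k) - s (x - k)) - (g x - s x)) powr p + norm (s x - s (x - k)) powr p)"
        unfolding c_def using p by (intro norm_diff_powr_le) auto
      also have "\<dots> \<le> c * (c * (?a + ?b) + M * (\<Sum>y\<in>Y. ?D y x))"
        unfolding c_def using p by (intro mult_left_mono add_mono norm_diff_powr_le sd) auto
      also have "\<dots> = (c * c) * ?a + ((c * c) * ?b + (c * M) * (\<Sum>y\<in>Y. ?D y x))" by (simp add: algebra_simps)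
      finally have "ennreal (norm (g (x - k) - g x) powr p) \<le> ennreal ((c * c) * ?a + ((c * c) * ?b + (c * M) * (\<Sum>y\<in>Y. ?D y x)))"
        by (rule ennreal_leI)
      also have "\<dots> = ennreal (c * c) * ennreal ?a + (ennreal (c * c) * ennreal ?b + ennreal (c * M) * (\<Sum>y\<in>Y. ennreal (?D y x)))"
        using c M by (simp add: ennreal_plus ennreal_mult sum_nonneg sum_ennreal)
      finally show "ennreal (norm (g (x - k) - g x) powr p) \<le> ennreal (c * c) * ennreal (norm (g (x + - k) - s (x + - k)) powr p) + (ennreal (c * c) * ennreal ?b
           + ennreal (c * M) * (\<Sum>y\<in>Y. ennreal (?D y x)))" by simp
    qed
    also have "\<dots> = ennreal (c * c) * (\<integral>\<^sup>+x. ennreal (norm (g (x + - k) - s (x + - k)) powr p) \<partial>lborel) + (ennreal (c * c) * Lp_power p (\<lambda>x. g x - s x)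
           + ennreal (c * M) * (\<Sum>y\<in>Y. \<integral>\<^sup>+x. ennreal (?D y x) \<partial>lborel))"
      by (simp add: nn_integral_add nn_integral_cmult nn_integral_sum del: sum_ennreal)
    also have "(\<integral>\<^sup>+x. ennreal (norm (g (x + - k) - s (x + - k)) powr p) \<partial>lborel) = Lp_power p (\<lambda>x. g x - s x)"
      by (rule nn_integral_lborel_shift[of "\<lambda>x. ennreal (norm (g x - s x) powr p)"]) measurable
    also have "ennreal (c * c) * Lp_power p (\<lambda>x. g x - s x) + (ennreal (c * c) * Lp_power p (\<lambda>x. g x - s x)
           + ennreal (c * M) * (\<Sum>y\<in>Y. \<integral>\<^sup>+x. ennreal (?D y x) \<partial>lborel))
       \<le> ennreal (c * c) * ennreal t1 + (ennreal (c * c) * ennreal t1 + ennreal (c * M) * (\<Sum>y\<in>Y. ennreal t2))"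
      using elim by (intro add_mono mult_left_mono s(2) sum_mono) auto
    also have "\<dots> = ennreal (c * c * t1 + (c * c * t1 + c * M * (real (card Y) * t2)))"
      using c t1 t2 M by (simp add: ennreal_of_nat_eq_real_of_nat del: ennreal_plus ennreal_mult flip: ennreal_plus ennreal_mult)
    also have "\<dots> \<le> ennreal t"
    proof (rule ennreal_leI)
      have "c * c * t1 = t / 4" using c by (simp add: t1_def)
      moreover have "c * M * (real (card Y) * t2) = (t / 2) * (M / (M + 1) * (real (card Y) / (real (card Y) + 1)))" 
      proof -
        have "M + 1 \<noteq> 0" "real (card Y) + 1 \<noteq> 0" "c \<noteq> 0" using c M by linarith+
        then show ?thesis by (simp add: t2_def divide_simps)
      qed
      moreover have "(t / 2) * (M / (M + 1) * (real (card Y) / (real (card Y) + 1))) \<le> (t / 2) * (1 * 1)"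
        using t M by (intro mult_left_mono mult_mono) (auto simp: divide_le_eq_1)
      ultimately show "c * c * t1 + (c * c * t1 + c * M * (real (card Y) * t2)) \<le> t" by linarith
    qed
    finally show ?case .
  qed
qed

abbreviation remainder_power :: "real \<Rightarrow> ('a::euclidean_space \<Rightarrow> real) \<Rightarrow> ('a \<Rightarrow> 'a) \<Rightarrow> 'a \<Rightarrow> ennreal" where
  "remainder_power p u g h \<equiv> \<integral>\<^sup>+x. ennreal (\<bar>u x - u (x - h) - g x \<bullet> h\<bar> powr p) \<partial>lborel"

text \<open>\<open>g\<close> is a gradient of \<open>u\<close> in the sense of \<open>L\<^sup>p\<close>: translation differences are linear in \<open>h\<close> up to \<open>o(|h|)\<close>, with a
  bound \<open>O(|h|)\<close> for all \<open>h\<close>. This is everything that the limit uses about the functions \<open>u\<close> and \<open>v\<close>.\<close>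

definition strong_Lp_grad :: "real \<Rightarrow> ('a::euclidean_space \<Rightarrow> real) \<Rightarrow> ('a \<Rightarrow> 'a) \<Rightarrow> bool" where
  "strong_Lp_grad p u g \<longleftrightarrow> u \<in> borel_measurable borel \<and> g \<in> borel_measurable borel \<and>
     (\<integral>\<^sup>+x. ennreal (\<bar>u x\<bar> powr p) \<partial>lborel) < \<infinity> \<and> Lp_power p g < \<infinity> \<and>
     (\<exists>C\<ge>0. \<forall>h. remainder_power p u g h \<le> ennreal (C * norm h powr p)) \<and>
     (\<forall>t>0. \<forall>\<^sub>F h in nhds 0. remainder_power p u g h \<le> ennreal (t * norm h powr p))"

lemma strong_Lp_grad_borel:
  assumes "strong_Lp_grad p u g"
  shows "u \<in> borel_measurable borel" and "g \<in> borel_measurable borel"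
  using assms by (simp_all add: strong_Lp_grad_def)

lemma (in borel_weak_gradient) strong_Lp_gradI:
  assumes p: "1 < p"
    and ufin: "(\<integral>\<^sup>+x. ennreal (\<bar>u x\<bar> powr p) \<partial>lborel) < \<infinity>" and gfin: "Lp_power p g < \<infinity>"
  shows "strong_Lp_grad p u g"
proof -
  let ?W = "\<lambda>k. \<integral>\<^sup>+x. ennreal (norm (g (x - k) - g x) powr p) \<partial>lborel"
  have rem: "remainder_power p u g h \<le> ennreal (C * norm h powr p)"
    if C: "\<And>t. t \<in> {0..1} \<Longrightarrow> ?W (t *\<^sub>R h) \<le> ennreal C" "0 \<le> C" for h C
  proof -
    have "(\<integral>\<^sup>+t. indicator {0..1::real} t * ?W (t *\<^sub>R h) \<partial>lborel) \<le> (\<integral>\<^sup>+t. indicator {0..1::real} t * ennreal C \<partial>lborel)"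
      using C by (intro nn_integral_mono) (auto split: split_indicator)
    also have "\<dots> = ennreal C" by (simp add: nn_integral_multc)
    finally show ?thesis 
      using order_trans[OF difference_remainder_bound[OF p, of h] mult_left_mono] C(2)
      by (simp add: ennreal_mult mult.commute)
  qed
  obtain G where G: "Lp_power p g = ennreal G" "G \<ge> 0"
    using gfin by (cases "Lp_power p g") auto
  have Wb: "?W k \<le> ennreal (2 powr p * (G + G))" for k
  proof -
    have "?W k \<le> (\<integral>\<^sup>+x. ennreal (2 powr p) * (ennreal (norm (g (x + - k)) powr p) + ennreal (norm (g x) powr p)) \<partial>lborel)"
      using p by (intro nn_integral_mono) (simp add: norm_diff_powr_le ennreal_leI flip: ennreal_plus ennreal_mult)
    also have "\<dots> = ennreal (2 powr p) * ((\<integral>\<^sup>+x. ennreal (norm (g (x + - k)) powr p) \<partial>lborel) + Lp_power p g)"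
      by (simp add: nn_integral_cmult nn_integral_add)
    also have "(\<integral>\<^sup>+x. ennreal (norm (g (x + - k)) powr p) \<partial>lborel) = Lp_power p g"
      by (rule nn_integral_lborel_shift[of "\<lambda>x. ennreal (norm (g x) powr p)"]) measurable
    finally show ?thesis using G by (simp flip: ennreal_plus ennreal_mult)
  qed
  have 1: "\<exists>C\<ge>0. \<forall>h. remainder_power p u g h \<le> ennreal (C * norm h powr p)"
    using rem[OF Wb] G(2) by (intro exI[of _ "2 powr p * (G + G)"]) auto
  have 2: "\<forall>\<^sub>F h in nhds 0. remainder_power p u g h \<le> ennreal (t * norm h powr p)" if t: "t > 0" for t
  proof -
    have "\<forall>\<^sub>F k in nhds 0. ?W k \<le> ennreal t" using p by (intro Lp_translation_continuous gfin t) auto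
    then obtain d where d: "d > 0" "\<And>k. norm k < d \<Longrightarrow> ?W k \<le> ennreal t" unfolding eventually_nhds_0_norm by blast
    have "remainder_power p u g h \<le> ennreal (t * norm h powr p)" if h: "norm h < d" for h
    proof (rule rem)
      fix s :: real assume s: "s \<in> {0..1}"
      then have "norm (s *\<^sub>R h) \<le> norm h" by (simp add: mult_left_le_one_le)
      then show "?W (s *\<^sub>R h) \<le> ennreal t" using d(2)[of "s *\<^sub>R h"] h by simp
    qed (use t in simp)
    then show ?thesis using d(1) unfolding eventually_nhds_0_norm by blast
  qed
  show ?thesis unfolding strong_Lp_grad_def using ufin gfin 1 2 by simp
qed

lemma lebesgue_ex_borel:
  fixes f :: "'a::euclidean_space \<Rightarrow> 'b::euclidean_space"
  assumes "f \<in> borel_measurable lebesgue"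
  obtains f' where "f' \<in> borel_measurable borel" "AE x in lborel. f x = f' x"
proof -
  have "\<forall>b. \<exists>F. F \<in> borel_measurable borel \<and> (AE x in lborel. f x \<bullet> b = F x)"
  proof
    fix b
    have "(\<lambda>x. f x \<bullet> b) \<in> borel_measurable lebesgue" using assms by (intro borel_measurable_inner) auto
    then show "\<exists>F. F \<in> borel_measurable borel \<and> (AE x in lborel. f x \<bullet> b = F x)" using completion_ex_borel_measurable_real by fastforce
  qed
  then obtain F where F: "\<And>b. F b \<in> borel_measurable borel" "\<And>b. AE x in lborel. f x \<bullet> b = F b x" by metis
  have "AE x in lborel. \<forall>b\<in>Basis. f x \<bullet> b = F b x" by (intro AE_finite_allI F) simp
  then have "AE x in lborel. f x = (\<Sum>b\<in>Basis. F b x *\<^sub>R b)"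
  proof eventually_elim
    case (elim x)
    have "f x = (\<Sum>b\<in>Basis. (f x \<bullet> b) *\<^sub>R b)" by (rule euclidean_representation[symmetric])
    also have "\<dots> = (\<Sum>b\<in>Basis. F b x *\<^sub>R b)" by (intro sum.cong) (use elim in auto)
    finally show ?case .
  qed
  moreover have "(\<lambda>x. \<Sum>b\<in>Basis. F b x *\<^sub>R b) \<in> borel_measurable borel" using F(1) by measurable
  ultimately show ?thesis using that by blast
qed

text \<open>A test function on \<open>\<Omega>\<close> and its derivative vanish outside \<open>\<Omega>\<close>, so the integrals over \<open>\<Omega>\<close> and over the whole
  space agree.\<close>

lemma is_weak_grad_subset:
  assumes "is_weak_grad UNIV u g" "open \<Omega>"
  shows "is_weak_grad \<Omega> u g"
proof -
  have 1: "loc_integrable \<Omega> u" "loc_integrable \<Omega> g" using assms by (auto simp: is_weak_grad_def loc_integrable_def)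
  have "(LINT x:\<Omega>|lebesgue. u x * frechet_derivative \<phi> (at x) b) = - (LINT x:\<Omega>|lebesgue. (g x \<bullet> b) * \<phi> x)" 
    if \<phi>: "test_fun \<Omega> \<phi>" and b: "b \<in> Basis" for \<phi> b
  proof -
    have "test_fun UNIV \<phi>" using \<phi> by (simp add: test_fun_def)
    then have "(LINT x:UNIV|lebesgue. u x * frechet_derivative \<phi> (at x) b) = - (LINT x:UNIV|lebesgue. (g x \<bullet> b) * \<phi> x)"
      using assms(1) b by (simp add: is_weak_grad_def)
    moreover have "x \<in> \<Omega>" if "\<phi> x \<noteq> 0" for x using \<phi> that closure_subset[of "{x. \<phi> x \<noteq> 0}"] by (auto simp: test_fun_def)
    then have "indicator \<Omega> x *\<^sub>R ((g x \<bullet> b) * \<phi> x) = indicator UNIV x *\<^sub>R ((g x \<bullet> b) * \<phi> x)" for x by (auto split: split_indicator)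
    moreover have "frechet_derivative \<phi> (at x) b = 0" if "x \<notin> \<Omega>" for x 
    proof -
      have "x \<notin> closure {x. \<phi> x \<noteq> 0}" using \<phi> that unfolding test_fun_def by blast
      then show ?thesis by (simp add: frechet_derivative_zero_outside_support)
    qed
    then have "indicator \<Omega> x *\<^sub>R (u x * frechet_derivative \<phi> (at x) b) = indicator UNIV x *\<^sub>R (u x * frechet_derivative \<phi> (at x) b)" for x 
      by (auto split: split_indicator)
    ultimately show ?thesis unfolding set_lebesgue_integral_def by (simp only:)
  qed
  then show ?thesis using 1 by (auto simp: is_weak_grad_def)
qed

lemma weak_grad_unique:
  assumes \<Omega>: "open \<Omega>" and 1: "is_weak_grad \<Omega> u g1" and 2: "is_weak_grad \<Omega> u g2"
  shows "AE x in lebesgue. x \<in> \<Omega> \<longrightarrow> g1 x = g2 x"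
proof -
  have "AE x in lebesgue. x \<in> \<Omega> \<longrightarrow> (g1 x - g2 x) \<bullet> b = 0" if b: "b \<in> Basis" for b
  proof (rule test_funs_separate[OF \<Omega>])
    have l: "loc_integrable \<Omega> (\<lambda>x. g x \<bullet> b)" if "is_weak_grad \<Omega> u g" for g
      unfolding loc_integrable_def
    proof (intro allI impI)
      fix K assume "compact K \<and> K \<subseteq> \<Omega>"
      then have "integrable lebesgue (\<lambda>x. (indicator K x *\<^sub>R g x) \<bullet> b)"
        using that by (intro integrable_inner_left) (auto simp: is_weak_grad_def loc_integrable_def set_integrable_def)
      then show "set_integrable lebesgue K (\<lambda>x. g x \<bullet> b)" by (simp add: set_integrable_def)
    qed
    show "loc_integrable \<Omega> (\<lambda>x. (g1 x - g2 x) \<bullet> b)"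
      using l[OF 1] l[OF 2] unfolding loc_integrable_def inner_diff_left by (auto intro: set_integral_diff)
    fix \<phi> assume \<phi>: "test_fun \<Omega> \<phi>"
    have i: "set_integrable lebesgue \<Omega> (\<lambda>x. (g x \<bullet> b) * \<phi> x)" if g: "is_weak_grad \<Omega> u g" for g
    proof -
      let ?K = "closure {x. \<phi> x \<noteq> 0}"
      have K: "compact ?K" "?K \<subseteq> \<Omega>" using \<phi> by (auto simp: test_fun_def)
      have Ki: "integrable lebesgue (\<lambda>x. indicator ?K x *\<^sub>R (g x \<bullet> b))" using l[OF g] K by (auto simp: loc_integrable_def set_integrable_def)
      have "test_fun UNIV \<phi>" using \<phi> by (simp add: test_fun_def)
      then obtain R where R: "\<And>x. R < norm x \<Longrightarrow> \<phi> x = 0" by (rule test_fun_support_ball) (rule that)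
      obtain B where B: "B \<ge> 0" "\<And>x. \<bar>\<phi> x\<bar> \<le> B" 
        using continuous_zero_off_ball_bounded[OF test_fun_continuous[OF \<phi>] R] by metis
      have z: "\<phi> x = 0" if "x \<notin> ?K" for x using that closure_subset[of "{x. \<phi> x \<noteq> 0}"] by auto
      have "integrable lebesgue (\<lambda>x. \<phi> x * (indicator ?K x *\<^sub>R (g x \<bullet> b)))"
      proof (rule Bochner_Integration.integrable_bound)
        show "integrable lebesgue (\<lambda>x. B * (indicator ?K x *\<^sub>R (g x \<bullet> b)))" by (intro integrable_mult_right Ki)
        show "(\<lambda>x. \<phi> x * (indicator ?K x *\<^sub>R (g x \<bullet> b))) \<in> borel_measurable lebesgue"
          by (intro borel_measurable_times borel_measurable_integrable[OF Ki] measurable_completion) 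
             (simp add: borel_measurable_continuous_onI test_fun_continuous[OF \<phi>])
        show "AE x in lebesgue. norm (\<phi> x * (indicator ?K x *\<^sub>R (g x \<bullet> b))) \<le> norm (B * (indicator ?K x *\<^sub>R (g x \<bullet> b)))"
          using B by (intro AE_I2) (simp add: abs_mult mult_right_mono)
      qed
      also have "(\<lambda>x. \<phi> x * (indicator ?K x *\<^sub>R (g x \<bullet> b))) = (\<lambda>x. indicator \<Omega> x *\<^sub>R ((g x \<bullet> b) * \<phi> x))"
      proof
        fix x
        show "\<phi> x * (indicator ?K x *\<^sub>R (g x \<bullet> b)) = indicator \<Omega> x *\<^sub>R ((g x \<bullet> b) * \<phi> x)"
        proof (cases "x \<in> ?K")
          case True 
          then have "x \<in> \<Omega>" using K(2) by blast
          then show ?thesis using True by simp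
        next
          case False then show ?thesis using z[OF False] by simp
        qed
      qed
      finally show ?thesis by (simp add: set_integrable_def)
    qed
    have "(LINT x:\<Omega>|lebesgue. (g1 x - g2 x) \<bullet> b * \<phi> x) = (LINT x:\<Omega>|lebesgue. (g1 x \<bullet> b) * \<phi> x) - (LINT x:\<Omega>|lebesgue. (g2 x \<bullet> b) * \<phi> x)"
      unfolding inner_diff_left left_diff_distrib by (rule set_integral_diff(2)[OF i[OF 1] i[OF 2]])
    also have "\<dots> = 0" using 1 2 \<phi> b unfolding is_weak_grad_def by fastforce
    finally show "(LINT x:\<Omega>|lebesgue. (g1 x - g2 x) \<bullet> b * \<phi> x) = 0" .
  qed
  then have "AE x in lebesgue. \<forall>b\<in>Basis. x \<in> \<Omega> \<longrightarrow> (g1 x - g2 x) \<bullet> b = 0" by (intro AE_finite_allI) auto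
  then show ?thesis by eventually_elim (auto simp: inner_diff_left intro: euclidean_eqI)
qed

section \<open>Borel representatives and radial functions\<close>

lemma lebesgue_measurable_AE_eq:
  fixes f f' :: "'a::euclidean_space \<Rightarrow> 'b::topological_space"
  assumes f': "f' \<in> borel_measurable borel" and ae: "AE x in lborel. f x = f' x"
  shows "f \<in> borel_measurable lebesgue"
proof (rule measurableI)
  fix B :: "'b set" assume B: "B \<in> sets borel"
  show "f -` B \<inter> space lebesgue \<in> sets lebesgue"
  proof (rule completion.in_sets_AE)
    show "AE x in lebesgue. (x \<in> f' -` B) = (x \<in> f -` B \<inter> space lebesgue)"
      using AE_completion[OF ae] by eventually_elim simp
    show "f' -` B \<in> sets lebesgue" using measurable_sets[OF f' B] by simp
  qed simp
qed simp

lemma lebesgue_borel_transfer: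
  fixes f f' :: "'a::euclidean_space \<Rightarrow> 'b::{banach, second_countable_topology}"
  assumes f': "f' \<in> borel_measurable borel" and ae: "AE x in lborel. f x = f' x"
  shows "integrable lebesgue f \<longleftrightarrow> integrable lborel f'" "integral\<^sup>L lebesgue f = integral\<^sup>L lborel f'"
proof -
  have f: "f \<in> borel_measurable lebesgue" by (rule lebesgue_measurable_AE_eq[OF f' ae])
  have fl: "f' \<in> borel_measurable lebesgue" using f' by (simp add: measurable_completion)
  have ae': "AE x in lebesgue. f x = f' x" by (rule AE_completion[OF ae])
  show "integrable lebesgue f \<longleftrightarrow> integrable lborel f'"
    using integrable_cong_AE[OF f fl ae'] integrable_completion[of f' lborel] f' by simp
  show "integral\<^sup>L lebesgue f = integral\<^sup>L lborel f'"
    using integral_cong_AE[OF f fl ae'] integral_completion[of f' lborel] f' by simp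
qed

text \<open>The chosen weak gradient on an open set agrees almost everywhere with any other weak gradient there, in
  particular with the restriction of \<open>g\<close>; one Borel representative therefore serves all open sets.\<close>

lemma W1p_strong_Lp_grad:
  fixes u :: "'a::euclidean_space \<Rightarrow> real"
  assumes p: "1 < p" and u: "u \<in> W1p p UNIV"
  obtains u' g' where "strong_Lp_grad p u' g'" "AE x in lborel. u x = u' x"
    "\<And>\<Omega>. open \<Omega> \<Longrightarrow> AE x in lborel. x \<in> \<Omega> \<longrightarrow> weak_grad \<Omega> u x = g' x"
proof -
  from u obtain g where Lu: "Lp_on p UNIV u" and g: "is_weak_grad UNIV u g" and Lg: "Lp_on p UNIV g"
    by (auto simp: W1p_def)
  have um: "u \<in> borel_measurable lebesgue" "g \<in> borel_measurable lebesgue" 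
    using Lu Lg by (auto simp: Lp_on_def set_borel_measurable_def)
  obtain u' where u'[measurable]: "u' \<in> borel_measurable borel" and uae: "AE x in lborel. u x = u' x"
    by (rule lebesgue_ex_borel[OF um(1)])
  obtain g' where g'[measurable]: "g' \<in> borel_measurable borel" and gae: "AE x in lborel. g x = g' x"
    by (rule lebesgue_ex_borel[OF um(2)])
  interpret borel_weak_gradient u' g'
  proof
    fix R
    have "set_integrable lebesgue (cball 0 R) u" "set_integrable lebesgue (cball 0 R) g"
      using g by (auto simp: is_weak_grad_def loc_integrable_def)
    moreover have "integrable lebesgue (\<lambda>x. indicator (cball 0 R) x *\<^sub>R u x) \<longleftrightarrow> integrable lborel (\<lambda>x. indicator (cball 0 R) x *\<^sub>R u' x)"
      by (rule lebesgue_borel_transfer(1)) (measurable, use uae in eventually_elim, simp)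
    moreover have "integrable lebesgue (\<lambda>x. indicator (cball 0 R) x *\<^sub>R g x) \<longleftrightarrow> integrable lborel (\<lambda>x. indicator (cball 0 R) x *\<^sub>R g' x)"
      by (rule lebesgue_borel_transfer(1)) (measurable, use gae in eventually_elim, simp)
    ultimately show "set_integrable lborel (cball 0 R) u'" "set_integrable lborel (cball 0 R) g'"
      by (simp_all add: set_integrable_def)
  next
    fix \<phi> :: "'a \<Rightarrow> real" and b :: 'a assume \<phi>: "test_fun UNIV \<phi>" and b: "b \<in> Basis"
    have [measurable]: "\<phi> \<in> borel_measurable borel" "(\<lambda>x. frechet_derivative \<phi> (at x) b) \<in> borel_measurable borel"
      by (intro borel_measurable_continuous_onI test_fun_continuous[OF \<phi>] test_fun_derivative_continuous[OF \<phi>])+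
    have "(LINT x|lebesgue. u x * frechet_derivative \<phi> (at x) b) = (\<integral>x. u' x * frechet_derivative \<phi> (at x) b \<partial>lborel)"
      by (rule lebesgue_borel_transfer(2)) (measurable, use uae in eventually_elim, simp)
    moreover have "(LINT x|lebesgue. (g x \<bullet> b) * \<phi> x) = (\<integral>x. (g' x \<bullet> b) * \<phi> x \<partial>lborel)"
      by (rule lebesgue_borel_transfer(2)) (measurable, use gae in eventually_elim, simp)
    ultimately show "(\<integral>x. u' x * frechet_derivative \<phi> (at x) b \<partial>lborel) = - (\<integral>x. (g' x \<bullet> b) * \<phi> x \<partial>lborel)"
      using g \<phi> b by (simp add: is_weak_grad_def set_lebesgue_integral_def)
  qed measurable
  have "integrable lebesgue (\<lambda>x. \<bar>u x\<bar> powr p) \<longleftrightarrow> integrable lborel (\<lambda>x. \<bar>u' x\<bar> powr p)"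
    by (rule lebesgue_borel_transfer(1)) (measurable, use uae in eventually_elim, simp)
  moreover have "integrable lebesgue (\<lambda>x. norm (g x) powr p) \<longleftrightarrow> integrable lborel (\<lambda>x. norm (g' x) powr p)"
    by (rule lebesgue_borel_transfer(1)) (measurable, use gae in eventually_elim, simp)
  ultimately have "integrable lborel (\<lambda>x. \<bar>u' x\<bar> powr p)" "integrable lborel (\<lambda>x. norm (g' x) powr p)"
    using Lu Lg by (simp_all add: Lp_on_def set_integrable_def)
  then have fin: "(\<integral>\<^sup>+x. ennreal (\<bar>u' x\<bar> powr p) \<partial>lborel) < \<infinity>" "Lp_power p g' < \<infinity>"
    by (simp_all add: integrable_iff_bounded)
  have "AE x in lborel. x \<in> \<Omega> \<longrightarrow> weak_grad \<Omega> u x = g' x" if \<Omega>: "open \<Omega>" for \<Omega>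
  proof -
    have g\<Omega>: "is_weak_grad \<Omega> u g" by (rule is_weak_grad_subset[OF g \<Omega>])
    then have "is_weak_grad \<Omega> u (weak_grad \<Omega> u)" unfolding weak_grad_def by (rule someI[of "is_weak_grad \<Omega> u"])
    from weak_grad_unique[OF \<Omega> this g\<Omega>] have "AE x in lborel. x \<in> \<Omega> \<longrightarrow> weak_grad \<Omega> u x = g x" by (simp add: AE_completion_iff)
    then show ?thesis using gae by eventually_elim simp
  qed
  with that strong_Lp_gradI[OF p fin] uae show ?thesis by blast
qed

lemma norm_image_fsigma_borel:
  fixes C :: "'a::euclidean_space set"
  assumes "fsigma C" shows "norm ` C \<in> sets borel"
proof -
  obtain F :: "nat \<Rightarrow> 'a set" where F: "range F \<subseteq> Collect compact" "C = \<Union>(F ` UNIV)" 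
    using assms fsigma_Union_compact by blast
  have "norm ` C = (\<Union>n. norm ` F n)" using F(2) by auto
  moreover have "norm ` F n \<in> sets borel" for n
    using F(1) by (intro borel_compact compact_continuous_image continuous_intros) auto
  ultimately show ?thesis by auto
qed

text \<open>Up to null sets, both \<open>norm -` T\<close> and its complement are countable unions of compact sets. Their images
  under the norm are Borel and enclose \<open>T\<close> from inside and outside, and the gap between them has a null
  preimage because the sets involved are radial.\<close>

lemma norm_vimage_lebesgue_imp_completion:
  fixes T :: "real set"
  assumes T: "(norm :: 'a::euclidean_space \<Rightarrow> real) -` T \<in> sets lebesgue"
  shows "T \<in> sets (completion (distr (lborel :: 'a measure) borel norm))"
proof -
  let ?n = "norm :: 'a \<Rightarrow> real"
  obtain C N where C: "fsigma C" "N \<in> null_sets lebesgue" "C \<union> N = ?n -` T"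
    by (rule lebesgue_set_almost_fsigma[OF T]) (rule that)
  have "?n -` (- T) \<in> sets lebesgue" using T by (simp add: vimage_Compl Compl_in_sets_lebesgue)
  then obtain C' N' where C': "fsigma C'" "N' \<in> null_sets lebesgue" "C' \<union> N' = ?n -` (- T)"
    by (rule lebesgue_set_almost_fsigma) (rule that)
  have b[measurable]: "?n ` C \<in> sets borel" "?n ` C' \<in> sets borel" by (intro norm_image_fsigma_borel C C')+
  have s: "?n ` C \<subseteq> T" "?n ` C' \<subseteq> - T" using C(3) C'(3) by auto
  have "?n -` (- (?n ` C') - ?n ` C) \<subseteq> N \<union> N'" using C(3) C'(3) by blast
  moreover have "N \<union> N' \<in> null_sets lebesgue" using C(2) C'(2) by (rule null_sets.Un)
  moreover have "?n -` (- (?n ` C') - ?n ` C) \<in> sets lebesgue"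
    using measurable_sets[of ?n borel borel "- (?n ` C') - ?n ` C"] b by auto
  ultimately have "?n -` (- (?n ` C') - ?n ` C) \<in> null_sets lebesgue" by (rule null_sets_subset[rotated 2])
  moreover have "?n -` (- (?n ` C') - ?n ` C) \<in> sets lborel"
    using measurable_sets[of ?n borel borel "- (?n ` C') - ?n ` C"] b by auto
  ultimately have "?n -` (- (?n ` C') - ?n ` C) \<in> null_sets lborel"
    by (simp add: null_sets_completion_iff)
  then have "- (?n ` C') - ?n ` C \<in> null_sets (distr lborel borel ?n)"
    using b by (simp add: null_sets_distr_iff)
  then show ?thesis
    by (rule sets_completionI[of T "?n ` C" "T - ?n ` C", rotated 2]) (use s b in auto)
qed

text \<open>A radial Lebesgue measurable function need not be a Borel function of the norm, and a Borel
  representative need not be radial; this representative is both. The profile along a unit vector is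
  measurable for the completed image measure of the norm, hence equal almost everywhere to a Borel
  function.\<close>

lemma radial_ex_borel_profile:
  fixes \<nu> :: "'a::euclidean_space \<Rightarrow> real"
  assumes m: "\<nu> \<in> borel_measurable (lebesgue_on (UNIV - {0}))"
    and nn: "\<And>h. h \<noteq> 0 \<Longrightarrow> 0 \<le> \<nu> h"
    and rad: "\<And>h k. h \<noteq> 0 \<Longrightarrow> k \<noteq> 0 \<Longrightarrow> norm h = norm k \<Longrightarrow> \<nu> h = \<nu> k"
  obtains r where "r \<in> borel_measurable borel" "\<And>t. 0 \<le> r t" "AE h in lborel. \<nu> h = r (norm h)"
proof -
  define e where "e = (SOME b. b \<in> (Basis :: 'a set))"
  have "norm e = 1" unfolding e_def by (simp add: SOME_Basis)
  then have e: "norm e = 1" "e \<noteq> 0" by auto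
  define r0 where "r0 t = (if 0 < t then \<nu> (t *\<^sub>R e) else 0)" for t
  have r0: "r0 (norm h) = \<nu> h" if "h \<noteq> 0" for h
    using that e rad[of "norm h *\<^sub>R e" h] by (auto simp: r0_def)
  let ?M = "distr (lborel :: 'a measure) borel norm"
  have "r0 \<in> borel_measurable (completion ?M)"
  proof (rule measurableI)
    fix B :: "real set" assume B: "B \<in> sets borel"
    have "{h \<in> space (lebesgue_on (UNIV - {0})). \<nu> h \<in> B} \<in> sets (lebesgue_on (UNIV - {0}))"
      using measurable_sets[OF m B] by (simp add: vimage_def Int_def conj_commute)
    then have "{h. h \<noteq> 0 \<and> \<nu> h \<in> B} \<in> sets lebesgue"
      by (subst (asm) sets_restrict_space_iff) (auto simp: space_restrict_space)
    moreover have "(if r0 0 \<in> B then {0} else {} :: 'a set) \<in> sets lebesgue" by auto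
    ultimately have "{h. h \<noteq> 0 \<and> \<nu> h \<in> B} \<union> (if r0 0 \<in> B then {0} else {}) \<in> sets lebesgue" by (rule sets.Un)
    also have "{h. h \<noteq> 0 \<and> \<nu> h \<in> B} \<union> (if r0 0 \<in> B then {0} else {}) = norm -` (r0 -` B)"
    proof (rule set_eqI)
      fix x :: 'a
      show "x \<in> {h. h \<noteq> 0 \<and> \<nu> h \<in> B} \<union> (if r0 0 \<in> B then {0} else {}) \<longleftrightarrow> x \<in> norm -` (r0 -` B)"
        using r0[of x] by (cases "x = 0") auto
    qed
    finally show "r0 -` B \<inter> space (completion ?M) \<in> sets (completion ?M)"
      using norm_vimage_lebesgue_imp_completion by simp
  qed simp
  then obtain r1 where r1: "r1 \<in> borel_measurable ?M" "AE t in ?M. r0 t = r1 t"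
    using completion_ex_borel_measurable_real by blast
  have "AE h in (lborel :: 'a measure). r0 (norm h) = r1 (norm h)" by (rule AE_distrD[OF _ r1(2)]) simp
  moreover have "AE h in (lborel :: 'a measure). h \<noteq> 0" by (rule AE_lborel_singleton)
  ultimately have "AE h in lborel. \<nu> h = max 0 (r1 (norm h))"
    by eventually_elim (use r0 nn in force)
  then show ?thesis using r1(1) by (intro that[of "\<lambda>t. max 0 (r1 t)"]) auto
qed

lemma nn_integral_lborel_reflect:
  fixes f :: "'a::euclidean_space \<Rightarrow> ennreal"
  assumes [measurable]: "f \<in> borel_measurable borel"
  shows "(\<integral>\<^sup>+x. f (c - x) \<partial>lborel) = (\<integral>\<^sup>+x. f x \<partial>lborel)"
proof -
  have "lborel = distr lborel borel (\<lambda>x::'a. c - x)" using lborel_affine[of "-1" c] by (simp add: density_1)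
  then have "(\<integral>\<^sup>+x. f x \<partial>lborel) = (\<integral>\<^sup>+x. f x \<partial>distr lborel borel (\<lambda>x::'a. c - x))" 
    by (rule arg_cong[where f = "\<lambda>M. nn_integral M f"])
  also have "\<dots> = (\<integral>\<^sup>+x. f (c - x) \<partial>lborel)" by (rule nn_integral_distr) measurable
  finally show ?thesis by (rule sym)
qed

lemma orthogonal_transformation_borel:
  fixes T :: "'a::euclidean_space \<Rightarrow> 'a"
  assumes "orthogonal_transformation T" shows "T \<in> borel_measurable borel"
  using orthogonal_transformation_linear[OF assms]
  by (intro borel_measurable_continuous_onI linear_continuous_on linear_conv_bounded_linear[THEN iffD1])

text \<open>The uniqueness proof for Haar measure. With \<open>B\<close> the unit ball, which \<open>T\<close> preserves, compute
  \<open>\<integral>\<integral> 1\<^sub>A (T x) 1\<^sub>B (y + T x) dy dx\<close> in both orders; translation invariance and reflection in a point give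
  \<open>|T\<^sup>-\<^sup>1 A| |B|\<close> and \<open>|A| |B|\<close>.\<close>

lemma lborel_distr_orthogonal:
  fixes T :: "'a::euclidean_space \<Rightarrow> 'a"
  assumes T: "orthogonal_transformation T"
  shows "distr lborel borel T = lborel"
proof (rule measure_eqI)
  fix A :: "'a set" assume "A \<in> sets (distr lborel borel T)"
  then have A[measurable]: "A \<in> sets borel" by simp
  note Tm[measurable] = orthogonal_transformation_borel[OF T]
  interpret linear T by (rule orthogonal_transformation_linear[OF T])
  let ?B = "ball 0 1 :: 'a set"
  have [measurable]: "?B \<in> sets borel" by simp
  let ?\<mu> = "emeasure lborel :: 'a set \<Rightarrow> ennreal"
  have BT: "indicator ?B (T x) = (indicator ?B x :: ennreal)" for x
    by (simp add: indicator_def orthogonal_transformation_norm[OF T])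
  have surj: "\<exists>y'. T y' = y" for y using orthogonal_transformation_surj[OF T] by (metis surjD)
  have "emeasure (distr lborel borel T) A * ?\<mu> ?B = (\<integral>\<^sup>+x. indicator A (T x) * ?\<mu> ?B \<partial>lborel)"
  proof -
    have "emeasure (distr lborel borel T) A = (\<integral>\<^sup>+x. indicator A x \<partial>distr lborel borel T)" by simp
    also have "\<dots> = (\<integral>\<^sup>+x. indicator A (T x) \<partial>lborel)" by (subst nn_integral_distr) auto
    finally show ?thesis by (simp add: nn_integral_multc)
  qed
  also have "\<dots> = (\<integral>\<^sup>+x. \<integral>\<^sup>+y. indicator A (T x) * indicator ?B (y + T x) \<partial>lborel \<partial>lborel)"
  proof (rule nn_integral_cong)
    fix x
    have "(\<integral>\<^sup>+y. indicator ?B (y + T x) \<partial>lborel) = ?\<mu> ?B"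
      using nn_integral_lborel_shift[of "indicator ?B" "T x"] by simp
    then show "indicator A (T x) * ?\<mu> ?B = (\<integral>\<^sup>+y. indicator A (T x) * indicator ?B (y + T x) \<partial>lborel)"
      by (subst nn_integral_cmult) auto
  qed
  also have "\<dots> = (\<integral>\<^sup>+y. \<integral>\<^sup>+x. indicator A (T x) * indicator ?B (y + T x) \<partial>lborel \<partial>lborel)"
    by (rule lborel_pair.Fubini'[symmetric]) measurable
  also have "\<dots> = (\<integral>\<^sup>+y. \<integral>\<^sup>+x. indicator A (T x - y) * indicator ?B (T x) \<partial>lborel \<partial>lborel)"
  proof (rule nn_integral_cong)
    fix y
    \<comment> \<open>A translation by \<open>y\<close> after \<open>T\<close> is a translation by \<open>y'\<close> before \<open>T\<close>.\<close>
    obtain y' where y': "T y' = y" using surj by blast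
    show "(\<integral>\<^sup>+x. indicator A (T x) * indicator ?B (y + T x) \<partial>lborel) = (\<integral>\<^sup>+x. indicator A (T x - y) * indicator ?B (T x) \<partial>lborel)"
      using nn_integral_lborel_shift[of "\<lambda>x. indicator A (T x - y) * indicator ?B (T x)" y'] by (simp add: add y' add.commute)
  qed
  also have "\<dots> = (\<integral>\<^sup>+x. \<integral>\<^sup>+y. indicator A (T x - y) * indicator ?B (T x) \<partial>lborel \<partial>lborel)"
    by (rule lborel_pair.Fubini') measurable
  also have "\<dots> = (\<integral>\<^sup>+x. ?\<mu> A * indicator ?B x \<partial>lborel)"
  proof (rule nn_integral_cong)
    fix x
    have "(\<integral>\<^sup>+y. indicator A (T x - y) \<partial>lborel) = ?\<mu> A"
      using nn_integral_lborel_reflect[of "indicator A" "T x"] by simp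
    then show "(\<integral>\<^sup>+y. indicator A (T x - y) * indicator ?B (T x) \<partial>lborel) = ?\<mu> A * indicator ?B x"
      by (subst nn_integral_multc) (auto simp: BT)
  qed
  also have "\<dots> = ?\<mu> A * ?\<mu> ?B" by (simp add: nn_integral_cmult_indicator)
  finally have eq: "emeasure (distr lborel borel T) A * ?\<mu> ?B = ?\<mu> A * ?\<mu> ?B" .
  have "?\<mu> ?B \<noteq> 0" using content_ball_pos[of 1 "0::'a"] by (auto simp: measure_def)
  moreover have "?\<mu> ?B < \<infinity>" by (rule emeasure_lborel_ball_finite)
  ultimately show "emeasure (distr lborel borel T) A = ?\<mu> A" 
    using eq by (auto simp: mult.commute[of _ "?\<mu> ?B"] ennreal_mult_cancel_left)
qed simp

section \<open>Polar coordinates and the constant K\<close>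

lemma nn_integral_lborel_orthogonal:
  fixes f :: "'a::euclidean_space \<Rightarrow> ennreal" and T :: "'a \<Rightarrow> 'a"
  assumes T: "orthogonal_transformation T" and [measurable]: "f \<in> borel_measurable borel"
  shows "(\<integral>\<^sup>+x. f (T x) \<partial>lborel) = (\<integral>\<^sup>+x. f x \<partial>lborel)"
proof -
  note orthogonal_transformation_borel[OF T, measurable]
  have "(\<integral>\<^sup>+x. f x \<partial>lborel) = (\<integral>\<^sup>+x. f x \<partial>distr lborel borel T)" by (simp add: lborel_distr_orthogonal[OF T])
  also have "\<dots> = (\<integral>\<^sup>+x. f (T x) \<partial>lborel)" by (rule nn_integral_distr) measurable
  finally show ?thesis by (rule sym)
qed

lemma integral_lborel_orthogonal:
  fixes f :: "'a::euclidean_space \<Rightarrow> real" and T :: "'a \<Rightarrow> 'a"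
  assumes T: "orthogonal_transformation T" and [measurable]: "f \<in> borel_measurable borel"
  shows "(\<integral>x. f (T x) \<partial>lborel) = (\<integral>x. f x \<partial>lborel)"
proof -
  note orthogonal_transformation_borel[OF T, measurable]
  have "(\<integral>x. f x \<partial>lborel) = (\<integral>x. f x \<partial>distr lborel borel T)" by (simp add: lborel_distr_orthogonal[OF T])
  also have "\<dots> = (\<integral>x. f (T x) \<partial>lborel)" by (rule integral_distr) measurable
  finally show ?thesis by (rule sym)
qed

lemma nn_integral_ball_scaling:
  fixes G :: "'a::euclidean_space \<Rightarrow> ennreal"
  assumes [measurable]: "G \<in> borel_measurable borel" and hom: "\<And>c h. 0 < c \<Longrightarrow> G (c *\<^sub>R h) = G h" and t: "0 < t"
  shows "(\<integral>\<^sup>+h. G h * indicator (ball 0 t) h \<partial>lborel) = ennreal (t ^ DIM('a)) * (\<integral>\<^sup>+h. G h * indicator (ball 0 1) h \<partial>lborel)"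
proof -
  have [measurable]: "ball 0 s \<in> sets (borel :: 'a measure)" for s by simp
  have "lborel = density (distr lborel borel (\<lambda>x::'a. t *\<^sub>R x)) (\<lambda>_. ennreal (t ^ DIM('a)))"
    using lborel_affine[of t "0::'a"] t by simp
  then have "(\<integral>\<^sup>+h. G h * indicator (ball 0 t) h \<partial>lborel) 
     = (\<integral>\<^sup>+h. G h * indicator (ball 0 t) h \<partial>density (distr lborel borel (\<lambda>x::'a. t *\<^sub>R x)) (\<lambda>_. ennreal (t ^ DIM('a))))"
    by (rule arg_cong[where f = "\<lambda>M. nn_integral M (\<lambda>h. G h * indicator (ball 0 t) h)"])
  also have "\<dots> = (\<integral>\<^sup>+h. ennreal (t ^ DIM('a)) * (G (t *\<^sub>R h) * indicator (ball 0 t) (t *\<^sub>R h)) \<partial>lborel)"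
    by (simp add: nn_integral_density nn_integral_distr)
  also have "\<dots> = (\<integral>\<^sup>+h. ennreal (t ^ DIM('a)) * (G h * indicator (ball 0 1) h) \<partial>lborel)"
    using t by (intro nn_integral_cong) (auto simp: hom indicator_def)
  also have "\<dots> = ennreal (t ^ DIM('a)) * (\<integral>\<^sup>+h. G h * indicator (ball 0 1) h \<partial>lborel)"
    by (rule nn_integral_cmult) measurable
  finally show ?thesis .
qed

text \<open>For \<open>G\<close> homogeneous of degree zero the two sides, as measures in the radial variable, agree on the
  intervals below \<open>t\<close>: by scaling both equal \<open>t\<^sup>d\<close> times the product of the integral of \<open>G\<close> over the unit
  ball and the volume of that ball.\<close>

lemma nn_integral_polar:
  fixes G :: "'a::euclidean_space \<Rightarrow> ennreal" and \<rho> :: "real \<Rightarrow> ennreal"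
  assumes G[measurable]: "G \<in> borel_measurable borel" and hom: "\<And>c h. 0 < c \<Longrightarrow> G (c *\<^sub>R h) = G h"
    and fin: "(\<integral>\<^sup>+h. G h * indicator (ball 0 1) h \<partial>lborel) < \<infinity>" and [measurable]: "\<rho> \<in> borel_measurable borel"
  shows "emeasure lborel (ball 0 1 :: 'a set) * (\<integral>\<^sup>+h. G h * \<rho> (norm h) \<partial>lborel) 
       = (\<integral>\<^sup>+h. G h * indicator (ball 0 1) h \<partial>lborel) * (\<integral>\<^sup>+h. \<rho> (norm (h::'a)) \<partial>lborel)"
proof -
  have [measurable]: "ball 0 s \<in> sets (borel :: 'a measure)" for s by simp
  let ?b = "emeasure lborel (ball 0 1 :: 'a set)" and ?g = "\<integral>\<^sup>+h. G h * indicator (ball 0 1) h \<partial>lborel"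
  let ?M1 = "scale_measure ?b (distr (density lborel G) borel norm)"
  let ?M2 = "scale_measure ?g (distr (lborel :: 'a measure) borel norm)"
  have vim: "norm -` {..<t} = (ball 0 t :: 'a set)" for t by auto
  have e1: "emeasure (distr (density lborel G) borel norm) {..<t} = (\<integral>\<^sup>+h. G h * indicator (ball 0 t) h \<partial>lborel)" for t
    by (simp add: emeasure_distr emeasure_density vim)
  have e2: "emeasure (distr (lborel :: 'a measure) borel norm) {..<t} = (\<integral>\<^sup>+h. 1 * indicator (ball 0 t :: 'a set) h \<partial>lborel)" for t
    by (simp add: emeasure_distr vim)
  have "?M1 = ?M2"
  proof (rule measure_eqI_generator_eq)
    show "Int_stable (range (lessThan :: real \<Rightarrow> real set))" 
    proof -
      have "{..<a} \<inter> {..<b} = {..<min a b}" for a b :: real by auto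
      then show ?thesis unfolding Int_stable_def by auto
    qed
    show "sets ?M1 = sigma_sets UNIV (range lessThan)" "sets ?M2 = sigma_sets UNIV (range lessThan)"
      by (simp_all add: borel_Iio)
    show "range (\<lambda>n::nat. {..<real n}) \<subseteq> range lessThan" by auto
    show "(\<Union>n::nat. {..<real n}) = UNIV" using reals_Archimedean2 by auto
    show eq: "emeasure ?M1 X = emeasure ?M2 X" if X: "X \<in> range lessThan" for X
    proof -
      from X obtain t where t: "X = {..<t}" by auto
      show ?thesis
      proof (cases "t > 0")
        case True
        have "(\<integral>\<^sup>+h. 1 * indicator (ball 0 t :: 'a set) h \<partial>lborel) = ennreal (t ^ DIM('a)) * (\<integral>\<^sup>+h. 1 * indicator (ball 0 1 :: 'a set) h \<partial>lborel)"
          by (rule nn_integral_ball_scaling) (use True in auto)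
        then show ?thesis using nn_integral_ball_scaling[OF G hom True]
          by (simp only: emeasure_scale_measure t e1 e2) (simp add: ac_simps)
      next
        case False
        then have "ball 0 t = ({} :: 'a set)" by simp
        then show ?thesis by (simp only: emeasure_scale_measure t e1 e2) simp
      qed
    qed
    show "emeasure ?M1 {..<real i} \<noteq> \<infinity>" for i :: nat
    proof -
      have "emeasure ?M1 {..<real i} = emeasure ?M2 {..<real i}" by (rule eq) simp
      also have "\<dots> = ?g * emeasure lborel (ball 0 (real i) :: 'a set)" by (simp add: emeasure_distr vim)
      also have "\<dots> < \<infinity>" using fin emeasure_lborel_ball_finite[of "0::'a" "real i"] by (simp add: ennreal_mult_less_top)
      finally show ?thesis by simp
    qed
  qed simp
  then have "nn_integral ?M1 \<rho> = nn_integral ?M2 \<rho>" by simp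
  then show ?thesis by (simp add: nn_integral_scale_measure nn_integral_distr nn_integral_density)
qed

text \<open>The surface measure is an image of the volume on the unit ball, so \<open>K\<close> is the mean over the ball of the
  function \<open>(|h\<^sub>k| / |h|)\<^sup>p\<close>; the factor \<open>d\<close> cancels.\<close>

lemma K_const_emeasure_ball:
  fixes k :: "'d::finite"
  assumes p: "0 < p"
  shows "0 \<le> K_const p k"
    and "(\<integral>\<^sup>+h. ennreal ((\<bar>h $ k\<bar> / norm h) powr p) * indicator (ball 0 1) h \<partial>lborel) 
      = ennreal (K_const p k) * emeasure lborel (ball 0 1 :: (real ^ 'd) set)"
proof -
  let ?S = "sphere_measure :: (real ^ 'd) measure"
  let ?D = "real DIM(real ^ 'd)"
  have Dpos: "?D > 0" by simp
  let ?R = "restrict_space lborel (ball 0 1 - {0}) :: (real ^ 'd) measure"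
  have [measurable]: "ball 0 1 - {0} \<in> sets (borel :: (real ^ 'd) measure)" by simp
  have m: "(\<lambda>x. x /\<^sub>R norm x) \<in> measurable ?R (restrict_space borel (sphere 0 1))"
    by (rule measurable_restrict_space3) (auto intro!: measurable_restrict_space1)
  have [measurable]: "ball 0 1 \<in> sets (borel :: (real ^ 'd) measure)" by simp
  define I where "I = (\<integral>\<^sup>+h. ennreal ((\<bar>h $ k\<bar> / norm h) powr p) * indicator (ball 0 1) h \<partial>(lborel :: (real ^ 'd) measure))"
  define b where "b = measure lborel (ball 0 1 :: (real ^ 'd) set)"
  have b: "emeasure lborel (ball 0 1 :: (real ^ 'd) set) = ennreal b" "b > 0"
    using emeasure_lborel_ball_finite[of "0 :: real ^ 'd" 1] content_ball_pos[of 1 "0 :: real ^ 'd"]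
    by (auto simp: b_def emeasure_eq_ennreal_measure less_top)
  have e: "emeasure ?S (sphere 0 1) = ennreal ?D * ennreal b"
  proof -
    have sp: "sphere 0 1 \<in> sets (restrict_space borel (sphere 0 1 :: (real ^ 'd) set))" by (simp add: sets_restrict_space_iff)
    have "(\<lambda>x. x /\<^sub>R norm x) -` sphere 0 1 \<inter> space ?R = (ball 0 1 - {0} :: (real ^ 'd) set)" 
      by (auto simp: space_restrict_space)
    then have "emeasure (distr ?R (restrict_space borel (sphere 0 1)) (\<lambda>x. x /\<^sub>R norm x)) (sphere 0 1) = emeasure ?R (ball 0 1 - {0})"
      by (simp add: emeasure_distr[OF m sp])
    also have "\<dots> = emeasure lborel (ball 0 1 - {0} :: (real ^ 'd) set)" by (subst emeasure_restrict_space) auto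
    also have "\<dots> = ennreal b" by (subst emeasure_Diff) (auto simp: b)
    finally show ?thesis by (simp add: sphere_measure_def ennreal_of_nat_eq_real_of_nat)
  qed
  have n: "(\<integral>\<^sup>+w. ennreal (\<bar>w $ k\<bar> powr p) \<partial>?S) = ennreal ?D * I"
  proof -
    have "(\<integral>\<^sup>+w. ennreal (\<bar>w $ k\<bar> powr p) \<partial>distr ?R (restrict_space borel (sphere 0 1)) (\<lambda>x. x /\<^sub>R norm x))
       = (\<integral>\<^sup>+x. ennreal (\<bar>(x /\<^sub>R norm x) $ k\<bar> powr p) \<partial>?R)"
      by (rule nn_integral_distr[OF m]) (auto intro!: measurable_restrict_space1)
    also have "\<dots> = (\<integral>\<^sup>+x. ennreal (\<bar>(x /\<^sub>R norm x) $ k\<bar> powr p) * indicator (ball 0 1 - {0}) x \<partial>lborel)"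
      by (subst nn_integral_restrict_space) auto
    also have "\<dots> = I" unfolding I_def
      by (intro nn_integral_cong) (auto simp: indicator_def abs_mult divide_inverse mult.commute)
    finally have d: "(\<integral>\<^sup>+w. ennreal (\<bar>w $ k\<bar> powr p) \<partial>distr ?R (restrict_space borel (sphere 0 1)) (\<lambda>x. x /\<^sub>R norm x)) = I" .
    have "(\<lambda>w. ennreal (\<bar>w $ k\<bar> powr p)) \<in> borel_measurable (distr ?R (restrict_space borel (sphere 0 1)) (\<lambda>x. x /\<^sub>R norm x))"
      by (simp, intro measurable_restrict_space1, measurable)
    then show ?thesis unfolding sphere_measure_def 
      by (subst nn_integral_scale_measure) (simp_all only: d ennreal_of_nat_eq_real_of_nat)
  qed
  have "I \<le> (\<integral>\<^sup>+h. indicator (ball 0 1) h \<partial>(lborel :: (real ^ 'd) measure))" unfolding I_def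
  proof (rule nn_integral_mono)
    fix h :: "real ^ 'd"
    have "(\<bar>h $ k\<bar> / norm h) powr p \<le> 1 powr p" using component_le_norm_cart[of h k] p 
      by (intro powr_mono2) (auto simp: divide_le_eq_1)
    then show "ennreal ((\<bar>h $ k\<bar> / norm h) powr p) * indicator (ball 0 1) h \<le> indicator (ball 0 1) h" 
      by (auto simp: indicator_def)
  qed
  also have "\<dots> < \<infinity>" using b by simp
  finally obtain i where i: "I = ennreal i" "i \<ge> 0" by (cases I) auto
  have "measure ?S (sphere 0 1) = ?D * b" using e b by (simp add: measure_def flip: ennreal_mult)
  moreover have "(LINT w|?S. \<bar>w $ k\<bar> powr p) = ?D * i"
  proof -
    have "(\<lambda>w. \<bar>w $ k\<bar> powr p) \<in> borel_measurable ?S"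
    proof (subst measurable_cong_sets[OF _ refl])
      show "sets ?S = sets (restrict_space borel (sphere 0 1))" by (simp add: sphere_measure_def)
    qed (intro measurable_restrict_space1, measurable)
    then show ?thesis using n i by (simp add: integral_eq_nn_integral flip: ennreal_mult)
  qed
  ultimately have K: "K_const p k = i / b" unfolding K_const_def using Dpos by (simp add: field_simps)
  show "0 \<le> K_const p k" using K i b by simp
  have "I = ennreal (K_const p k) * emeasure lborel (ball 0 1 :: (real ^ 'd) set)"
    unfolding K i b(1) using i b by (simp flip: ennreal_mult)
  then show "(\<integral>\<^sup>+h. ennreal ((\<bar>h $ k\<bar> / norm h) powr p) * indicator (ball 0 1) h \<partial>lborel) 
      = ennreal (K_const p k) * emeasure lborel (ball 0 1 :: (real ^ 'd) set)" by (simp add: I_def)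
qed

text \<open>Rotate \<open>a\<close> to the axis \<open>k\<close> and separate \<open>|h\<^sub>k| / |h|\<close> from the radial factor by polar coordinates.\<close>

lemma radial_moment:
  fixes k :: "'d::finite" and a :: "real ^ 'd" and w :: "real \<Rightarrow> real"
  assumes p: "1 < p" and [measurable]: "w \<in> borel_measurable borel" and w: "\<And>t. 0 \<le> w t"
  shows "(\<integral>\<^sup>+h. ennreal (\<bar>a \<bullet> h\<bar> powr p * w (norm h)) \<partial>lborel) 
     = ennreal (K_const p k * norm a powr p) * (\<integral>\<^sup>+h. ennreal (norm h powr p * w (norm h)) \<partial>(lborel :: (real ^ 'd) measure))"
proof -
  let ?e = "axis k 1 :: real ^ 'd"
  have [measurable]: "ball 0 1 \<in> sets (borel :: (real ^ 'd) measure)" by simp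
  have "norm (norm a *\<^sub>R ?e) = norm a" by simp
  then obtain T where T: "orthogonal_transformation T" "T (norm a *\<^sub>R ?e) = a" by (rule orthogonal_transformation_exists)
  have aT: "a \<bullet> T h = norm a * (h $ k)" for h
  proof -
    have "a \<bullet> T h = T (norm a *\<^sub>R ?e) \<bullet> T h" by (simp add: T(2))
    also have "\<dots> = (norm a *\<^sub>R ?e) \<bullet> h" using T(1) by (simp only: orthogonal_transformation_def)
    finally show ?thesis by (simp add: inner_axis' )
  qed
  have "(\<integral>\<^sup>+h. ennreal (\<bar>a \<bullet> h\<bar> powr p * w (norm h)) \<partial>lborel) = (\<integral>\<^sup>+h. ennreal (\<bar>a \<bullet> T h\<bar> powr p * w (norm (T h))) \<partial>lborel)"
    by (rule nn_integral_lborel_orthogonal[OF T(1), of "\<lambda>h. ennreal (\<bar>a \<bullet> h\<bar> powr p * w (norm h))", symmetric]) measurable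
  also have "\<dots> = (\<integral>\<^sup>+h. ennreal (norm a powr p) * (ennreal ((\<bar>h $ k\<bar> / norm h) powr p) * ennreal (norm h powr p * w (norm h))) \<partial>lborel)"
  proof (rule nn_integral_cong)
    fix h :: "real ^ 'd"
    have "\<bar>h $ k\<bar> powr p = (\<bar>h $ k\<bar> / norm h) powr p * norm h powr p" using p
      by (cases "h = 0") (simp_all add: powr_divide)
    then show "ennreal (\<bar>a \<bullet> T h\<bar> powr p * w (norm (T h))) = ennreal (norm a powr p) * (ennreal ((\<bar>h $ k\<bar> / norm h) powr p) * ennreal (norm h powr p * w (norm h)))"
      using w by (simp add: aT orthogonal_transformation_norm[OF T(1)] abs_mult powr_mult mult.assoc flip: ennreal_mult)
  qed
  also have "\<dots> = ennreal (norm a powr p) * (\<integral>\<^sup>+h. ennreal ((\<bar>h $ k\<bar> / norm h) powr p) * ennreal (norm h powr p * w (norm h)) \<partial>lborel)"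
    by (rule nn_integral_cmult) measurable
  also have "(\<integral>\<^sup>+h. ennreal ((\<bar>h $ k\<bar> / norm h) powr p) * ennreal (norm h powr p * w (norm h)) \<partial>lborel) 
     = ennreal (K_const p k) * (\<integral>\<^sup>+h. ennreal (norm h powr p * w (norm h)) \<partial>(lborel :: (real ^ 'd) measure))"
  proof -
    let ?b = "emeasure lborel (ball 0 1 :: (real ^ 'd) set)"
    have bfin: "?b < \<infinity>" by (rule emeasure_lborel_ball_finite)
    have b0: "?b \<noteq> 0" using content_ball_pos[of 1 "0 :: real ^ 'd"] by (auto simp: measure_def)
    have Kb: "(\<integral>\<^sup>+h. ennreal ((\<bar>h $ k\<bar> / norm h) powr p) * indicator (ball 0 1) h \<partial>lborel) = ennreal (K_const p k) * ?b"
      using p by (intro K_const_emeasure_ball) simp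
    have "?b * (\<integral>\<^sup>+h. ennreal ((\<bar>h $ k\<bar> / norm h) powr p) * ennreal (norm h powr p * w (norm h)) \<partial>lborel) 
      = (ennreal (K_const p k) * ?b) * (\<integral>\<^sup>+h. ennreal (norm h powr p * w (norm h)) \<partial>(lborel :: (real ^ 'd) measure))"
      unfolding Kb[symmetric]
      by (rule nn_integral_polar[of "\<lambda>h. ennreal ((\<bar>h $ k\<bar> / norm h) powr p)" "\<lambda>t. ennreal (t powr p * w t)"])
         (use Kb bfin in \<open>auto simp: abs_mult ennreal_mult_less_top\<close>)
    then show ?thesis using bfin b0 by (auto simp: mult.commute[of "ennreal (K_const p k)"] mult.assoc ennreal_mult_cancel_left)
  qed
  finally show ?thesis using K_const_emeasure_ball(1)[of p k] p by (simp add: ennreal_mult ac_simps)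
qed

text \<open>Split \<open>b\<close> into a multiple of \<open>a\<close>, where the integrand is \<open>|a \<bullet> h|\<^sup>p\<close>, and a vector \<open>d\<close> orthogonal to \<open>a\<close>. The
  reflection in the hyperplane orthogonal to \<open>d\<close> preserves the weight and \<open>a \<bullet> h\<close> and changes the sign of
  \<open>d \<bullet> h\<close>, so the second part vanishes.\<close>

lemma radial_duality_moment:
  fixes k :: "'d::finite" and a b :: "real ^ 'd" and w :: "real \<Rightarrow> real"
  assumes p: "1 < p" and [measurable]: "w \<in> borel_measurable borel" and w: "\<And>t. 0 \<le> w t"
    and fin: "integrable lborel (\<lambda>h :: real ^ 'd. norm h powr p * w (norm h))"
  shows "(\<integral>h. duality_map p (a \<bullet> h) * (b \<bullet> h) * w (norm h) \<partial>lborel) 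
     = K_const p k * (norm a powr (p - 2) * (a \<bullet> b)) * (\<integral>h. norm h powr p * w (norm h) \<partial>(lborel :: (real ^ 'd) measure))"
proof (cases "a = 0")
  case False
  define c where "c = (a \<bullet> b) / (a \<bullet> a)"
  define d where "d = b - c *\<^sub>R a"
  have ad: "a \<bullet> d = 0" using False by (simp add: d_def c_def inner_diff_right)
  have K0: "K_const p k \<ge> 0" using K_const_emeasure_ball(1)[of p k] p by simp
  have int: "integrable lborel (\<lambda>h. duality_map p (a \<bullet> h) * (d \<bullet> h) * w (norm h))" for d
  proof (rule Bochner_Integration.integrable_bound)
    show "integrable lborel (\<lambda>h :: real ^ 'd. (norm a powr (p - 1) * norm d) * (norm h powr p * w (norm h)))" by (intro integrable_mult_right fin)
    show "AE h in lborel. norm (duality_map p (a \<bullet> h) * (d \<bullet> h) * w (norm h)) \<le> norm ((norm a powr (p - 1) * norm d) * (norm h powr p * w (norm h)))"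
    proof (rule AE_I2)
      fix h
      have "\<bar>duality_map p (a \<bullet> h)\<bar> * \<bar>d \<bullet> h\<bar> \<le> (norm a * norm h) powr (p - 1) * (norm d * norm h)"
        unfolding abs_duality_map using p Cauchy_Schwarz_ineq2 by (intro mult_mono powr_mono2) auto
      also have "\<dots> = (norm a powr (p - 1) * norm d) * norm h powr p" by (cases "h = 0") (simp_all add: powr_mult powr_diff)
      finally have "\<bar>duality_map p (a \<bullet> h)\<bar> * \<bar>d \<bullet> h\<bar> * w (norm h) \<le> (norm a powr (p - 1) * norm d) * norm h powr p * w (norm h)"
        using w by (rule mult_right_mono)
      then show "norm (duality_map p (a \<bullet> h) * (d \<bullet> h) * w (norm h)) \<le> norm ((norm a powr (p - 1) * norm d) * (norm h powr p * w (norm h)))"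
        using w by (simp add: abs_mult mult.assoc)
    qed
  qed measurable
  have 1: "(\<integral>h. duality_map p (a \<bullet> h) * (a \<bullet> h) * w (norm h) \<partial>lborel) = K_const p k * norm a powr p * (\<integral>h. norm h powr p * w (norm h) \<partial>(lborel :: (real ^ 'd) measure))"
  proof -
    have "ennreal (\<integral>h. norm h powr p * w (norm h) \<partial>(lborel :: (real ^ 'd) measure)) = (\<integral>\<^sup>+h. ennreal (norm h powr p * w (norm h)) \<partial>(lborel :: (real ^ 'd) measure))"
      by (rule nn_integral_eq_integral[OF fin, symmetric]) (use w in auto)
    moreover have "ennreal (\<integral>h. \<bar>a \<bullet> h\<bar> powr p * w (norm h) \<partial>lborel) = (\<integral>\<^sup>+h. ennreal (\<bar>a \<bullet> h\<bar> powr p * w (norm h)) \<partial>lborel)"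
      using int[of a] w by (intro nn_integral_eq_integral[symmetric]) (auto simp: duality_map_mult_self)
    ultimately have "ennreal (\<integral>h. \<bar>a \<bullet> h\<bar> powr p * w (norm h) \<partial>lborel) = ennreal (K_const p k * norm a powr p * (\<integral>h. norm h powr p * w (norm h) \<partial>(lborel :: (real ^ 'd) measure)))"
      using radial_moment[OF p assms(2) w, of a k] K0 by (simp add: ennreal_mult' )
    then show ?thesis using K0 w by (subst (asm) ennreal_inj) (auto simp: duality_map_mult_self intro!: integral_nonneg_AE mult_nonneg_nonneg)
  qed
  have 2: "(\<integral>h. duality_map p (a \<bullet> h) * (d \<bullet> h) * w (norm h) \<partial>lborel) = 0"
  proof (cases "d = 0")
    case d: False
    \<comment> \<open>The reflection in the hyperplane orthogonal to \<open>d\<close>.\<close>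
    define R where "R h = h - (2 * (d \<bullet> h) / (d \<bullet> d)) *\<^sub>R d" for h
    have R: "orthogonal_transformation R"
      unfolding orthogonal_transformation_def
    proof
      show "linear R" unfolding R_def 
        by (intro linearI) (simp_all add: inner_add_right algebra_simps add_divide_distrib)
      show "\<forall>v w. R v \<bullet> R w = v \<bullet> w"
        using d by (auto simp: R_def inner_diff_left inner_diff_right field_simps inner_commute)
    qed
    have aR: "a \<bullet> R h = a \<bullet> h" for h by (simp add: R_def inner_diff_right ad)
    have dR: "d \<bullet> R h = - (d \<bullet> h)" for h using d by (simp add: R_def inner_diff_right)
    have "(\<integral>h. duality_map p (a \<bullet> R h) * (d \<bullet> R h) * w (norm (R h)) \<partial>lborel) = (\<integral>h. duality_map p (a \<bullet> h) * (d \<bullet> h) * w (norm h) \<partial>lborel)"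
      by (rule integral_lborel_orthogonal[OF R, of "\<lambda>h. duality_map p (a \<bullet> h) * (d \<bullet> h) * w (norm h)"]) measurable
    then show ?thesis by (simp add: aR dR orthogonal_transformation_norm[OF R])
  qed simp
  have b: "b = c *\<^sub>R a + d" by (simp add: d_def)
  have "(\<integral>h. duality_map p (a \<bullet> h) * (b \<bullet> h) * w (norm h) \<partial>lborel) 
    = (\<integral>h. c * (duality_map p (a \<bullet> h) * (a \<bullet> h) * w (norm h)) + duality_map p (a \<bullet> h) * (d \<bullet> h) * w (norm h) \<partial>lborel)"
    unfolding b by (intro Bochner_Integration.integral_cong) (simp_all add: inner_add_left algebra_simps)
  also have "\<dots> = c * (\<integral>h. duality_map p (a \<bullet> h) * (a \<bullet> h) * w (norm h) \<partial>lborel) + (\<integral>h. duality_map p (a \<bullet> h) * (d \<bullet> h) * w (norm h) \<partial>lborel)"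
    by (subst Bochner_Integration.integral_add) (auto intro: int)
  also have "\<dots> = K_const p k * (c * norm a powr p) * (\<integral>h. norm h powr p * w (norm h) \<partial>(lborel :: (real ^ 'd) measure))"
    by (simp add: 1 2)
  also have "c * norm a powr p = norm a powr (p - 2) * (a \<bullet> b)"
    using False by (simp add: c_def powr_diff dot_square_norm powr_numeral power2_eq_square)
  finally show ?thesis .
qed simp

section \<open>Concentrating kernels\<close>

lemma tendsto_0_ennreal_iff:
  fixes f :: "'a \<Rightarrow> ennreal"
  shows "(f \<longlongrightarrow> 0) F \<longleftrightarrow> (\<forall>t>0. \<forall>\<^sub>F x in F. f x \<le> ennreal t)"
proof safe
  fix t :: real assume "(f \<longlongrightarrow> 0) F" "0 < t"
  then have "\<forall>\<^sub>F x in F. f x < ennreal t" by (intro order_tendstoD) auto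
  then show "\<forall>\<^sub>F x in F. f x \<le> ennreal t" by eventually_elim simp
next
  assume *: "\<forall>t>0. \<forall>\<^sub>F x in F. f x \<le> ennreal t"
  show "(f \<longlongrightarrow> 0) F"
  proof (rule order_tendstoI)
    fix a :: ennreal assume "0 < a"
    then obtain t where t: "0 < t" "ennreal t < a" by (metis dense ennreal_cases ennreal_less_zero_iff less_top_ennreal not_less_iff_gr_or_eq order.strict_trans ennreal_0 ennreal_neg less_eq_real_def linorder_not_le)
    from *[rule_format, OF t(1)] show "\<forall>\<^sub>F x in F. f x < a" by eventually_elim (use t(2) in auto)
  qed simp
qed

lemma ennreal_abs_integral_le: "ennreal \<bar>integral\<^sup>L M f\<bar> \<le> (\<integral>\<^sup>+x. ennreal \<bar>f x\<bar> \<partial>M)"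
  for f :: "'a \<Rightarrow> real"
proof (cases "integrable M f")
  case True
  then show ?thesis using integral_norm_bound_ennreal[of M f] by simp
qed (simp add: not_integrable_integral_eq)

lemma integral_young_le:
  fixes f X Y :: "'z \<Rightarrow> real"
  assumes bd: "\<And>z. \<bar>f z\<bar> \<le> t * X z + C * Y z" and nn: "\<And>z. 0 \<le> X z" "\<And>z. 0 \<le> Y z" "0 \<le> t" "0 \<le> C" "0 \<le> x" "0 \<le> y"
    and [measurable]: "X \<in> borel_measurable M" "Y \<in> borel_measurable M"
    and X: "(\<integral>\<^sup>+z. ennreal (X z) \<partial>M) \<le> ennreal x" and Y: "(\<integral>\<^sup>+z. ennreal (Y z) \<partial>M) \<le> ennreal y"
  shows "\<bar>\<integral>z. f z \<partial>M\<bar> \<le> t * x + C * y"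
proof -
  have "ennreal \<bar>\<integral>z. f z \<partial>M\<bar> \<le> (\<integral>\<^sup>+z. ennreal t * ennreal (X z) + ennreal C * ennreal (Y z) \<partial>M)"
    using bd nn
    by (intro order_trans[OF ennreal_abs_integral_le] nn_integral_mono) (auto simp flip: ennreal_mult ennreal_plus intro!: ennreal_leI)
  also have "\<dots> = ennreal t * (\<integral>\<^sup>+z. ennreal (X z) \<partial>M) + ennreal C * (\<integral>\<^sup>+z. ennreal (Y z) \<partial>M)"
    by (simp add: nn_integral_add nn_integral_cmult)
  also have "\<dots> \<le> ennreal t * ennreal x + ennreal C * ennreal y"
    using X Y by (intro add_mono mult_left_mono) auto
  also have "\<dots> = ennreal (t * x + C * y)" using nn by (simp flip: ennreal_mult ennreal_plus)
  finally show ?thesis using nn by (subst (asm) ennreal_le_iff) auto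
qed

lemma mult_divide_Suc_le:
  fixes a c :: real assumes "0 \<le> a" "0 \<le> c" shows "a / (c + 1) * c \<le> a"
proof -
  have "a / (c + 1) * c = a * (c / (c + 1))" by simp
  also have "\<dots> \<le> a * 1" using assms by (intro mult_left_mono) auto
  finally show ?thesis by simp
qed

text \<open>The pattern of every limit below: a bounded quantity \<open>X\<close> enters with an arbitrarily small factor, and the
  other quantity \<open>Y\<close> tends to zero.\<close>

lemma tendsto_0_integral_youngI:
  fixes f X Y :: "'e \<Rightarrow> 'z \<Rightarrow> real"
  assumes bd: "\<And>t. 0 < t \<Longrightarrow> \<exists>C\<ge>0. \<forall>e z. \<bar>f e z\<bar> \<le> t * X e z + C * Y e z"
    and nn: "\<And>e z. 0 \<le> X e z" "\<And>e z. 0 \<le> Y e z"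
    and m: "\<And>e. X e \<in> borel_measurable (M e)" "\<And>e. Y e \<in> borel_measurable (M e)"
    and X: "\<forall>\<^sub>F e in F. (\<integral>\<^sup>+z. ennreal (X e z) \<partial>M e) \<le> ennreal C0"
    and Y: "((\<lambda>e. \<integral>\<^sup>+z. ennreal (Y e z) \<partial>M e) \<longlongrightarrow> 0) F"
  shows "((\<lambda>e. \<integral>z. f e z \<partial>M e) \<longlongrightarrow> 0) F"
proof (rule tendstoI)
  fix \<tau> :: real assume \<tau>: "0 < \<tau>"
  define t where "t = \<tau> / 4 / (\<bar>C0\<bar> + 1)"
  have t: "t > 0" using \<tau> by (simp add: t_def)
  obtain C where C: "C \<ge> 0" "\<And>e z. \<bar>f e z\<bar> \<le> t * X e z + C * Y e z" using bd[OF t] by blast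
  define s where "s = \<tau> / 4 / (C + 1)"
  have s: "s > 0" using \<tau> C by (simp add: s_def)
  have "\<forall>\<^sub>F e in F. (\<integral>\<^sup>+z. ennreal (Y e z) \<partial>M e) \<le> ennreal s" using Y s by (simp add: tendsto_0_ennreal_iff)
  with X show "\<forall>\<^sub>F e in F. dist (\<integral>z. f e z \<partial>M e) 0 < \<tau>"
  proof eventually_elim
    case (elim e)
    have "(\<integral>\<^sup>+z. ennreal (X e z) \<partial>M e) \<le> ennreal \<bar>C0\<bar>" using elim(1) by (auto elim!: order_trans intro!: ennreal_leI)
    then have "\<bar>\<integral>z. f e z \<partial>M e\<bar> \<le> t * \<bar>C0\<bar> + C * s"
      using t s C elim by (intro integral_young_le[where X = "X e" and Y = "Y e"] nn m) auto
    also have "\<dots> \<le> \<tau> / 4 + \<tau> / 4"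
      using \<tau> C mult_divide_Suc_le[of "\<tau> / 4" "\<bar>C0\<bar>"] mult_divide_Suc_le[of "\<tau> / 4" C]
      by (intro add_mono) (simp_all add: t_def s_def mult.commute[of C])
    finally show ?case using \<tau> by simp
  qed
qed

lemma abs_add_powr_le_ennreal: 
  fixes a b :: real assumes "0 \<le> p" 
  shows "ennreal (\<bar>a + b\<bar> powr p) \<le> ennreal (2 powr p) * (ennreal (\<bar>a\<bar> powr p) + ennreal (\<bar>b\<bar> powr p))"
  using abs_add_powr_le[OF assms, of a b] by (simp flip: ennreal_plus ennreal_mult add: ennreal_leI)

lemma abs_diff_powr_le_ennreal: 
  fixes a b :: real assumes "0 \<le> p" 
  shows "ennreal (\<bar>a - b\<bar> powr p) \<le> ennreal (2 powr p) * (ennreal (\<bar>a\<bar> powr p) + ennreal (\<bar>b\<bar> powr p))"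
  using abs_add_powr_le_ennreal[OF assms, of a "- b"] by simp

text \<open>For \<open>|h| < 1 / n\<close> a point of \<open>\<Omega>\<close> that is moved out of \<open>\<Omega>\<close> has distance less than \<open>1 / n\<close> from the complement.
  As \<open>\<Omega>\<close> is open, these layers decrease to the empty set, and \<open>f dx\<close> is a finite measure.\<close>

lemma boundary_layer_vanishes:
  fixes f :: "'a::euclidean_space \<Rightarrow> ennreal"
  assumes \<Omega>: "open \<Omega>" and [measurable]: "f \<in> borel_measurable borel" and fin: "(\<integral>\<^sup>+x. f x \<partial>lborel) < \<infinity>" and t: "0 < t"
  shows "\<forall>\<^sub>F h in nhds 0. (\<integral>\<^sup>+x. f x * indicator {x \<in> \<Omega>. x + h \<notin> \<Omega>} x \<partial>lborel) \<le> ennreal t"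
proof (cases "- \<Omega> = {}")
  case True
  then have "{x \<in> \<Omega>. x + h \<notin> \<Omega>} = {}" for h by auto
  then show ?thesis by simp
next
  case False
  have [measurable]: "\<Omega> \<in> sets borel" using \<Omega> by (rule borel_open)
  have cl: "closed (- \<Omega>)" using \<Omega> by (rule closed_Compl)
  define A where "A n = {x \<in> \<Omega>. infdist x (- \<Omega>) < 1 / real (Suc n)}" for n
  have [measurable]: "(\<lambda>x. infdist x (- \<Omega>)) \<in> borel_measurable borel" by (intro borel_measurable_continuous_onI continuous_intros)
  have Am[measurable]: "A n \<in> sets borel" for n unfolding A_def by measurable
  have "(\<lambda>n. emeasure (density lborel f) (A n)) \<longlonglongrightarrow> emeasure (density lborel f) (\<Inter>n. A n)"
  proof (rule Lim_emeasure_decseq)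
    show "emeasure (density lborel f) (A i) \<noteq> \<infinity>" for i
    proof -
      have "emeasure (density lborel f) (A i) \<le> (\<integral>\<^sup>+x. f x \<partial>lborel)"
        by (subst emeasure_density) (auto intro!: nn_integral_mono simp: indicator_def)
      then show ?thesis using fin by auto
    qed
    show "decseq A" unfolding A_def decseq_def
    proof (intro allI impI subsetI, clarify)
      fix m n :: nat and x assume "m \<le> n" "x \<in> \<Omega>" "infdist x (- \<Omega>) < 1 / real (Suc n)"
      moreover have "1 / real (Suc n) \<le> 1 / real (Suc m)" using \<open>m \<le> n\<close> by (simp add: frac_le)
      ultimately show "infdist x (- \<Omega>) < 1 / real (Suc m)" by linarith
    qed
  qed auto
  moreover have "(\<Inter>n. A n) = {}"
  proof -
    have "x \<notin> (\<Inter>n. A n)" if x: "x \<in> \<Omega>" for x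
    proof -
      have "infdist x (- \<Omega>) > 0" using x in_closed_iff_infdist_zero[OF cl False, of x] infdist_nonneg[of x "- \<Omega>"] by auto
      then obtain n where "1 / real (Suc n) < infdist x (- \<Omega>)" using nat_approx_posE by blast
      then show ?thesis by (auto simp: A_def not_less intro!: exI[of _ n])
    qed
    then show ?thesis by (auto simp: A_def)
  qed
  ultimately have "(\<lambda>n. emeasure (density lborel f) (A n)) \<longlonglongrightarrow> 0" by (simp only: emeasure_empty)
  then have "\<forall>\<^sub>F n in sequentially. emeasure (density lborel f) (A n) < ennreal t" using t by (intro order_tendstoD) auto
  then obtain n where n: "emeasure (density lborel f) (A n) < ennreal t" by (auto simp: eventually_sequentially)
  have "(\<integral>\<^sup>+x. f x * indicator {x \<in> \<Omega>. x + h \<notin> \<Omega>} x \<partial>lborel) \<le> ennreal t" if h: "norm h < 1 / real (Suc n)" for h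
  proof -
    have sub: "{x \<in> \<Omega>. x + h \<notin> \<Omega>} \<subseteq> A n"
    proof clarify
      fix x assume x: "x \<in> \<Omega>" "x + h \<notin> \<Omega>"
      then have "infdist x (- \<Omega>) \<le> dist x (x + h)" by (intro infdist_le) auto
      then show "x \<in> A n" using x(1) h by (simp add: A_def dist_norm)
    qed
    have "(\<integral>\<^sup>+x. f x * indicator {x \<in> \<Omega>. x + h \<notin> \<Omega>} x \<partial>lborel) \<le> (\<integral>\<^sup>+x. f x * indicator (A n) x \<partial>lborel)"
      using sub by (intro nn_integral_mono mult_left_mono) (auto simp: indicator_def)
    also have "\<dots> = emeasure (density lborel f) (A n)" by (subst emeasure_density) auto
    finally show ?thesis using n by auto
  qed
  then show ?thesis unfolding eventually_nhds_0_norm by (intro exI[of _ "1 / real (Suc n)"]) auto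
qed

text \<open>The measures \<open>P e\<close> play the role of \<open>\<nu>\<^sub>\<epsilon>(h) dh\<close>. Of radial symmetry only its consequence for the limit is
  kept: the angular average \<open>ang\<close>, with a constant \<open>\<kappa>\<close> that does not depend on \<open>e\<close>. The axioms are required for
  every real \<open>e\<close> so that the bounds that are uniform in \<open>e\<close> carry no side condition.\<close>

locale concentrating_kernels =
  fixes p :: real and P :: "real \<Rightarrow> 'a::euclidean_space measure" and \<kappa> :: real
  assumes p: "1 < p"
    and sets_P [measurable_cong]: "\<And>e. sets (P e) = sets borel"
    and sf: "\<And>e. sigma_finite_measure (P e)"
    and mass: "\<And>e. (\<integral>\<^sup>+h. ennreal (min 1 (norm h powr p)) \<partial>P e) = 1"
    and conc: "\<And>d. 0 < d \<Longrightarrow> ((\<lambda>e. emeasure (P e) {h. d < norm h}) \<longlongrightarrow> 0) (at_right 0)"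
    and ang: "\<And>a b e. (\<integral>h. duality_map p (a \<bullet> h) * (b \<bullet> h) * indicator (cball 0 1) h \<partial>P e) 
        = \<kappa> * (norm a powr (p - 2) * (a \<bullet> b)) * (\<integral>h. norm h powr p * indicator (cball 0 1) h \<partial>P e)"
begin

abbreviation Q :: "real \<Rightarrow> ('a \<times> 'a) measure" where
  "Q e \<equiv> lborel \<Otimes>\<^sub>M P e"

abbreviation energy :: "real \<Rightarrow> ('a \<times> 'a) set \<Rightarrow> ('a \<times> 'a \<Rightarrow> real) \<Rightarrow> ennreal" where
  "energy e S a \<equiv> \<integral>\<^sup>+z. indicator S z * ennreal (\<bar>a z\<bar> powr p) \<partial>Q e"

abbreviation near_moment :: "real \<Rightarrow> ennreal" where
  "near_moment e \<equiv> \<integral>\<^sup>+h. ennreal (norm h powr p * indicator (cball 0 1) h) \<partial>P e"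

abbreviation mass_on :: "'a set \<Rightarrow> ('a \<Rightarrow> real) \<Rightarrow> ennreal" where
  "mass_on K w \<equiv> \<integral>\<^sup>+x. indicator K x * ennreal \<bar>w x\<bar> \<partial>lborel"

definition increment :: "('a \<Rightarrow> real) \<Rightarrow> 'a \<times> 'a \<Rightarrow> real" where
  "increment u z = u (fst z) - u (fst z - snd z)"

text \<open>The linear part of the increment, cut off at \<open>|h| = 1\<close> so that it is integrable against the kernels, of
  which only the part near the origin has finite \<open>p\<close>-th moment.\<close>

definition tangent :: "('a \<Rightarrow> 'a) \<Rightarrow> 'a \<times> 'a \<Rightarrow> real" where
  "tangent g z = indicator (cball 0 1) (snd z) * (g (fst z) \<bullet> snd z)"

lemma space_P [simp]: "space (P e) = UNIV"
  using sets_eq_imp_space_eq[OF sets_P] by simp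

lemma pair_sigma_finite_Q: "pair_sigma_finite lborel (P e)"
  by (intro pair_sigma_finite.intro sigma_finite_lborel sf)

lemma measurable_increment [measurable]: 
  assumes [measurable]: "u \<in> borel_measurable borel" 
  shows "increment u \<in> borel_measurable (borel \<Otimes>\<^sub>M borel)"
  unfolding increment_def by measurable

lemma measurable_tangent [measurable]: 
  assumes [measurable]: "g \<in> borel_measurable borel"
  shows "tangent g \<in> borel_measurable (borel \<Otimes>\<^sub>M borel)"
  unfolding tangent_def by measurable

lemma min_1_powr_norm:
  fixes h :: 'a
  shows "norm h \<le> 1 \<Longrightarrow> min 1 (norm h powr p) = norm h powr p" "\<not> norm h \<le> 1 \<Longrightarrow> min 1 (norm h powr p) = 1"
  using p powr_mono2[of p "norm h" 1] powr_mono2[of p 1 "norm h"] by auto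

lemma nn_integral_Q:
  assumes "f \<in> borel_measurable (borel \<Otimes>\<^sub>M borel)"
  shows "(\<integral>\<^sup>+z. f z \<partial>Q e) = (\<integral>\<^sup>+h. \<integral>\<^sup>+x. f (x, h) \<partial>lborel \<partial>P e)"
    and "(\<integral>\<^sup>+z. f z \<partial>Q e) = (\<integral>\<^sup>+x. \<integral>\<^sup>+h. f (x, h) \<partial>P e \<partial>lborel)"
proof -
  interpret pair_sigma_finite lborel "P e" by (rule pair_sigma_finite_Q)
  have [measurable]: "f \<in> borel_measurable (Q e)" using assms by measurable
  show "(\<integral>\<^sup>+z. f z \<partial>Q e) = (\<integral>\<^sup>+h. \<integral>\<^sup>+x. f (x, h) \<partial>lborel \<partial>P e)" by (rule nn_integral_snd[symmetric]) measurable
  show "(\<integral>\<^sup>+z. f z \<partial>Q e) = (\<integral>\<^sup>+x. \<integral>\<^sup>+h. f (x, h) \<partial>P e \<partial>lborel)" by (rule M2.nn_integral_fst[symmetric]) measurable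
qed

lemma near_moment_le_1: "near_moment e \<le> 1"
proof -
  have "near_moment e \<le> (\<integral>\<^sup>+h. ennreal (min 1 (norm h powr p)) \<partial>P e)"
  proof (intro nn_integral_mono ennreal_leI)
    fix h :: 'a
    show "norm h powr p * indicator (cball 0 1) h \<le> min 1 (norm h powr p)"
      using min_1_powr_norm(1)[of h] by (cases "norm h \<le> 1") simp_all
  qed
  then show ?thesis by (simp add: mass)
qed

text \<open>On \<open>|h| > 1\<close> the weight \<open>min 1 |h|\<^sup>p\<close> is \<open>1\<close>, so the moment is \<open>1\<close> minus a mass that tends to \<open>0\<close>.\<close>

lemma near_moment_tendsto_1: "((\<lambda>e. \<integral>h. norm h powr p * indicator (cball 0 1) h \<partial>P e) \<longlongrightarrow> 1) (at_right 0)"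
proof -
  have *: "(\<integral>h. norm h powr p * indicator (cball 0 1) h \<partial>P e) = 1 - enn2real (emeasure (P e) {h. 1 < norm h})" for e
  proof -
    have m: "{h::'a. 1 < norm h} \<in> sets borel" by measurable
    have "1 = (\<integral>\<^sup>+h. ennreal (norm h powr p * indicator (cball 0 1) h) + indicator {h. 1 < norm h} h \<partial>P e)"
      unfolding mass[of e, symmetric] by (intro nn_integral_cong) (auto simp: indicator_def min_1_powr_norm)
    also have "\<dots> = near_moment e + emeasure (P e) {h. 1 < norm h}"
      using m by (subst nn_integral_add) (auto simp: sets_P)
    finally have 1: "1 = near_moment e + emeasure (P e) {h. 1 < norm h}" .
    have "(\<integral>h. norm h powr p * indicator (cball 0 1) h \<partial>P e) = enn2real (near_moment e)"
      by (rule integral_eq_nn_integral) auto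
    moreover obtain a where "near_moment e = ennreal a" "a \<ge> 0"
      using near_moment_le_1[of e] by (cases "near_moment e") (auto simp: top_unique)
    moreover obtain b where "emeasure (P e) {h. 1 < norm h} = ennreal b" "b \<ge> 0"
      using 1 by (cases "emeasure (P e) {h. 1 < norm h}") auto
    ultimately show ?thesis using 1 by (simp flip: ennreal_plus)
  qed
  have "((\<lambda>e. enn2real (emeasure (P e) {h. 1 < norm h})) \<longlongrightarrow> enn2real 0) (at_right 0)"
    using conc[of 1] by (intro tendsto_enn2real) auto
  from tendsto_diff[OF tendsto_const this, of 1] show ?thesis by (simp add: *)
qed

lemma integral_bound_mass:
  assumes "\<And>h. \<psi> h \<le> ennreal (C * min 1 (norm h powr p))" "0 \<le> C"
  shows "(\<integral>\<^sup>+h. \<psi> h \<partial>P e) \<le> ennreal C"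
proof -
  have "(\<integral>\<^sup>+h. \<psi> h \<partial>P e) \<le> (\<integral>\<^sup>+h. ennreal C * ennreal (min 1 (norm h powr p)) \<partial>P e)"
    using assms by (intro nn_integral_mono) (simp flip: ennreal_mult)
  also have "\<dots> = ennreal C" by (simp add: nn_integral_cmult mass)
  finally show ?thesis .
qed

text \<open>Near the origin \<open>\<psi>\<close> is a small multiple of the weight with integral \<open>1\<close>; away from the origin \<open>\<psi>\<close> is bounded
  and the kernels lose their mass.\<close>

lemma concentration_tendsto_0:
  assumes C: "\<And>h. \<psi> h \<le> ennreal (C * min 1 (norm h powr p))" "0 \<le> C"
    and small: "\<And>t. 0 < t \<Longrightarrow> \<forall>\<^sub>F h in nhds 0. \<psi> h \<le> ennreal (t * norm h powr p)"
  shows "((\<lambda>e. \<integral>\<^sup>+h. \<psi> h \<partial>P e) \<longlongrightarrow> 0) (at_right 0)"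
  unfolding tendsto_0_ennreal_iff
proof safe
  fix \<tau> :: real assume \<tau>: "0 < \<tau>"
  obtain d where d: "d > 0" "\<And>h. norm h < d \<Longrightarrow> \<psi> h \<le> ennreal (\<tau> / 2 * norm h powr p)"
    using small[of "\<tau> / 2"] \<tau> unfolding eventually_nhds_0_norm by auto
  define d' where "d' = min d 1 / 2"
  have d': "0 < d'" "d' < d" "d' < 1" using d(1) by (auto simp: d'_def)
  define s where "s = \<tau> / (2 * (C + 1))"
  have s: "s > 0" using \<tau> C by (simp add: s_def)
  have "\<forall>\<^sub>F e in at_right 0. emeasure (P e) {h. d' < norm h} \<le> ennreal s"
    using conc[OF d'(1)] s by (simp add: tendsto_0_ennreal_iff)
  then show "\<forall>\<^sub>F e in at_right 0. (\<integral>\<^sup>+h. \<psi> h \<partial>P e) \<le> ennreal \<tau>"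
  proof eventually_elim
    case (elim e)
    have [measurable]: "{h::'a. d' < norm h} \<in> sets borel" by measurable
    have "(\<integral>\<^sup>+h. \<psi> h \<partial>P e) \<le> (\<integral>\<^sup>+h. ennreal (\<tau> / 2) * ennreal (min 1 (norm h powr p)) + ennreal C * indicator {h. d' < norm h} h \<partial>P e)"
    proof (rule nn_integral_mono)
      fix h
      show "\<psi> h \<le> ennreal (\<tau> / 2) * ennreal (min 1 (norm h powr p)) + ennreal C * indicator {h. d' < norm h} h"
      proof (cases "norm h \<le> d'")
        case True
        then have "norm h powr p \<le> 1" using d' p powr_mono2[of p "norm h" 1] by auto
        then show ?thesis using d(2)[of h] True d' \<tau> by (simp add: min_def flip: ennreal_mult)
      next
        case False
        have "C * min 1 (norm h powr p) \<le> C * 1" using C by (intro mult_left_mono) auto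
        then have "\<psi> h \<le> ennreal C" using C(1)[of h] by (auto elim!: order_trans intro!: ennreal_leI)
        then show ?thesis using False by (simp add: add_increasing)
      qed
    qed
    also have "\<dots> = ennreal (\<tau> / 2) + ennreal C * emeasure (P e) {h. d' < norm h}"
      by (simp add: nn_integral_add nn_integral_cmult mass nn_integral_cmult_indicator sets_P)
    also have "\<dots> \<le> ennreal (\<tau> / 2) + ennreal C * ennreal s" using elim by (intro add_mono mult_left_mono) auto
    also have "\<dots> = ennreal (\<tau> / 2 + C * s)" using \<tau> C s by (simp flip: ennreal_mult ennreal_plus)
    also have "\<dots> \<le> ennreal \<tau>"
    proof (rule ennreal_leI)
      have "C * s = (\<tau> / 2) * (C / (C + 1))" by (simp add: s_def)
      also have "\<dots> \<le> (\<tau> / 2) * 1" using \<tau> C by (intro mult_left_mono) auto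
      finally show "\<tau> / 2 + C * s \<le> \<tau>" by simp
    qed
    finally show ?case .
  qed
qed

text \<open>For \<open>|h| \<le> 1\<close> these are the bounds in the definition of the gradient; for \<open>|h| > 1\<close> the linear part is
  cut off and the norm of \<open>u\<close> bounds the increment.\<close>

lemma strong_grad_remainder_bounds:
  assumes s: "strong_Lp_grad p u g"
  defines "\<psi> \<equiv> \<lambda>h. \<integral>\<^sup>+x. ennreal (\<bar>increment u (x, h) - tangent g (x, h)\<bar> powr p) \<partial>lborel"
  shows "\<exists>C\<ge>0. \<forall>h. \<psi> h \<le> ennreal (C * min 1 (norm h powr p))"
    and "\<And>t. 0 < t \<Longrightarrow> \<forall>\<^sub>F h in nhds 0. \<psi> h \<le> ennreal (t * norm h powr p)"
proof -
  note strong_Lp_grad_borel[OF s, measurable]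
  obtain C where C: "C \<ge> 0" "\<And>h. remainder_power p u g h \<le> ennreal (C * norm h powr p)"
    using s by (auto simp: strong_Lp_grad_def)
  obtain U where U: "(\<integral>\<^sup>+x. ennreal (\<bar>u x\<bar> powr p) \<partial>lborel) = ennreal U" "U \<ge> 0"
    using s by (cases "\<integral>\<^sup>+x. ennreal (\<bar>u x\<bar> powr p) \<partial>lborel") (auto simp: strong_Lp_grad_def)
  define D where "D = C + 2 powr p * (U + U)"
  have eq: "\<psi> h = remainder_power p u g h" if "norm h \<le> 1" for h
    using that by (simp add: \<psi>_def increment_def tangent_def)
  have "\<psi> h \<le> ennreal (D * min 1 (norm h powr p))" for h
  proof (cases "norm h \<le> 1")
    case True
    have "min 1 (norm h powr p) = norm h powr p" using True p powr_mono2[of p "norm h" 1] by auto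
    moreover have "C * norm h powr p \<le> D * norm h powr p" using U by (intro mult_right_mono) (auto simp: D_def)
    ultimately show ?thesis unfolding eq[OF True] using C(2)[of h] by (metis ennreal_leI order_trans)
  next
    case False
    have "\<psi> h \<le> (\<integral>\<^sup>+x. ennreal (2 powr p) * (ennreal (\<bar>u x\<bar> powr p) + ennreal (\<bar>u (x + - h)\<bar> powr p)) \<partial>lborel)"
      unfolding \<psi>_def increment_def tangent_def using False p abs_diff_powr_le_ennreal[of p] by (intro nn_integral_mono) auto
    also have "\<dots> = ennreal (2 powr p) * ((\<integral>\<^sup>+x. ennreal (\<bar>u x\<bar> powr p) \<partial>lborel) + (\<integral>\<^sup>+x. ennreal (\<bar>u (x + - h)\<bar> powr p) \<partial>lborel))"
      by (simp add: nn_integral_cmult nn_integral_add)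
    also have "(\<integral>\<^sup>+x. ennreal (\<bar>u (x + - h)\<bar> powr p) \<partial>lborel) = (\<integral>\<^sup>+x. ennreal (\<bar>u x\<bar> powr p) \<partial>lborel)"
      by (rule nn_integral_lborel_shift[of "\<lambda>x. ennreal (\<bar>u x\<bar> powr p)"]) measurable
    finally have "\<psi> h \<le> ennreal (2 powr p * (U + U))" using U by (simp flip: ennreal_plus ennreal_mult)
    also have "\<dots> \<le> ennreal (D * min 1 (norm h powr p))"
      using C(1) unfolding min_1_powr_norm(2)[OF False] by (intro ennreal_leI) (simp add: D_def)
    finally show ?thesis .
  qed
  then show "\<exists>C\<ge>0. \<forall>h. \<psi> h \<le> ennreal (C * min 1 (norm h powr p))" using C U by (intro exI[of _ D]) (auto simp: D_def)
  fix t :: real assume "0 < t"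
  then have "\<forall>\<^sub>F h in nhds 0. remainder_power p u g h \<le> ennreal (t * norm h powr p)"
    using s by (simp add: strong_Lp_grad_def)
  moreover have "\<forall>\<^sub>F h :: 'a in nhds 0. norm h \<le> 1" unfolding eventually_nhds_0_norm by (intro exI[of _ 1]) auto
  ultimately show "\<forall>\<^sub>F h in nhds 0. \<psi> h \<le> ennreal (t * norm h powr p)" by eventually_elim (simp add: eq)
qed

lemma increment_minus_tangent_tendsto:
  assumes s: "strong_Lp_grad p u g"
  shows "((\<lambda>e. \<integral>\<^sup>+z. ennreal (\<bar>increment u z - tangent g z\<bar> powr p) \<partial>Q e) \<longlongrightarrow> 0) (at_right 0)"
proof -
  note strong_Lp_grad_borel[OF s, measurable]
  obtain C where "C \<ge> 0" "\<And>h. (\<integral>\<^sup>+x. ennreal (\<bar>increment u (x, h) - tangent g (x, h)\<bar> powr p) \<partial>lborel) \<le> ennreal (C * min 1 (norm h powr p))"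
    using strong_grad_remainder_bounds(1)[OF s] by blast
  then have "((\<lambda>e. \<integral>\<^sup>+h. \<integral>\<^sup>+x. ennreal (\<bar>increment u (x, h) - tangent g (x, h)\<bar> powr p) \<partial>lborel \<partial>P e) \<longlongrightarrow> 0) (at_right 0)"
    by (intro concentration_tendsto_0[where C = C] strong_grad_remainder_bounds(2)[OF s]) auto
  then show ?thesis by (subst nn_integral_Q(1)) auto
qed

lemma abs_tangent_le: "\<bar>tangent g (x, h)\<bar> powr p \<le> norm (g x) powr p * (norm h powr p * indicator (cball 0 1) h)"
  using powr_norm_inner_le[of p "g x" h] p 
  by (cases "norm h \<le> 1") (simp_all add: tangent_def mult.commute[of "norm (g x) powr p"])

text \<open>Cauchy-Schwarz leaves \<open>|h|\<^sup>p\<close> for \<open>|h| \<le> 1\<close>, whose integral is at most \<open>1\<close>.\<close>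

lemma tangent_Lp_le:
  assumes [measurable]: "g \<in> borel_measurable borel"
  shows "(\<integral>\<^sup>+z. ennreal (\<bar>tangent g z\<bar> powr p) \<partial>Q e) \<le> Lp_power p g"
proof -
  have "(\<integral>\<^sup>+z. ennreal (\<bar>tangent g z\<bar> powr p) \<partial>Q e) = (\<integral>\<^sup>+x. \<integral>\<^sup>+h. ennreal (\<bar>tangent g (x, h)\<bar> powr p) \<partial>P e \<partial>lborel)"
    by (rule nn_integral_Q(2)) measurable
  also have "\<dots> \<le> Lp_power p g"
  proof (rule nn_integral_mono)
    fix x
    have "(\<integral>\<^sup>+h. ennreal (\<bar>tangent g (x, h)\<bar> powr p) \<partial>P e) \<le> (\<integral>\<^sup>+h. ennreal (norm (g x) powr p) * ennreal (norm h powr p * indicator (cball 0 1) h) \<partial>P e)"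
      using abs_tangent_le by (intro nn_integral_mono) (simp add: ennreal_leI flip: ennreal_mult)
    also have "\<dots> = ennreal (norm (g x) powr p) * near_moment e"
      by (rule nn_integral_cmult) measurable
    also have "\<dots> \<le> ennreal (norm (g x) powr p) * 1" by (intro mult_left_mono near_moment_le_1) simp
    finally show "(\<integral>\<^sup>+h. ennreal (\<bar>tangent g (x, h)\<bar> powr p) \<partial>P e) \<le> ennreal (norm (g x) powr p)" by simp
  qed
  finally show ?thesis .
qed

lemma increment_fibre_bound:
  assumes s: "strong_Lp_grad p u g"
  shows "\<exists>C\<ge>0. \<forall>h. (\<integral>\<^sup>+x. ennreal (\<bar>increment u (x, h)\<bar> powr p) \<partial>lborel) \<le> ennreal (C * min 1 (norm h powr p))"
proof -
  note strong_Lp_grad_borel[OF s, measurable]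
  obtain C where C: "C \<ge> 0" "\<And>h. (\<integral>\<^sup>+x. ennreal (\<bar>increment u (x, h) - tangent g (x, h)\<bar> powr p) \<partial>lborel) \<le> ennreal (C * min 1 (norm h powr p))"
    using strong_grad_remainder_bounds(1)[OF s] by blast
  obtain G where G: "Lp_power p g = ennreal G" "G \<ge> 0"
    using s by (cases "Lp_power p g") (auto simp: strong_Lp_grad_def)
  have "(\<integral>\<^sup>+x. ennreal (\<bar>increment u (x, h)\<bar> powr p) \<partial>lborel) \<le> ennreal ((2 powr p * (C + G)) * min 1 (norm h powr p))" for h
  proof -
    let ?m = "min 1 (norm h powr p)"
    have "(\<integral>\<^sup>+x. ennreal (\<bar>increment u (x, h)\<bar> powr p) \<partial>lborel) 
      \<le> (\<integral>\<^sup>+x. ennreal (2 powr p) * (ennreal (\<bar>increment u (x, h) - tangent g (x, h)\<bar> powr p) + ennreal (norm (g x) powr p) * ennreal ?m) \<partial>lborel)"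
    proof (rule nn_integral_mono)
      fix x
      have "norm (g x) powr p * (norm h powr p * indicator (cball 0 1) h) \<le> norm (g x) powr p * ?m"
        using p powr_mono2[of p "norm h" 1] by (intro mult_left_mono) (auto simp: indicator_def)
      then have "ennreal (\<bar>tangent g (x, h)\<bar> powr p) \<le> ennreal (norm (g x) powr p) * ennreal ?m"
        using abs_tangent_le[of g x h] by (simp flip: ennreal_mult add: ennreal_leI)
      then show "ennreal (\<bar>increment u (x, h)\<bar> powr p) \<le> ennreal (2 powr p) * (ennreal (\<bar>increment u (x, h) - tangent g (x, h)\<bar> powr p) + ennreal (norm (g x) powr p) * ennreal ?m)"
        using abs_add_powr_le_ennreal[of p "increment u (x, h) - tangent g (x, h)" "tangent g (x, h)"] p
        by (auto elim!: order_trans intro!: mult_left_mono add_left_mono)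
    qed
    also have "\<dots> = ennreal (2 powr p) * ((\<integral>\<^sup>+x. ennreal (\<bar>increment u (x, h) - tangent g (x, h)\<bar> powr p) \<partial>lborel) + ennreal G * ennreal ?m)"
      by (simp add: nn_integral_cmult nn_integral_add nn_integral_multc G)
    also have "\<dots> \<le> ennreal (2 powr p) * (ennreal (C * ?m) + ennreal G * ennreal ?m)"
      by (intro mult_left_mono add_right_mono C) simp
    also have "\<dots> = ennreal ((2 powr p * (C + G)) * ?m)"
      using C G by (simp flip: ennreal_mult ennreal_plus) (simp add: algebra_simps)
    finally show ?thesis .
  qed
  then show ?thesis using C G by (intro exI[of _ "2 powr p * (C + G)"]) auto
qed

lemma increment_Lp_bound:
  assumes s: "strong_Lp_grad p u g"
  shows "\<exists>C\<ge>0. \<forall>e. (\<integral>\<^sup>+z. ennreal (\<bar>increment u z\<bar> powr p) \<partial>Q e) \<le> ennreal C"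
proof -
  note strong_Lp_grad_borel[OF s, measurable]
  obtain C where C: "C \<ge> 0" "\<And>h. (\<integral>\<^sup>+x. ennreal (\<bar>increment u (x, h)\<bar> powr p) \<partial>lborel) \<le> ennreal (C * min 1 (norm h powr p))"
    using increment_fibre_bound[OF s] by blast
  have "(\<integral>\<^sup>+z. ennreal (\<bar>increment u z\<bar> powr p) \<partial>Q e) \<le> ennreal C" for e
    by (subst nn_integral_Q(1)) (auto intro: integral_bound_mass C)
  then show ?thesis using C(1) by blast
qed

lemma integrable_duality_map_times:
  assumes [measurable]: "a \<in> borel_measurable (borel \<Otimes>\<^sub>M borel)" "w \<in> borel_measurable (borel \<Otimes>\<^sub>M borel)" "S \<in> sets (borel \<Otimes>\<^sub>M borel)"
    and a: "energy e S a < \<infinity>"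
    and w: "energy e S w < \<infinity>"
  shows "integrable (Q e) (\<lambda>z. indicator S z * (duality_map p (a z) * w z))"
proof (rule integrableI_bounded)
  have "(\<integral>\<^sup>+z. ennreal (norm (indicator S z * (duality_map p (a z) * w z))) \<partial>Q e) 
    \<le> (\<integral>\<^sup>+z. indicator S z * ennreal (\<bar>a z\<bar> powr p) + indicator S z * ennreal (\<bar>w z\<bar> powr p) \<partial>Q e)"
  proof (rule nn_integral_mono)
    fix z
    have "\<bar>duality_map p (a z)\<bar> * \<bar>w z\<bar> \<le> \<bar>a z\<bar> powr p + \<bar>w z\<bar> powr p"
      using young_scaled[of p 1 "\<bar>a z\<bar>" "\<bar>w z\<bar>"] p by (simp add: abs_duality_map)
    then show "ennreal (norm (indicator S z * (duality_map p (a z) * w z))) \<le> indicator S z * ennreal (\<bar>a z\<bar> powr p) + indicator S z * ennreal (\<bar>w z\<bar> powr p)"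
      by (auto simp: indicator_def abs_mult ennreal_leI simp flip: ennreal_plus)
  qed
  also have "\<dots> = energy e S a + energy e S w"
    by (rule nn_integral_add) measurable
  also have "\<dots> < \<infinity>" using a w by simp
  finally show "(\<integral>\<^sup>+z. ennreal (norm (indicator S z * (duality_map p (a z) * w z))) \<partial>Q e) < \<infinity>" .
qed measurable

lemma ennreal_indicator_mult: "ennreal (indicator S z * r) = indicator S z * ennreal r"
  by (simp add: indicator_def)

lemma tendsto_duality_map_diff_times:
  assumes [measurable]: "\<And>e. a e \<in> borel_measurable (borel \<Otimes>\<^sub>M borel)" "\<And>e. b e \<in> borel_measurable (borel \<Otimes>\<^sub>M borel)"
      "\<And>e. w e \<in> borel_measurable (borel \<Otimes>\<^sub>M borel)" "S \<in> sets (borel \<Otimes>\<^sub>M borel)"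
    and a: "\<forall>\<^sub>F e in F. energy e S (a e) \<le> ennreal Ca"
    and b: "\<forall>\<^sub>F e in F. energy e S (b e) \<le> ennreal Cb"
    and w: "\<forall>\<^sub>F e in F. energy e S (w e) \<le> ennreal Cw"
    and ab: "((\<lambda>e. energy e S (\<lambda>z. a e z - b e z)) \<longlongrightarrow> 0) F"
  shows "((\<lambda>e. \<integral>z. indicator S z * ((duality_map p (a e z) - duality_map p (b e z)) * w e z) \<partial>Q e) \<longlongrightarrow> 0) F"
proof (rule tendsto_0_integral_youngI)
  let ?X = "\<lambda>e z. indicator S z * (\<bar>a e z\<bar> powr p + \<bar>b e z\<bar> powr p + \<bar>w e z\<bar> powr p)"
  let ?Y = "\<lambda>e z. indicator S z * \<bar>a e z - b e z\<bar> powr p"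
  fix t :: real assume "0 < t"
  from duality_map_diff_young[OF p this] obtain C where "C \<ge> 0" 
    "\<And>a b w. \<bar>duality_map p a - duality_map p b\<bar> * \<bar>w\<bar> \<le> t * (\<bar>a\<bar> powr p + \<bar>b\<bar> powr p + \<bar>w\<bar> powr p) + C * \<bar>a - b\<bar> powr p" by blast
  then show "\<exists>C\<ge>0. \<forall>e z. \<bar>indicator S z * ((duality_map p (a e z) - duality_map p (b e z)) * w e z)\<bar> \<le> t * ?X e z + C * ?Y e z"
    by (intro exI[of _ C]) (auto simp: indicator_def abs_mult)
next
  let ?X = "\<lambda>e z. indicator S z * (\<bar>a e z\<bar> powr p + \<bar>b e z\<bar> powr p + \<bar>w e z\<bar> powr p)"
  show "\<forall>\<^sub>F e in F. (\<integral>\<^sup>+z. ennreal (?X e z) \<partial>Q e) \<le> ennreal (\<bar>Ca\<bar> + \<bar>Cb\<bar> + \<bar>Cw\<bar>)"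
    using a b w
  proof eventually_elim
    case (elim e)
    have "(\<integral>\<^sup>+z. ennreal (?X e z) \<partial>Q e) = (\<integral>\<^sup>+z. indicator S z * ennreal (\<bar>a e z\<bar> powr p) + indicator S z * ennreal (\<bar>b e z\<bar> powr p) + indicator S z * ennreal (\<bar>w e z\<bar> powr p) \<partial>Q e)"
      by (intro nn_integral_cong) (simp add: indicator_def)
    also have "\<dots> = energy e S (a e) + energy e S (b e) + energy e S (w e)"
      by (simp add: nn_integral_add)
    also have "\<dots> \<le> ennreal \<bar>Ca\<bar> + ennreal \<bar>Cb\<bar> + ennreal \<bar>Cw\<bar>"
      using elim by (intro add_mono) (auto elim!: order_trans intro!: ennreal_leI)
    finally show ?case by simp
  qed
  show "((\<lambda>e. \<integral>\<^sup>+z. ennreal (indicator S z * \<bar>a e z - b e z\<bar> powr p) \<partial>Q e) \<longlongrightarrow> 0) F"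
    using ab by (simp add: ennreal_indicator_mult)
qed (auto simp: indicator_def)

lemma tendsto_duality_map_times_small_right:
  assumes [measurable]: "\<And>e. a e \<in> borel_measurable (borel \<Otimes>\<^sub>M borel)"
      "\<And>e. w e \<in> borel_measurable (borel \<Otimes>\<^sub>M borel)" "S \<in> sets (borel \<Otimes>\<^sub>M borel)"
    and a: "\<forall>\<^sub>F e in F. energy e S (a e) \<le> ennreal Ca"
    and w: "((\<lambda>e. energy e S (w e)) \<longlongrightarrow> 0) F"
  shows "((\<lambda>e. \<integral>z. indicator S z * (duality_map p (a e z) * w e z) \<partial>Q e) \<longlongrightarrow> 0) F"
proof (rule tendsto_0_integral_youngI)
  let ?X = "\<lambda>e z. indicator S z * \<bar>a e z\<bar> powr p" and ?Y = "\<lambda>e z. indicator S z * \<bar>w e z\<bar> powr p"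
  fix t :: real assume "0 < t"
  from duality_map_young_left[OF p this] obtain C where "C \<ge> 0" 
    "\<And>a w. \<bar>duality_map p a\<bar> * \<bar>w\<bar> \<le> t * \<bar>a\<bar> powr p + C * \<bar>w\<bar> powr p" by blast
  then show "\<exists>C\<ge>0. \<forall>e z. \<bar>indicator S z * (duality_map p (a e z) * w e z)\<bar> \<le> t * ?X e z + C * ?Y e z"
    by (intro exI[of _ C]) (auto simp: indicator_def abs_mult)
qed (use a w in \<open>auto simp: ennreal_indicator_mult\<close>)

lemma tendsto_duality_map_times_small_left:
  assumes [measurable]: "\<And>e. a e \<in> borel_measurable (borel \<Otimes>\<^sub>M borel)"
      "\<And>e. w e \<in> borel_measurable (borel \<Otimes>\<^sub>M borel)" "S \<in> sets (borel \<Otimes>\<^sub>M borel)"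
    and w: "\<forall>\<^sub>F e in F. energy e S (w e) \<le> ennreal Cw"
    and a: "((\<lambda>e. energy e S (a e)) \<longlongrightarrow> 0) F"
  shows "((\<lambda>e. \<integral>z. indicator S z * (duality_map p (a e z) * w e z) \<partial>Q e) \<longlongrightarrow> 0) F"
proof (rule tendsto_0_integral_youngI)
  let ?X = "\<lambda>e z. indicator S z * \<bar>w e z\<bar> powr p" and ?Y = "\<lambda>e z. indicator S z * \<bar>a e z\<bar> powr p"
  fix t :: real assume "0 < t"
  from duality_map_young_right[OF p this] obtain C where "C \<ge> 0" 
    "\<And>a w. \<bar>duality_map p a\<bar> * \<bar>w\<bar> \<le> t * \<bar>w\<bar> powr p + C * \<bar>a\<bar> powr p" by blast
  then show "\<exists>C\<ge>0. \<forall>e z. \<bar>indicator S z * (duality_map p (a e z) * w e z)\<bar> \<le> t * ?X e z + C * ?Y e z"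
    by (intro exI[of _ C]) (auto simp: indicator_def abs_mult)
qed (use a w in \<open>auto simp: ennreal_indicator_mult\<close>)

text \<open>A translation moves the difference to \<open>\<phi>\<close>: \<open>\<integral> \<phi> x (w x - w (x - h)) dx = \<integral> (\<phi> x - \<phi> (x + h)) w x dx\<close>. The Lipschitz
  constant of \<open>\<phi>\<close> then yields the factor \<open>|h|\<close> that compensates the singularity of the kernel.\<close>

lemma cutoff_difference_pairing_le:
  fixes w \<phi> :: "'a \<Rightarrow> real"
  assumes [measurable]: "w \<in> borel_measurable borel" "\<phi> \<in> borel_measurable borel" "K' \<in> sets borel"
    and w: "mass_on K' w \<le> ennreal J" "0 \<le> J"
    and \<phi>: "\<And>x. \<bar>\<phi> x\<bar> \<le> 1" "\<And>x. x \<notin> K' \<Longrightarrow> \<phi> x = 0" "\<And>x. x \<notin> K' \<Longrightarrow> \<phi> (x + h) = 0"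
    and L: "0 \<le> L" "\<And>x y. \<bar>\<phi> x - \<phi> y\<bar> \<le> L * norm (x - y)"
  shows "\<bar>\<integral>x. \<phi> x * (w x - w (x - h)) \<partial>lborel\<bar> \<le> L * norm h * J"
proof -
  have wi: "integrable lborel (\<lambda>x. indicator K' x * w x)"
  proof (rule integrableI_bounded)
    have "(\<integral>\<^sup>+x. ennreal (norm (indicator K' x * w x)) \<partial>lborel) = mass_on K' w"
      by (intro nn_integral_cong) (simp add: indicator_def)
    then show "(\<integral>\<^sup>+x. ennreal (norm (indicator K' x * w x)) \<partial>lborel) < \<infinity>" using w(1) by (auto intro: le_less_trans)
  qed measurable
  have ci: "integrable lborel (\<lambda>x. c x * w x)" 
    if [measurable]: "c \<in> borel_measurable borel" and c: "\<And>x. \<bar>c x\<bar> \<le> 1" "\<And>x. x \<notin> K' \<Longrightarrow> c x = 0" for c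
  proof (rule Bochner_Integration.integrable_bound[OF wi])
    show "AE x in lborel. norm (c x * w x) \<le> norm (indicator K' x * w x)"
    proof (rule AE_I2)
      fix x show "norm (c x * w x) \<le> norm (indicator K' x * w x)"
        using c[of x] by (cases "x \<in> K'") (auto simp: abs_mult intro: mult_left_le_one_le)
    qed
  qed measurable
  have i1: "integrable lborel (\<lambda>x. \<phi> x * w x)" by (rule ci) (use \<phi> in auto)
  have i2: "integrable lborel (\<lambda>x. \<phi> (x + h) * w x)" by (rule ci) (use \<phi> in auto)
  have i2': "integrable lborel (\<lambda>x. \<phi> x * w (x - h))" using integrable_lborel_shift[OF i2, of "- h"] by simp
  have "(\<integral>x. \<phi> x * (w x - w (x - h)) \<partial>lborel) = (\<integral>x. \<phi> x * w x \<partial>lborel) - (\<integral>x. \<phi> x * w (x - h) \<partial>lborel)"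
    unfolding right_diff_distrib by (rule Bochner_Integration.integral_diff[OF i1 i2'])
  also have "(\<integral>x. \<phi> x * w (x - h) \<partial>lborel) = (\<integral>x. \<phi> (x + h) * w x \<partial>lborel)"
    using integral_lborel_shift[of "\<lambda>x. \<phi> x * w (x - h)" h] by simp
  also have "(\<integral>x. \<phi> x * w x \<partial>lborel) - (\<integral>x. \<phi> (x + h) * w x \<partial>lborel) = (\<integral>x. \<phi> x * w x - \<phi> (x + h) * w x \<partial>lborel)"
    by (rule Bochner_Integration.integral_diff[OF i1 i2, symmetric])
  finally have "ennreal \<bar>\<integral>x. \<phi> x * (w x - w (x - h)) \<partial>lborel\<bar> \<le> (\<integral>\<^sup>+x. ennreal \<bar>\<phi> x * w x - \<phi> (x + h) * w x\<bar> \<partial>lborel)"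
    using ennreal_abs_integral_le by simp
  also have "\<dots> \<le> (\<integral>\<^sup>+x. ennreal (L * norm h) * (indicator K' x * ennreal \<bar>w x\<bar>) \<partial>lborel)"
  proof (rule nn_integral_mono)
    fix x
    have "\<bar>\<phi> x - \<phi> (x + h)\<bar> * \<bar>w x\<bar> \<le> (L * norm h) * \<bar>w x\<bar>" using L(2)[of x "x + h"] by (intro mult_right_mono) auto
    then have "\<bar>\<phi> x * w x - \<phi> (x + h) * w x\<bar> \<le> (L * norm h) * \<bar>w x\<bar>" by (simp add: abs_mult flip: left_diff_distrib)
    then show "ennreal \<bar>\<phi> x * w x - \<phi> (x + h) * w x\<bar> \<le> ennreal (L * norm h) * (indicator K' x * ennreal \<bar>w x\<bar>)"
      using \<phi>(2,3)[of x] L(1) by (cases "x \<in> K'") (auto simp: ennreal_leI simp flip: ennreal_mult)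
  qed
  also have "\<dots> = ennreal (L * norm h) * mass_on K' w" by (rule nn_integral_cmult) measurable
  also have "\<dots> \<le> ennreal (L * norm h) * ennreal J" using w by (intro mult_left_mono) auto
  also have "\<dots> = ennreal (L * norm h * J)" using L w by (simp add: ennreal_mult)
  finally show ?thesis using L w by (subst (asm) ennreal_le_iff) auto
qed

lemma abs_tangent_const_le: "\<bar>tangent (\<lambda>_. y) z\<bar> \<le> norm y * norm (snd z)" "\<bar>tangent (\<lambda>_. y) z\<bar> \<le> norm y"
proof -
  show 1: "\<bar>tangent (\<lambda>_. y) z\<bar> \<le> norm y * norm (snd z)"
    using Cauchy_Schwarz_ineq2[of y "snd z"] by (auto simp: tangent_def indicator_def)
  show "\<bar>tangent (\<lambda>_. y) z\<bar> \<le> norm y"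
  proof (cases "norm (snd z) \<le> 1")
    case True
    then have "norm y * norm (snd z) \<le> norm y * 1" by (intro mult_left_mono) auto
    then show ?thesis using 1 by simp
  qed (simp add: tangent_def)
qed

lemma integrable_localized_pairing:
  assumes [measurable]: "\<Omega> \<in> sets borel" "A \<in> sets borel" "w \<in> borel_measurable borel" "c \<in> borel_measurable borel"
    and A: "A \<subseteq> \<Omega>" "emeasure lborel A < \<infinity>" and c: "\<And>x. \<bar>c x\<bar> \<le> 1" "\<And>x. x \<notin> A \<Longrightarrow> c x = 0"
    and w: "energy e (\<Omega> \<times> UNIV) (increment w) < \<infinity>"
  shows "integrable (Q e) (\<lambda>z. c (fst z) * (duality_map p (tangent (\<lambda>_. y) z) * increment w z))"
proof (rule Bochner_Integration.integrable_bound)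
  let ?b = "\<lambda>z. indicator (\<Omega> \<times> UNIV) z * (duality_map p (tangent (\<lambda>x. indicator A x *\<^sub>R y) z) * increment w z)"
  show "integrable (Q e) ?b"
  proof (rule integrable_duality_map_times)
    have "energy e (\<Omega> \<times> UNIV) (tangent (\<lambda>x. indicator A x *\<^sub>R y)) 
       \<le> (\<integral>\<^sup>+z. ennreal (\<bar>tangent (\<lambda>x. indicator A x *\<^sub>R y) z\<bar> powr p) \<partial>Q e)"
      by (intro nn_integral_mono) (simp add: indicator_def)
    also have "\<dots> \<le> (\<integral>\<^sup>+x. ennreal (norm (indicator A x *\<^sub>R y) powr p) \<partial>lborel)" by (rule tangent_Lp_le) measurable
    also have "\<dots> = (\<integral>\<^sup>+x. ennreal (norm y powr p) * indicator A x \<partial>lborel)"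
      by (intro nn_integral_cong) (simp add: indicator_def)
    also have "\<dots> = ennreal (norm y powr p) * emeasure lborel A" by (rule nn_integral_cmult_indicator) measurable
    also have "\<dots> < \<infinity>" using A(2) by (simp add: ennreal_mult_less_top)
    finally show "energy e (\<Omega> \<times> UNIV) (tangent (\<lambda>x. indicator A x *\<^sub>R y)) < \<infinity>" .
  qed (use w in auto)
  show "AE z in Q e. norm (c (fst z) * (duality_map p (tangent (\<lambda>_. y) z) * increment w z)) \<le> norm (?b z)"
  proof (rule AE_I2)
    fix z :: "'a \<times> 'a"
    show "norm (c (fst z) * (duality_map p (tangent (\<lambda>_. y) z) * increment w z)) \<le> norm (?b z)"
    proof (cases "fst z \<in> A")
      case True
      then have "z \<in> \<Omega> \<times> UNIV" "tangent (\<lambda>x. indicator A x *\<^sub>R y) z = tangent (\<lambda>_. y) z" 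
        using A(1) by (auto simp: mem_Times_iff tangent_def)
      then show ?thesis using c(1)[of "fst z"] by (simp add: abs_mult mult_left_le_one_le)
    qed (simp add: c(2))
  qed
qed measurable

lemma weighted_tangent_power_le:
  fixes c :: "'a \<Rightarrow> real"
  assumes [measurable]: "c \<in> borel_measurable borel" and c: "\<And>x. 0 \<le> c x"
  shows "(\<integral>\<^sup>+z. ennreal (c (fst z) * \<bar>tangent (\<lambda>_. y) z\<bar> powr p) \<partial>Q e) \<le> ennreal (norm y powr p) * (\<integral>\<^sup>+x. ennreal (c x) \<partial>lborel)"
proof -
  have "(\<integral>\<^sup>+z. ennreal (c (fst z) * \<bar>tangent (\<lambda>_. y) z\<bar> powr p) \<partial>Q e) = (\<integral>\<^sup>+x. \<integral>\<^sup>+h. ennreal (c x * \<bar>tangent (\<lambda>_. y) (x, h)\<bar> powr p) \<partial>P e \<partial>lborel)"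
    by (subst nn_integral_Q(2)) auto
  also have "\<dots> \<le> (\<integral>\<^sup>+x. ennreal (norm y powr p) * ennreal (c x) \<partial>lborel)"
  proof (rule nn_integral_mono)
    fix x
    have "(\<integral>\<^sup>+h. ennreal (c x * \<bar>tangent (\<lambda>_. y) (x, h)\<bar> powr p) \<partial>P e) 
      \<le> (\<integral>\<^sup>+h. ennreal (norm y powr p * c x) * ennreal (norm h powr p * indicator (cball 0 1) h) \<partial>P e)"
    proof (rule nn_integral_mono)
      fix h
      have "c x * \<bar>tangent (\<lambda>_. y) (x, h)\<bar> powr p \<le> c x * (norm y powr p * (norm h powr p * indicator (cball 0 1) h))"
        using abs_tangent_le[of "\<lambda>_. y" x h] c by (intro mult_left_mono) auto
      then show "ennreal (c x * \<bar>tangent (\<lambda>_. y) (x, h)\<bar> powr p) \<le> ennreal (norm y powr p * c x) * ennreal (norm h powr p * indicator (cball 0 1) h)"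
        using c by (simp add: ennreal_leI mult_ac flip: ennreal_mult)
    qed
    also have "\<dots> = ennreal (norm y powr p * c x) * near_moment e"
      by (rule nn_integral_cmult) measurable
    also have "\<dots> \<le> ennreal (norm y powr p * c x) * 1" by (intro mult_left_mono near_moment_le_1) simp
    finally show "(\<integral>\<^sup>+h. ennreal (c x * \<bar>tangent (\<lambda>_. y) (x, h)\<bar> powr p) \<partial>P e) \<le> ennreal (norm y powr p) * ennreal (c x)"
      using c by (simp add: ennreal_mult)
  qed
  also have "\<dots> = ennreal (norm y powr p) * (\<integral>\<^sup>+x. ennreal (c x) \<partial>lborel)" by (rule nn_integral_cmult) measurable
  finally show ?thesis .
qed

lemma tangent_diff: "tangent g z - tangent s z = tangent (\<lambda>x. g x - s x) z"
  by (simp add: tangent_def inner_diff_left right_diff_distrib)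

lemma tangent_Lp_le_on:
  assumes [measurable]: "g \<in> borel_measurable borel" and "Lp_power p g \<le> c"
  shows "energy e S (tangent g) \<le> c"
proof -
  have "energy e S (tangent g) \<le> (\<integral>\<^sup>+z. ennreal (\<bar>tangent g z\<bar> powr p) \<partial>Q e)"
    by (intro nn_integral_mono) (simp add: indicator_def)
  with tangent_Lp_le[OF assms(1)] assms(2) show ?thesis by (meson order_trans)
qed

section \<open>Weak convergence of increments\<close>

text \<open>Increments of functions that tend to zero locally in \<open>L\<^sup>1(\<Omega>)\<close> with bounded energy converge weakly to
  zero. The test objects are \<open>\<phi> x |y \<bullet> h|\<^sup>p\<^sup>-\<^sup>2 (y \<bullet> h)\<close>, first with a Lipschitz cutoff \<open>\<phi>\<close>, then with an
  indicator, and finally with a vector field in place of \<open>y\<close>.\<close>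

context
  fixes \<Omega> :: "'a set" and w :: "real \<Rightarrow> 'a \<Rightarrow> real" and Cw :: real
  assumes \<Omega>: "open \<Omega>" and wm [measurable]: "\<And>e. w e \<in> borel_measurable borel"
    and bd: "\<forall>\<^sub>F e in at_right 0. energy e (\<Omega> \<times> UNIV) (increment (w e)) \<le> ennreal Cw"
    and loc: "\<And>K. compact K \<Longrightarrow> K \<subseteq> \<Omega> \<Longrightarrow> ((\<lambda>e. mass_on K (w e)) \<longlongrightarrow> 0) (at_right 0)"
begin

text \<open>For \<open>|h| \<le> d\<close> the translates of the support of \<open>\<phi>\<close> stay in a compact \<open>K' \<subseteq> \<Omega>\<close>, and moving the difference to \<open>\<phi>\<close>
  bounds the pairing by a multiple of \<open>\<integral>\<^sub>K\<^sub>' |w\<^sub>e|\<close>. For \<open>|h| > d\<close> the energy bound and the vanishing mass of the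
  kernels suffice.\<close>

lemma weak_limit_cutoff:
  assumes K: "compact K" "K \<subseteq> \<Omega>" and \<phi>: "\<And>x. x \<notin> K \<Longrightarrow> \<phi> x = 0" "\<And>x. 0 \<le> \<phi> x" "\<And>x. \<phi> x \<le> 1"
    and L: "0 \<le> L" "\<And>x y. \<bar>\<phi> x - \<phi> y\<bar> \<le> L * norm (x - y)"
  shows "((\<lambda>e. \<integral>z. \<phi> (fst z) * (duality_map p (tangent (\<lambda>_. y) z) * increment (w e) z) \<partial>Q e) \<longlongrightarrow> 0) (at_right 0)"
proof -
  have [measurable]: "\<Omega> \<in> sets borel" "K \<in> sets borel" using \<Omega> K by (auto intro: borel_compact)
  have [measurable]: "\<phi> \<in> borel_measurable borel" by (rule lipschitz_borel_measurable[OF L])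
  obtain d0 where d0: "d0 > 0" "(\<Union>x\<in>K. cball x d0) \<subseteq> \<Omega>"
    by (rule compact_subset_open_imp_cball_epsilon_subset[OF K(1) \<Omega> K(2)]) (rule that)
  define d where "d = min d0 1"
  have d: "0 < d" "d \<le> 1" "d \<le> d0" using d0 by (auto simp: d_def)
  define K' where "K' = {x + y |x y. x \<in> K \<and> y \<in> cball 0 d}"
  have K': "compact K'" unfolding K'_def by (intro compact_sums K(1) compact_cball)
  have K'sub: "K' \<subseteq> \<Omega>"
  proof
    fix z assume "z \<in> K'"
    then obtain x y where xy: "z = x + y" "x \<in> K" "norm y \<le> d" by (auto simp: K'_def)
    then have "z \<in> cball x d0" using d by (auto simp: dist_norm)
    then show "z \<in> \<Omega>" using d0(2) xy(2) by blast
  qed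
  have [measurable]: "K' \<in> sets borel" using K' by (rule borel_compact)
  have KK': "K \<subseteq> K'"
  proof
    fix x assume "x \<in> K"
    then show "x \<in> K'" unfolding K'_def using d by (intro CollectI exI[of _ x] exI[of _ 0]) auto
  qed
  have shift: "\<phi> (x + h) = 0" if "x \<notin> K'" "norm h \<le> d" for x h
  proof (rule \<phi>(1))
    show "x + h \<notin> K"
    proof
      assume "x + h \<in> K"
      then have "x \<in> K'" unfolding K'_def using that(2) by (intro CollectI exI[of _ "x + h"] exI[of _ "- h"]) auto
      then show False using that(1) by simp
    qed
  qed
  let ?T = "\<lambda>z. duality_map p (tangent (\<lambda>_. y) z)"
  let ?near = "\<lambda>e z. indicator (cball 0 d) (snd z) * (\<phi> (fst z) * (?T z * increment (w e) z))"
  let ?far = "\<lambda>e z. indicator (- cball 0 d) (snd z) * (\<phi> (fst z) * (?T z * increment (w e) z))"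
  have [measurable]: "- cball 0 d \<in> sets (borel :: 'a measure)" by simp
  obtain F where F: "(\<integral>\<^sup>+x. ennreal (\<phi> x) \<partial>lborel) = ennreal F" "F \<ge> 0"
  proof -
    have "(\<integral>\<^sup>+x. ennreal (\<phi> x) \<partial>lborel) \<le> (\<integral>\<^sup>+x. indicator K x \<partial>lborel)"
      using \<phi> by (intro nn_integral_mono) (auto simp: indicator_def)
    also have "\<dots> < \<infinity>" using emeasure_compact_finite[OF K(1)] by simp
    finally show ?thesis using that by (cases "\<integral>\<^sup>+x. ennreal (\<phi> x) \<partial>lborel") auto
  qed
  define Y where "Y z = indicator (- cball 0 d) (snd z) * \<phi> (fst z)" for z :: "'a \<times> 'a"
  have [measurable]: "Y \<in> borel_measurable (borel \<Otimes>\<^sub>M borel)" unfolding Y_def by measurable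
  have Y0: "((\<lambda>e. \<integral>\<^sup>+z. ennreal (Y z) \<partial>Q e) \<longlongrightarrow> 0) (at_right 0)"
  proof -
    define \<psi> where "\<psi> h = ennreal (F * indicator (- cball 0 d) h)" for h :: 'a
    have "(\<integral>\<^sup>+z. ennreal (Y z) \<partial>Q e) = (\<integral>\<^sup>+h. \<psi> h \<partial>P e)" for e
    proof (subst nn_integral_Q(1))
      have "(\<integral>\<^sup>+x. ennreal (Y (x, h)) \<partial>lborel) = \<psi> h" for h
        by (cases "h \<in> cball 0 d") (simp_all add: Y_def \<psi>_def F)
      then show "(\<integral>\<^sup>+h. \<integral>\<^sup>+x. ennreal (Y (x, h)) \<partial>lborel \<partial>P e) = (\<integral>\<^sup>+h. \<psi> h \<partial>P e)" by simp
    qed measurable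
    moreover have "((\<lambda>e. \<integral>\<^sup>+h. \<psi> h \<partial>P e) \<longlongrightarrow> 0) (at_right 0)"
    proof (rule concentration_tendsto_0)
      show "\<psi> h \<le> ennreal (F / d powr p * min 1 (norm h powr p))" for h
      proof (cases "norm h \<le> d")
        case False
        have dp: "d powr p \<le> 1" "d powr p \<le> norm h powr p" using d p False powr_mono2[of p d 1] powr_mono2[of p d "norm h"] by auto
        have "F * 1 \<le> F / d powr p * min 1 (norm h powr p)" 
        proof -
          have "F / d powr p * d powr p \<le> F / d powr p * min 1 (norm h powr p)"
            using dp F d by (intro mult_left_mono) auto
          then show ?thesis using d by simp
        qed
        then show ?thesis using False by (simp add: \<psi>_def ennreal_leI)
      qed (simp add: \<psi>_def)
      show "0 \<le> F / d powr p" using F by simp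
      show "\<forall>\<^sub>F h in nhds 0. \<psi> h \<le> ennreal (t * norm h powr p)" for t
        unfolding eventually_nhds_0_norm using d by (intro exI[of _ d]) (auto simp: \<psi>_def)
    qed
    ultimately show ?thesis by simp
  qed
  have far: "((\<lambda>e. \<integral>z. ?far e z \<partial>Q e) \<longlongrightarrow> 0) (at_right 0)"
  proof (rule tendsto_0_integral_youngI[where Y = "\<lambda>_. Y" and X = "\<lambda>e z. indicator (\<Omega> \<times> UNIV) z * \<bar>increment (w e) z\<bar> powr p"])
    fix t :: real assume t: "0 < t"
    from duality_map_young_right[OF p this] obtain C where C: "C \<ge> 0" 
      "\<And>a w. \<bar>duality_map p a\<bar> * \<bar>w\<bar> \<le> t * \<bar>w\<bar> powr p + C * \<bar>a\<bar> powr p" by blast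
    show "\<exists>C\<ge>0. \<forall>e z. \<bar>?far e z\<bar> \<le> t * (indicator (\<Omega> \<times> UNIV) z * \<bar>increment (w e) z\<bar> powr p) + C * Y z"
    proof (intro exI[of _ "C * norm y powr p"] conjI allI)
      fix e z
      show "\<bar>?far e z\<bar> \<le> t * (indicator (\<Omega> \<times> UNIV) z * \<bar>increment (w e) z\<bar> powr p) + (C * norm y powr p) * Y z"
      proof (cases "fst z \<in> K \<and> snd z \<notin> cball 0 d")
        case True
        then have z: "z \<in> \<Omega> \<times> UNIV" "Y z = \<phi> (fst z)" "?far e z = \<phi> (fst z) * (?T z * increment (w e) z)" using K by (auto simp: Y_def mem_Times_iff)
        have "\<bar>?T z\<bar> * \<bar>increment (w e) z\<bar> \<le> t * \<bar>increment (w e) z\<bar> powr p + C * norm y powr p"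
          using C(2)[of "tangent (\<lambda>_. y) z" "increment (w e) z"] C(1) abs_tangent_const_le(2)[of y z] p powr_mono2[of p "\<bar>tangent (\<lambda>_. y) z\<bar>" "norm y"]
          by (smt (verit, best) abs_ge_zero mult_left_mono)
        then have "\<phi> (fst z) * (\<bar>?T z\<bar> * \<bar>increment (w e) z\<bar>) \<le> \<phi> (fst z) * (t * \<bar>increment (w e) z\<bar> powr p + C * norm y powr p)"
          using \<phi>(2) by (intro mult_left_mono) auto
        also have "\<dots> \<le> 1 * (t * \<bar>increment (w e) z\<bar> powr p) + (C * norm y powr p) * \<phi> (fst z)"
          unfolding distrib_left using \<phi>(3) t by (intro add_mono mult_right_mono) (auto simp: mult_ac)
        finally show ?thesis unfolding z(2,3) using z(1) \<phi>(2)[of "fst z"] by (simp add: abs_mult)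
      next
        case False
        then have far0: "?far e z = 0" using \<phi>(1) by auto
        have "0 \<le> Y z" using \<phi>(2) by (simp add: Y_def)
        then show ?thesis unfolding far0 using t C(1) by simp
      qed
    qed (use C in simp)
  next
    show "0 \<le> Y z" for z using \<phi>(2) by (simp add: Y_def)
    show "\<forall>\<^sub>F e in at_right 0. (\<integral>\<^sup>+z. ennreal (indicator (\<Omega> \<times> UNIV) z * \<bar>increment (w e) z\<bar> powr p) \<partial>Q e) \<le> ennreal Cw"
      using bd by (simp add: ennreal_indicator_mult)
  qed (use Y0 in auto)
  have near_bound: "\<bar>\<integral>z. ?near e z \<partial>Q e\<bar> \<le> norm y powr (p - 1) * L * J"
    if J: "mass_on K' (w e) \<le> ennreal J" "0 \<le> J" for e J
  proof (cases "integrable (Q e) (?near e)")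
    case True
    interpret PQ: pair_sigma_finite lborel "P e" by (rule pair_sigma_finite_Q)
    have "(\<integral>z. ?near e z \<partial>Q e) = (\<integral>h. \<integral>x. ?near e (x, h) \<partial>lborel \<partial>P e)"
      using PQ.integral_snd[of "\<lambda>x h. ?near e (x, h)"] True by (simp add: case_prod_unfold)
    then have "ennreal \<bar>\<integral>z. ?near e z \<partial>Q e\<bar> \<le> (\<integral>\<^sup>+h. ennreal \<bar>\<integral>x. ?near e (x, h) \<partial>lborel\<bar> \<partial>P e)"
      using ennreal_abs_integral_le by simp
    also have "\<dots> \<le> (\<integral>\<^sup>+h. ennreal (norm y powr (p - 1) * L * J) * ennreal (norm h powr p * indicator (cball 0 1) h) \<partial>P e)"
    proof (rule nn_integral_mono)
      fix h :: 'a
      show "ennreal \<bar>\<integral>x. ?near e (x, h) \<partial>lborel\<bar> \<le> ennreal (norm y powr (p - 1) * L * J) * ennreal (norm h powr p * indicator (cball 0 1) h)"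
      proof (cases "norm h \<le> d")
        case True
        have "(\<integral>x. ?near e (x, h) \<partial>lborel) = (\<integral>x. ?T (0, h) * (\<phi> x * (w e x - w e (x - h))) \<partial>lborel)"
          using True by (intro Bochner_Integration.integral_cong) (simp_all add: increment_def tangent_def)
        also have "\<dots> = ?T (0, h) * (\<integral>x. \<phi> x * (w e x - w e (x - h)) \<partial>lborel)" by (rule integral_mult_right_zero)
        finally have "\<bar>\<integral>x. ?near e (x, h) \<partial>lborel\<bar> = \<bar>?T (0, h)\<bar> * \<bar>\<integral>x. \<phi> x * (w e x - w e (x - h)) \<partial>lborel\<bar>" by (simp add: abs_mult)
        also have "\<dots> \<le> (norm y * norm h) powr (p - 1) * (L * norm h * J)"
        proof (rule mult_mono)
          show "\<bar>?T (0, h)\<bar> \<le> (norm y * norm h) powr (p - 1)"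
            unfolding abs_duality_map using abs_tangent_const_le(1)[of y "(0, h)"] p by (intro powr_mono2) auto
          show "\<bar>\<integral>x. \<phi> x * (w e x - w e (x - h)) \<partial>lborel\<bar> \<le> L * norm h * J"
            using \<phi> KK' by (intro cutoff_difference_pairing_le[where K' = K'] J L shift True) auto
        qed auto
        also have "\<dots> = norm y powr (p - 1) * L * J * norm h powr p" 
          by (cases "h = 0") (simp_all add: powr_mult powr_diff)
        finally show ?thesis using True d J L by (simp add: ennreal_leI flip: ennreal_mult)
      next
        case False then show ?thesis by simp
      qed
    qed
    also have "\<dots> = ennreal (norm y powr (p - 1) * L * J) * near_moment e"
      by (rule nn_integral_cmult) measurable
    also have "\<dots> \<le> ennreal (norm y powr (p - 1) * L * J) * 1" by (intro mult_left_mono near_moment_le_1) simp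
    finally show ?thesis using J L by (subst (asm) mult_1_right, subst (asm) ennreal_le_iff) auto
  next
    case False then show ?thesis using J L by (simp add: not_integrable_integral_eq)
  qed
  have near: "((\<lambda>e. \<integral>z. ?near e z \<partial>Q e) \<longlongrightarrow> 0) (at_right 0)"
  proof (rule tendstoI)
    fix \<tau> :: real assume \<tau>: "0 < \<tau>"
    define c where "c = norm y powr (p - 1) * L"
    have c: "c \<ge> 0" using L by (simp add: c_def)
    define s where "s = \<tau> / (2 * (c + 1))"
    have s: "s > 0" using \<tau> c by (simp add: s_def)
    have "\<forall>\<^sub>F e in at_right 0. mass_on K' (w e) \<le> ennreal s"
      using loc[OF K' K'sub] s by (simp add: tendsto_0_ennreal_iff)
    then show "\<forall>\<^sub>F e in at_right 0. dist (\<integral>z. ?near e z \<partial>Q e) 0 < \<tau>"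
    proof eventually_elim
      case (elim e)
      have "\<bar>\<integral>z. ?near e z \<partial>Q e\<bar> \<le> c * s" using near_bound[OF elim] s by (simp add: c_def)
      also have "c * s = (\<tau> / 2) * (c / (c + 1))" by (simp add: s_def)
      also have "\<dots> \<le> (\<tau> / 2) * 1" using \<tau> c by (intro mult_left_mono) auto
      finally show ?case using \<tau> by simp
    qed
  qed
  have eq: "\<forall>\<^sub>F e in at_right 0. (\<integral>z. ?near e z \<partial>Q e) + (\<integral>z. ?far e z \<partial>Q e) = (\<integral>z. \<phi> (fst z) * (?T z * increment (w e) z) \<partial>Q e)"
    using bd
  proof eventually_elim
    case (elim e)
    let ?f = "\<lambda>z. \<phi> (fst z) * (?T z * increment (w e) z)"
    have fi: "integrable (Q e) ?f"
      using elim \<phi> K(2) emeasure_compact_finite[OF K(1)]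
      by (intro integrable_localized_pairing[where A = K and \<Omega> = \<Omega>]) (auto intro: le_less_trans simp: abs_le_iff order_trans[OF _ \<phi>(2)])
    have ni: "integrable (Q e) (\<lambda>z. indicator A (snd z) * ?f z)" if [measurable]: "A \<in> sets borel" for A
      by (rule Bochner_Integration.integrable_bound[OF fi]) (measurable, auto simp: indicator_def)
    have "(\<integral>z. ?near e z \<partial>Q e) + (\<integral>z. ?far e z \<partial>Q e) = (\<integral>z. ?near e z + ?far e z \<partial>Q e)"
      by (rule Bochner_Integration.integral_add[symmetric]) (intro ni, measurable)+
    also have "\<dots> = (\<integral>z. ?f z \<partial>Q e)"
      by (intro Bochner_Integration.integral_cong) (auto simp: indicator_def)
    finally show ?case .
  qed
  from tendsto_add[OF near far] have "((\<lambda>e. (\<integral>z. ?near e z \<partial>Q e) + (\<integral>z. ?far e z \<partial>Q e)) \<longlongrightarrow> 0) (at_right 0)" by simp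
  from this eq show ?thesis by (rule Lim_transform_eventually)
qed

text \<open>Replacing the indicator by a cutoff changes the pairing little, uniformly in \<open>e\<close>: the energy of \<open>w\<close> is
  bounded, and the tangent has norm at most \<open>|y|\<close> times the \<open>L\<^sup>1\<close> distance of indicator and cutoff.\<close>

lemma weak_limit_indicator:
  assumes A: "A \<subseteq> \<Omega>" "A \<in> sets borel" "emeasure lborel A < \<infinity>"
  shows "((\<lambda>e. \<integral>z. indicator A (fst z) * (duality_map p (tangent (\<lambda>_. y) z) * increment (w e) z) \<partial>Q e) \<longlongrightarrow> 0) (at_right 0)"
proof (rule tendstoI)
  fix \<tau> :: real assume \<tau>: "0 < \<tau>"
  note A(2)[measurable]
  have \<Omega>b[measurable]: "\<Omega> \<in> sets borel" using \<Omega> by (rule borel_open)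
  let ?f = "\<lambda>e z. duality_map p (tangent (\<lambda>_. y) z) * increment (w e) z"
  define t where "t = \<tau> / 4 / (\<bar>Cw\<bar> + 1)"
  have t: "t > 0" using \<tau> by (simp add: t_def)
  obtain C where C: "C \<ge> 0" "\<And>a w. \<bar>duality_map p a\<bar> * \<bar>w\<bar> \<le> t * \<bar>w\<bar> powr p + C * \<bar>a\<bar> powr p"
    using duality_map_young_right[OF p t] by blast
  define c where "c = C * norm y powr p"
  have c: "c \<ge> 0" using C by (simp add: c_def)
  define s where "s = \<tau> / 4 / (c + 1)"
  have s: "s > 0" using \<tau> c by (simp add: s_def)
  obtain \<phi> :: "'a \<Rightarrow> real" and K L where K: "compact K" "K \<subseteq> \<Omega>" "\<And>x. x \<notin> K \<Longrightarrow> \<phi> x = 0"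
    and p01: "\<And>x. 0 \<le> \<phi> x" "\<And>x. \<phi> x \<le> 1" and L: "0 \<le> L" "\<And>x y. \<bar>\<phi> x - \<phi> y\<bar> \<le> L * norm (x - y)"
    and ap: "(\<integral>\<^sup>+x. ennreal \<bar>indicator A x - \<phi> x\<bar> \<partial>lborel) \<le> ennreal s"
    by (rule lipschitz_cutoff[OF \<Omega> A s]) (rule that)
  have [measurable]: "\<phi> \<in> borel_measurable borel" by (rule lipschitz_borel_measurable[OF L])
  have Kb: "K \<in> sets borel" using K(1) by (rule borel_compact)
  have abs\<phi>: "\<bar>\<phi> x\<bar> \<le> 1" for x using p01[of x] by simp
  have "((\<lambda>e. \<integral>z. \<phi> (fst z) * ?f e z \<partial>Q e) \<longlongrightarrow> 0) (at_right 0)"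
    by (rule weak_limit_cutoff[OF K p01 L])
  then have "\<forall>\<^sub>F e in at_right 0. dist (\<integral>z. \<phi> (fst z) * ?f e z \<partial>Q e) 0 < \<tau> / 4" using \<tau> by (intro tendstoD) auto
  with bd show "\<forall>\<^sub>F e in at_right 0. dist (\<integral>z. indicator A (fst z) * ?f e z \<partial>Q e) 0 < \<tau>"
  proof eventually_elim
    case (elim e)
    have fin: "energy e (\<Omega> \<times> UNIV) (increment (w e)) < \<infinity>" using elim(1) by (auto intro: le_less_trans)
    have iA: "integrable (Q e) (\<lambda>z. indicator A (fst z) * ?f e z)"
      using A by (intro integrable_localized_pairing[OF \<Omega>b _ wm _ _ _ _ _ fin, where A = A]) (auto simp: indicator_def)
    have i\<phi>: "integrable (Q e) (\<lambda>z. \<phi> (fst z) * ?f e z)"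
      using K emeasure_compact_finite[OF K(1)] by (intro integrable_localized_pairing[OF \<Omega>b Kb wm _ _ _ abs\<phi> _ fin]) auto
    have "(\<integral>z. indicator A (fst z) * ?f e z \<partial>Q e) - (\<integral>z. \<phi> (fst z) * ?f e z \<partial>Q e) = (\<integral>z. indicator A (fst z) * ?f e z - \<phi> (fst z) * ?f e z \<partial>Q e)"
      by (rule Bochner_Integration.integral_diff[OF iA i\<phi>, symmetric])
    also have "\<bar>\<dots>\<bar> \<le> t * \<bar>Cw\<bar> + C * (norm y powr p * s)"
    proof (rule integral_young_le[where X = "\<lambda>z. indicator (\<Omega> \<times> UNIV) z * \<bar>increment (w e) z\<bar> powr p" 
          and Y = "\<lambda>z. \<bar>indicator A (fst z) - \<phi> (fst z)\<bar> * \<bar>tangent (\<lambda>_. y) z\<bar> powr p"])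
      fix z :: "'a \<times> 'a"
      let ?d = "\<bar>indicator A (fst z) - \<phi> (fst z)\<bar>"
      have d: "0 \<le> ?d" "?d \<le> 1" using p01[of "fst z"] by (auto simp: indicator_def)
      have "\<bar>indicator A (fst z) * ?f e z - \<phi> (fst z) * ?f e z\<bar> = ?d * (\<bar>duality_map p (tangent (\<lambda>_. y) z)\<bar> * \<bar>increment (w e) z\<bar>)"
        by (simp add: abs_mult flip: left_diff_distrib)
      also have "\<dots> \<le> ?d * (t * \<bar>increment (w e) z\<bar> powr p + C * \<bar>tangent (\<lambda>_. y) z\<bar> powr p)"
        using d(1) C(2) by (rule mult_left_mono[rotated])
      also have "\<dots> = t * (?d * \<bar>increment (w e) z\<bar> powr p) + C * (?d * \<bar>tangent (\<lambda>_. y) z\<bar> powr p)" by (simp add: algebra_simps)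
      also have "?d * \<bar>increment (w e) z\<bar> powr p \<le> indicator (\<Omega> \<times> UNIV) z * \<bar>increment (w e) z\<bar> powr p"
      proof (cases "fst z \<in> \<Omega>")
        case True
        then have "z \<in> \<Omega> \<times> UNIV" by (simp add: mem_Times_iff)
        then show ?thesis using d by (simp add: mult_left_le_one_le)
      next
        case False
        then have "?d = 0" using A(1) K(2,3) by (auto simp: indicator_def)
        then show ?thesis by simp
      qed
      finally show "\<bar>indicator A (fst z) * ?f e z - \<phi> (fst z) * ?f e z\<bar> \<le> t * (indicator (\<Omega> \<times> UNIV) z * \<bar>increment (w e) z\<bar> powr p) + C * (?d * \<bar>tangent (\<lambda>_. y) z\<bar> powr p)"
        using t by simp
    next
      show "(\<integral>\<^sup>+z. ennreal (indicator (\<Omega> \<times> UNIV) z * \<bar>increment (w e) z\<bar> powr p) \<partial>Q e) \<le> ennreal \<bar>Cw\<bar>"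
        using elim(1) by (auto simp: ennreal_indicator_mult elim!: order_trans intro!: ennreal_leI)
      have "(\<integral>\<^sup>+z. ennreal (\<bar>indicator A (fst z) - \<phi> (fst z)\<bar> * \<bar>tangent (\<lambda>_. y) z\<bar> powr p) \<partial>Q e) 
        \<le> ennreal (norm y powr p) * (\<integral>\<^sup>+x. ennreal \<bar>indicator A x - \<phi> x\<bar> \<partial>lborel)"
        by (rule weighted_tangent_power_le) auto
      also have "\<dots> \<le> ennreal (norm y powr p) * ennreal s" using ap by (rule mult_left_mono) simp
      finally show "(\<integral>\<^sup>+z. ennreal (\<bar>indicator A (fst z) - \<phi> (fst z)\<bar> * \<bar>tangent (\<lambda>_. y) z\<bar> powr p) \<partial>Q e) \<le> ennreal (norm y powr p * s)"
        using s by (simp add: ennreal_mult)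
    qed (use t C s in auto)
    also have "\<dots> \<le> \<tau> / 4 + \<tau> / 4"
      using \<tau> c mult_divide_Suc_le[of "\<tau> / 4" "\<bar>Cw\<bar>"] mult_divide_Suc_le[of "\<tau> / 4" c]
      by (intro add_mono) (simp_all add: t_def s_def c_def mult.commute mult.left_commute)
    finally show ?case using elim(2) \<tau> unfolding dist_real_def by linarith
  qed
qed

text \<open>The nonlinear expression in \<open>g\<close> cannot be decomposed linearly, but for a simple function \<open>s\<close> it is the sum
  over the values \<open>y\<close> of \<open>s\<close> of the expressions for the constant vectors \<open>y\<close> on the level sets. The error of
  replacing \<open>g\<close> by \<open>s\<close> is uniform in \<open>e\<close>.\<close>

lemma weak_limit_vector:
  fixes g :: "'a \<Rightarrow> 'a"
  assumes gm[measurable]: "g \<in> borel_measurable borel" and gfin: "Lp_power p g < \<infinity>"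
  shows "((\<lambda>e. \<integral>z. indicator (\<Omega> \<times> UNIV) z * (duality_map p (tangent g z) * increment (w e) z) \<partial>Q e) \<longlongrightarrow> 0) (at_right 0)"
proof (rule tendstoI)
  fix \<tau> :: real assume \<tau>: "0 < \<tau>"
  have \<Omega>b[measurable]: "\<Omega> \<in> sets borel" using \<Omega> by (rule borel_open)
  let ?S = "\<Omega> \<times> (UNIV :: 'a set)"
  obtain G where G: "Lp_power p g = ennreal G" "G \<ge> 0"
    using gfin by (cases "Lp_power p g") auto
  define G' where "G' = 2 powr p * (G + 1)"
  define M where "M = G + G' + \<bar>Cw\<bar>"
  have M: "M \<ge> 0" "G' \<ge> 0" using G by (auto simp: M_def G'_def)
  define t where "t = \<tau> / 4 / (M + 1)"
  have t: "t > 0" using \<tau> M by (simp add: t_def)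
  obtain C where C: "C \<ge> 0" "\<And>a b w. \<bar>duality_map p a - duality_map p b\<bar> * \<bar>w\<bar> \<le> t * (\<bar>a\<bar> powr p + \<bar>b\<bar> powr p + \<bar>w\<bar> powr p) + C * \<bar>a - b\<bar> powr p"
    using duality_map_diff_young[OF p t] by blast
  define r where "r = min 1 (\<tau> / 4 / (C + 1))"
  have r: "r > 0" "r \<le> 1" using \<tau> C by (auto simp: r_def)
  obtain s where s: "simple_function borel s" "Lp_power p (\<lambda>x. g x - s x) \<le> ennreal r"
    "\<And>y. y \<noteq> 0 \<Longrightarrow> emeasure lborel (s -` {y}) < \<infinity>"
    using simple_Lp_approx[OF gm _ gfin r(1)] p by auto
  have sm[measurable]: "s \<in> borel_measurable borel" using s(1) by (rule borel_measurable_simple_function)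
  have lev[measurable]: "s -` {y} \<in> sets borel" for y using measurable_sets[OF sm, of "{y}"] by simp
  define Y where "Y = range s - {0}"
  have Y: "finite Y" using s(1) by (simp add: Y_def simple_function_def)
  have sG': "Lp_power p s \<le> ennreal G'"
  proof -
    have "Lp_power p s \<le> (\<integral>\<^sup>+x. ennreal (2 powr p) * (ennreal (norm (g x) powr p) + ennreal (norm (g x - s x) powr p)) \<partial>lborel)"
    proof (rule nn_integral_mono)
      fix x
      show "ennreal (norm (s x) powr p) \<le> ennreal (2 powr p) * (ennreal (norm (g x) powr p) + ennreal (norm (g x - s x) powr p))"
        using norm_diff_powr_le[of p "g x" "g x - s x"] p by (simp add: ennreal_leI flip: ennreal_plus ennreal_mult)
    qed
    also have "\<dots> = ennreal (2 powr p) * (ennreal G + Lp_power p (\<lambda>x. g x - s x))"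
      by (simp add: nn_integral_cmult nn_integral_add G)
    also have "\<dots> \<le> ennreal (2 powr p) * (ennreal G + ennreal 1)"
      using s(2) r(2) by (intro mult_left_mono add_left_mono) (auto elim!: order_trans)
    also have "\<dots> = ennreal G'" using G by (simp add: G'_def ennreal_mult)
    finally show ?thesis .
  qed
  \<comment> \<open>The value \<open>0\<close> contributes nothing, and only the other level sets have finite measure.\<close>
  let ?A = "\<lambda>y. \<Omega> \<inter> s -` {y}"
  let ?f = "\<lambda>y e z. duality_map p (tangent (\<lambda>_. y) z) * increment (w e) z"
  have Afin: "emeasure lborel (?A y) < \<infinity>" if "y \<in> Y" for y
    using s(3)[of y] that emeasure_mono[of "?A y" "s -` {y}" lborel] by (auto simp: Y_def intro: le_less_trans)
  have "((\<lambda>e. \<Sum>y\<in>Y. \<integral>z. indicator (?A y) (fst z) * ?f y e z \<partial>Q e) \<longlongrightarrow> (\<Sum>y\<in>Y. 0)) (at_right 0)"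
    using Afin by (intro tendsto_sum weak_limit_indicator) auto
  then have "\<forall>\<^sub>F e in at_right 0. dist (\<Sum>y\<in>Y. \<integral>z. indicator (?A y) (fst z) * ?f y e z \<partial>Q e) 0 < \<tau> / 4" 
    using \<tau> by (intro tendstoD) auto
  with bd show "\<forall>\<^sub>F e in at_right 0. dist (\<integral>z. indicator ?S z * (duality_map p (tangent g z) * increment (w e) z) \<partial>Q e) 0 < \<tau>"
  proof eventually_elim
    case (elim e)
    have fin: "energy e ?S (increment (w e)) < \<infinity>" using elim(1) by (auto intro: le_less_trans)
    have int: "integrable (Q e) (\<lambda>z. indicator ?S z * (duality_map p (tangent a z) * increment (w e) z))" 
      if [measurable]: "a \<in> borel_measurable borel" and "Lp_power p a \<le> ennreal c" for a c
      using le_less_trans[OF tangent_Lp_le_on[OF that] ennreal_less_top] fin by (intro integrable_duality_map_times) auto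
    have ig: "integrable (Q e) (\<lambda>z. indicator ?S z * (duality_map p (tangent g z) * increment (w e) z))" using G by (intro int[of _ G]) auto
    have ints: "integrable (Q e) (\<lambda>z. indicator ?S z * (duality_map p (tangent s z) * increment (w e) z))" using sG' by (intro int[of _ G']) auto
    have sum: "(\<integral>z. indicator ?S z * (duality_map p (tangent s z) * increment (w e) z) \<partial>Q e) = (\<Sum>y\<in>Y. \<integral>z. indicator (?A y) (fst z) * ?f y e z \<partial>Q e)"
    proof -
      have "indicator ?S z * (duality_map p (tangent s z) * increment (w e) z) = (\<Sum>y\<in>Y. indicator (?A y) (fst z) * ?f y e z)" for z
      proof -
        have "(\<Sum>y\<in>Y. indicator (?A y) (fst z) * ?f y e z) = (\<Sum>y\<in>Y. if y = s (fst z) then indicator ?S z * ?f y e z else 0)"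
          by (intro sum.cong) (auto simp: indicator_def mem_Times_iff)
        also have "\<dots> = (if s (fst z) \<in> Y then indicator ?S z * ?f (s (fst z)) e z else 0)"
          using Y by (simp add: sum.delta')
        also have "\<dots> = indicator ?S z * (duality_map p (tangent s z) * increment (w e) z)"
          by (auto simp: Y_def tangent_def)
        finally show ?thesis by simp
      qed
      then have "(\<integral>z. indicator ?S z * (duality_map p (tangent s z) * increment (w e) z) \<partial>Q e) = (\<integral>z. (\<Sum>y\<in>Y. indicator (?A y) (fst z) * ?f y e z) \<partial>Q e)" by simp
      also have "\<dots> = (\<Sum>y\<in>Y. \<integral>z. indicator (?A y) (fst z) * ?f y e z \<partial>Q e)"
        by (intro Bochner_Integration.integral_sum) (rule integrable_localized_pairing[OF \<Omega>b _ wm _ _ Afin _ _ fin]; auto simp: indicator_def)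
      finally show ?thesis .
    qed
    have "(\<integral>z. indicator ?S z * (duality_map p (tangent g z) * increment (w e) z) \<partial>Q e) - (\<integral>z. indicator ?S z * (duality_map p (tangent s z) * increment (w e) z) \<partial>Q e) 
       = (\<integral>z. indicator ?S z * (duality_map p (tangent g z) * increment (w e) z) - indicator ?S z * (duality_map p (tangent s z) * increment (w e) z) \<partial>Q e)"
      by (rule Bochner_Integration.integral_diff[OF ig ints, symmetric])
    also have "\<bar>\<dots>\<bar> \<le> t * M + C * r"
    proof (rule integral_young_le[where X = "\<lambda>z. indicator ?S z * (\<bar>tangent g z\<bar> powr p + \<bar>tangent s z\<bar> powr p + \<bar>increment (w e) z\<bar> powr p)" 
          and Y = "\<lambda>z. indicator ?S z * \<bar>tangent g z - tangent s z\<bar> powr p"])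
      fix z :: "'a \<times> 'a"
      show "\<bar>indicator ?S z * (duality_map p (tangent g z) * increment (w e) z) - indicator ?S z * (duality_map p (tangent s z) * increment (w e) z)\<bar>
        \<le> t * (indicator ?S z * (\<bar>tangent g z\<bar> powr p + \<bar>tangent s z\<bar> powr p + \<bar>increment (w e) z\<bar> powr p)) + C * (indicator ?S z * \<bar>tangent g z - tangent s z\<bar> powr p)"
        using C(2)[of "tangent g z" "tangent s z" "increment (w e) z"] by (cases "z \<in> ?S") (simp_all add: abs_mult flip: left_diff_distrib)
    next
      have "(\<integral>\<^sup>+z. ennreal (indicator ?S z * (\<bar>tangent g z\<bar> powr p + \<bar>tangent s z\<bar> powr p + \<bar>increment (w e) z\<bar> powr p)) \<partial>Q e)
        = (\<integral>\<^sup>+z. indicator ?S z * ennreal (\<bar>tangent g z\<bar> powr p) + indicator ?S z * ennreal (\<bar>tangent s z\<bar> powr p) + indicator ?S z * ennreal (\<bar>increment (w e) z\<bar> powr p) \<partial>Q e)"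
        by (intro nn_integral_cong) (simp add: indicator_def)
      also have "\<dots> = energy e ?S (tangent g) + energy e ?S (tangent s) + energy e ?S (increment (w e))"
        by (simp add: nn_integral_add)
      also have "\<dots> \<le> ennreal G + ennreal G' + ennreal \<bar>Cw\<bar>"
        using elim(1) G sG' by (intro add_mono tangent_Lp_le_on) (auto elim!: order_trans intro!: ennreal_leI)
      also have "\<dots> = ennreal M" using G M by (simp add: M_def)
      finally show "(\<integral>\<^sup>+z. ennreal (indicator ?S z * (\<bar>tangent g z\<bar> powr p + \<bar>tangent s z\<bar> powr p + \<bar>increment (w e) z\<bar> powr p)) \<partial>Q e) \<le> ennreal M" .
      show "(\<integral>\<^sup>+z. ennreal (indicator ?S z * \<bar>tangent g z - tangent s z\<bar> powr p) \<partial>Q e) \<le> ennreal r"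
        unfolding ennreal_indicator_mult tangent_diff using s(2) by (intro tangent_Lp_le_on) auto
    qed (use t C M r in auto)
    also have "\<dots> \<le> \<tau> / 4 + \<tau> / 4"
    proof (rule add_mono)
      show "t * M \<le> \<tau> / 4" using mult_divide_Suc_le[of "\<tau> / 4" M] \<tau> M by (simp add: t_def)
      have "C * r \<le> C * (\<tau> / 4 / (C + 1))" using C by (intro mult_left_mono) (auto simp: r_def)
      also have "\<dots> \<le> \<tau> / 4" using mult_divide_Suc_le[of "\<tau> / 4" C] \<tau> C by (simp add: mult.commute)
      finally show "C * r \<le> \<tau> / 4" .
    qed
    finally show ?case using elim(2) \<tau> unfolding sum dist_real_def by linarith
  qed
qed

end

section \<open>The layer across the boundary and the limit of the forms\<close>

definition outer :: "'a set \<Rightarrow> ('a \<times> 'a) set" where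
  "outer \<Omega> = {z. fst z \<notin> \<Omega> \<and> fst z - snd z \<in> \<Omega>}"

lemma outer_borel: "open \<Omega> \<Longrightarrow> outer \<Omega> \<in> sets (borel \<Otimes>\<^sub>M borel)"
proof -
  assume "open \<Omega>"
  then have [measurable]: "\<Omega> \<in> sets borel" by (rule borel_open)
  have "Measurable.pred (borel \<Otimes>\<^sub>M borel) (\<lambda>z. fst z \<notin> \<Omega> \<and> fst z - snd z \<in> \<Omega>)" by measurable
  then show ?thesis by (simp add: pred_def space_pair_measure outer_def)
qed

text \<open>Substitute \<open>x + h\<close> for \<open>x\<close>. The base point then lies in the open set \<open>\<Omega>\<close>, and the layer of points that leave \<open>\<Omega>\<close>
  under translation by \<open>h\<close> vanishes as \<open>h\<close> tends to \<open>0\<close>. With the base point outside \<open>\<Omega>\<close> the boundary would remain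
  in the limit.\<close>

lemma outer_increment_tendsto_0:
  assumes \<Omega>: "open \<Omega>" and s: "strong_Lp_grad p u g"
  shows "((\<lambda>e. energy e (outer \<Omega>) (increment u)) \<longlongrightarrow> 0) (at_right 0)"
proof -
  note strong_Lp_grad_borel[OF s, measurable]
  have [measurable]: "\<Omega> \<in> sets borel" using \<Omega> by (rule borel_open)
  note outer_borel[OF \<Omega>, measurable]
  have gfin: "Lp_power p g < \<infinity>" using s by (simp add: strong_Lp_grad_def)
  define \<psi> where "\<psi> h = (\<integral>\<^sup>+x. indicator (outer \<Omega>) (x, h) * ennreal (\<bar>increment u (x, h)\<bar> powr p) \<partial>lborel)" for h
  obtain C where C: "C \<ge> 0" "\<And>h. (\<integral>\<^sup>+x. ennreal (\<bar>increment u (x, h)\<bar> powr p) \<partial>lborel) \<le> ennreal (C * min 1 (norm h powr p))"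
    using increment_fibre_bound[OF s] by blast
  have lim: "((\<lambda>e. \<integral>\<^sup>+h. \<psi> h \<partial>P e) \<longlongrightarrow> 0) (at_right 0)"
  proof (rule concentration_tendsto_0[OF _ C(1)])
    fix h
    have "\<psi> h \<le> (\<integral>\<^sup>+x. ennreal (\<bar>increment u (x, h)\<bar> powr p) \<partial>lborel)"
      unfolding \<psi>_def by (intro nn_integral_mono) (simp add: indicator_def)
    then show "\<psi> h \<le> ennreal (C * min 1 (norm h powr p))" using C(2)[of h] by (rule order_trans)
  next
    fix t :: real assume t: "0 < t"
    define t' where "t' = t / 2 / 2 powr p"
    have t': "t' > 0" using t by (simp add: t'_def)
    have 1: "\<forall>\<^sub>F h in nhds 0. remainder_power p u g h \<le> ennreal (t' * norm h powr p)"
      using s t' by (simp add: strong_Lp_grad_def)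
    then have r1: "\<forall>\<^sub>F h in nhds 0. remainder_power p u g (- h) \<le> ennreal (t' * norm (- h) powr p)"
    proof -
      obtain d where d: "d > 0" "\<And>h. norm h < d \<Longrightarrow> (remainder_power p u g h) \<le> ennreal (t' * norm h powr p)"
        using 1 unfolding eventually_nhds_0_norm by blast
      show ?thesis unfolding eventually_nhds_0_norm
      proof (intro exI[of _ d] conjI allI impI d(1))
        fix h :: 'a assume "norm h < d"
        then show "remainder_power p u g (- h) \<le> ennreal (t' * norm (- h) powr p)"
          by (intro d(2)) simp
      qed
    qed
    have 2: "\<forall>\<^sub>F h in nhds 0. (\<integral>\<^sup>+x. ennreal (norm (g x) powr p) * indicator {x \<in> \<Omega>. x + h \<notin> \<Omega>} x \<partial>lborel) \<le> ennreal t'"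
      by (rule boundary_layer_vanishes[OF \<Omega> _ gfin t']) measurable
    from r1 2 show "\<forall>\<^sub>F h in nhds 0. \<psi> h \<le> ennreal (t * norm h powr p)"
    proof eventually_elim
      case (elim h)
      let ?B = "{x \<in> \<Omega>. x + h \<notin> \<Omega>}"
      have Bm[measurable]: "?B \<in> sets borel" by measurable
      have "\<psi> h = (\<integral>\<^sup>+x. indicator (outer \<Omega>) (x + h, h) * ennreal (\<bar>increment u (x + h, h)\<bar> powr p) \<partial>lborel)"
        unfolding \<psi>_def by (rule nn_integral_lborel_shift[symmetric, of "\<lambda>x. indicator (outer \<Omega>) (x, h) * ennreal (\<bar>increment u (x, h)\<bar> powr p)"]) measurable
      also have "\<dots> \<le> (\<integral>\<^sup>+x. ennreal (2 powr p) * (ennreal (\<bar>u x - u (x - - h) - g x \<bullet> - h\<bar> powr p) + ennreal (norm h powr p) * (ennreal (norm (g x) powr p) * indicator ?B x)) \<partial>lborel)"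
      proof (rule nn_integral_mono)
        fix x
        show "indicator (outer \<Omega>) (x + h, h) * ennreal (\<bar>increment u (x + h, h)\<bar> powr p) 
          \<le> ennreal (2 powr p) * (ennreal (\<bar>u x - u (x - - h) - g x \<bullet> - h\<bar> powr p) + ennreal (norm h powr p) * (ennreal (norm (g x) powr p) * indicator ?B x))"
        proof (cases "x \<in> ?B")
          case True
          have "\<bar>increment u (x + h, h)\<bar> = \<bar>(u x - u (x - - h) - g x \<bullet> - h) + g x \<bullet> - h\<bar>" by (simp add: increment_def)
          then have "ennreal (\<bar>increment u (x + h, h)\<bar> powr p) \<le> ennreal (2 powr p) * (ennreal (\<bar>u x - u (x - - h) - g x \<bullet> - h\<bar> powr p) + ennreal (\<bar>g x \<bullet> - h\<bar> powr p))"
            using abs_add_powr_le_ennreal[of p "u x - u (x - - h) - g x \<bullet> - h" "g x \<bullet> - h"] p by simp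
          also have "\<dots> \<le> ennreal (2 powr p) * (ennreal (\<bar>u x - u (x - - h) - g x \<bullet> - h\<bar> powr p) + ennreal (norm (- h) powr p * norm (g x) powr p))"
            using p by (intro mult_left_mono add_left_mono ennreal_leI powr_norm_inner_le) auto
          finally show ?thesis using True by (simp add: outer_def ennreal_mult)
        next
          case False
          then have "(x + h, h) \<notin> outer \<Omega>" by (auto simp: outer_def)
          then show ?thesis by simp
        qed
      qed
      also have "\<dots> = ennreal (2 powr p) * (remainder_power p u g (- h) 
          + ennreal (norm h powr p) * (\<integral>\<^sup>+x. ennreal (norm (g x) powr p) * indicator ?B x \<partial>lborel))"
        by (subst nn_integral_cmult, measurable, subst nn_integral_add, measurable, subst nn_integral_cmult, measurable)
      also have "\<dots> \<le> ennreal (2 powr p) * (ennreal (t' * norm (- h) powr p) + ennreal (norm h powr p) * ennreal t')"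
        using elim by (intro mult_left_mono add_mono) auto
      also have "\<dots> = ennreal (2 powr p * (t' * norm h powr p + norm h powr p * t'))"
        using t' by (simp flip: ennreal_mult ennreal_plus)
      also have "2 powr p * (t' * norm h powr p + norm h powr p * t') = t * norm h powr p" by (simp add: t'_def)
      finally show ?case .
    qed
  qed
  show ?thesis using lim unfolding \<psi>_def by (subst nn_integral_Q(1)) auto
qed

text \<open>Integrate over \<open>h\<close> first; the angular average turns the integrand into the local one.\<close>

lemma tangent_pairing:
  assumes [measurable]: "\<Omega> \<in> sets borel" "g \<in> borel_measurable borel" "g' \<in> borel_measurable borel"
    and fin: "Lp_power p g < \<infinity>" "Lp_power p g' < \<infinity>"
  shows "(\<integral>z. indicator (\<Omega> \<times> UNIV) z * (duality_map p (tangent g z) * tangent g' z) \<partial>Q e) 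
     = \<kappa> * (\<integral>x. indicator \<Omega> x * (norm (g x) powr (p - 2) * (g x \<bullet> g' x)) \<partial>lborel) * (\<integral>h. norm h powr p * indicator (cball 0 1) h \<partial>P e)"
    (is "_ = \<kappa> * _ * ?m")
proof -
  interpret PQ: pair_sigma_finite lborel "P e" by (rule pair_sigma_finite_Q)
  let ?f = "\<lambda>z. indicator (\<Omega> \<times> UNIV) z * (duality_map p (tangent g z) * tangent g' z)"
  have int: "integrable (Q e) ?f"
    using le_less_trans[OF tangent_Lp_le_on[OF assms(2) order_refl] fin(1)] le_less_trans[OF tangent_Lp_le_on[OF assms(3) order_refl] fin(2)]
    by (intro integrable_duality_map_times) auto
  have inner: "(\<integral>h. ?f (x, h) \<partial>P e) = indicator \<Omega> x * (norm (g x) powr (p - 2) * (g x \<bullet> g' x)) * (\<kappa> * ?m)" for x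
  proof -
    have "?f (x, h) = indicator \<Omega> x * (duality_map p (g x \<bullet> h) * (g' x \<bullet> h) * indicator (cball 0 1) h)" for h
      by (simp add: indicator_def tangent_def)
    then have "(\<integral>h. ?f (x, h) \<partial>P e) = indicator \<Omega> x * (\<integral>h. duality_map p (g x \<bullet> h) * (g' x \<bullet> h) * indicator (cball 0 1) h \<partial>P e)"
      by (simp only: integral_mult_right_zero)
    also have "(\<integral>h. duality_map p (g x \<bullet> h) * (g' x \<bullet> h) * indicator (cball 0 1) h \<partial>P e) = \<kappa> * (norm (g x) powr (p - 2) * (g x \<bullet> g' x)) * ?m" by (rule ang)
    finally show ?thesis by (simp only: mult_ac)
  qed
  have "(\<integral>z. ?f z \<partial>Q e) = (\<integral>x. \<integral>h. ?f (x, h) \<partial>P e \<partial>lborel)"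
    using PQ.integral_fst[of "\<lambda>x h. ?f (x, h)"] int by (simp add: case_prod_unfold)
  also have "\<dots> = (\<integral>x. indicator \<Omega> x * (norm (g x) powr (p - 2) * (g x \<bullet> g' x)) * (\<kappa> * ?m) \<partial>lborel)" by (simp only: inner)
  also have "\<dots> = (\<integral>x. indicator \<Omega> x * (norm (g x) powr (p - 2) * (g x \<bullet> g' x)) \<partial>lborel) * (\<kappa> * ?m)" by (rule integral_mult_left_zero)
  finally show ?thesis by (simp add: mult_ac)
qed

text \<open>With \<open>w = v\<^sub>e - v\<close> and \<open>J\<close> for the nonlinearity, the pairing of \<open>J (Du)\<close> with \<open>D v\<^sub>e\<close> is the sum of four terms:
  \<open>J (Du) - J (tangent g)\<close> with \<open>D v\<^sub>e\<close>, and \<open>J (tangent g)\<close> with \<open>Dv - tangent g'\<close>, with \<open>tangent g'\<close> and with \<open>Dw\<close>. The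
  third converges to the local form, the others to \<open>0\<close>.\<close>

theorem forms_converge:
  fixes vv :: "real \<Rightarrow> 'a \<Rightarrow> real"
  assumes \<Omega>: "open \<Omega>" and su: "strong_Lp_grad p u g" and sv: "strong_Lp_grad p v g'"
    and vm[measurable]: "\<And>e. vv e \<in> borel_measurable borel"
    and bd: "\<forall>\<^sub>F e in at_right 0. energy e (\<Omega> \<times> UNIV \<union> outer \<Omega>) (increment (vv e)) \<le> ennreal C"
    and loc: "\<And>K. compact K \<Longrightarrow> K \<subseteq> \<Omega> \<Longrightarrow> ((\<lambda>e. \<integral>\<^sup>+x. indicator K x * ennreal \<bar>vv e x - v x\<bar> \<partial>lborel) \<longlongrightarrow> 0) (at_right 0)"
  shows "((\<lambda>e. \<integral>z. indicator (\<Omega> \<times> UNIV) z * (duality_map p (increment u z) * increment (vv e) z) \<partial>Q e) 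
       \<longlongrightarrow> \<kappa> * (\<integral>x. indicator \<Omega> x * (norm (g x) powr (p - 2) * (g x \<bullet> g' x)) \<partial>lborel)) (at_right 0)"
    and "((\<lambda>e. \<integral>z. indicator (\<Omega> \<times> UNIV \<union> outer \<Omega>) z * (duality_map p (increment u z) * increment (vv e) z) \<partial>Q e) 
       \<longlongrightarrow> \<kappa> * (\<integral>x. indicator \<Omega> x * (norm (g x) powr (p - 2) * (g x \<bullet> g' x)) \<partial>lborel)) (at_right 0)"
proof -
  have [measurable]: "\<Omega> \<in> sets borel" using \<Omega> by (rule borel_open)
  note outer_borel[OF \<Omega>, measurable]
  have um[measurable]: "u \<in> borel_measurable borel" "g \<in> borel_measurable borel" "v \<in> borel_measurable borel" "g' \<in> borel_measurable borel"
    using su sv by (auto simp: strong_Lp_grad_def)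
  have gfin: "Lp_power p g < \<infinity>" "Lp_power p g' < \<infinity>"
    using su sv by (simp_all add: strong_Lp_grad_def)
  let ?S = "\<Omega> \<times> (UNIV :: 'a set)"
  let ?I = "\<lambda>S a b e. \<integral>z. indicator S z * (duality_map p (a z) * b z) \<partial>Q e"
  let ?N = "\<lambda>S a e. \<integral>\<^sup>+z. indicator S z * ennreal (\<bar>a z\<bar> powr p) \<partial>Q e"
  let ?L = "\<kappa> * (\<integral>x. indicator \<Omega> x * (norm (g x) powr (p - 2) * (g x \<bullet> g' x)) \<partial>lborel)"
  define w where "w e x = vv e x - v x" for e x
  have wm[measurable]: "w e \<in> borel_measurable borel" for e unfolding w_def[abs_def] by measurable
  have Nmono: "?N S a e \<le> ?N T a e" if "S \<subseteq> T" for S T and a :: "'a \<times> 'a \<Rightarrow> real" and e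
    using that by (intro nn_integral_mono) (auto simp: indicator_def)
  have NUNIV: "?N S a e \<le> (\<integral>\<^sup>+z. ennreal (\<bar>a z\<bar> powr p) \<partial>Q e)" for S and a :: "'a \<times> 'a \<Rightarrow> real" and e
    by (intro nn_integral_mono) (auto simp: indicator_def)
  have vS: "\<forall>\<^sub>F e in at_right 0. ?N ?S (increment (vv e)) e \<le> ennreal C"
    using bd by eventually_elim (rule order_trans[OF Nmono], auto)
  have vO: "\<forall>\<^sub>F e in at_right 0. ?N (outer \<Omega>) (increment (vv e)) e \<le> ennreal C"
    using bd by eventually_elim (rule order_trans[OF Nmono], auto)
  obtain Cu where Cu: "Cu \<ge> 0" "\<And>e. (\<integral>\<^sup>+z. ennreal (\<bar>increment u z\<bar> powr p) \<partial>Q e) \<le> ennreal Cu" using increment_Lp_bound[OF su] by blast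
  obtain Cv where Cv: "Cv \<ge> 0" "\<And>e. (\<integral>\<^sup>+z. ennreal (\<bar>increment v z\<bar> powr p) \<partial>Q e) \<le> ennreal Cv" using increment_Lp_bound[OF sv] by blast
  have uN: "?N S (increment u) e \<le> ennreal Cu" for S e using order_trans[OF NUNIV Cu(2)] .
  have vN: "?N S (increment v) e \<le> ennreal Cv" for S e using order_trans[OF NUNIV Cv(2)] .
  obtain G where G: "Lp_power p g = ennreal G" "G \<ge> 0"
    using gfin(1) by (cases "Lp_power p g") auto
  obtain G' where G': "Lp_power p g' = ennreal G'" "G' \<ge> 0"
    using gfin(2) by (cases "Lp_power p g'") auto
  have tN: "?N S (tangent g) e \<le> ennreal G" for S e using G by (intro tangent_Lp_le_on) auto
  have tN': "?N S (tangent g') e \<le> ennreal G'" for S e using G' by (intro tangent_Lp_le_on) auto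
  have wS: "\<forall>\<^sub>F e in at_right 0. ?N ?S (increment (w e)) e \<le> ennreal (2 powr p * (\<bar>C\<bar> + Cv))"
    using vS
  proof eventually_elim
    case (elim e)
    have "?N ?S (increment (w e)) e \<le> (\<integral>\<^sup>+z. ennreal (2 powr p) * (indicator ?S z * ennreal (\<bar>increment (vv e) z\<bar> powr p) + indicator ?S z * ennreal (\<bar>increment v z\<bar> powr p)) \<partial>Q e)"
    proof (rule nn_integral_mono)
      fix z
      have "increment (w e) z = increment (vv e) z - increment v z" by (simp add: increment_def w_def)
      then show "indicator ?S z * ennreal (\<bar>increment (w e) z\<bar> powr p) \<le> ennreal (2 powr p) * (indicator ?S z * ennreal (\<bar>increment (vv e) z\<bar> powr p) + indicator ?S z * ennreal (\<bar>increment v z\<bar> powr p))"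
        using abs_diff_powr_le_ennreal[of p "increment (vv e) z" "increment v z"] p by (simp add: indicator_def)
    qed
    also have "\<dots> = ennreal (2 powr p) * (?N ?S (increment (vv e)) e + ?N ?S (increment v) e)"
      by (simp add: nn_integral_cmult nn_integral_add)
    also have "\<dots> \<le> ennreal (2 powr p) * (ennreal \<bar>C\<bar> + ennreal Cv)"
      using elim vN by (intro mult_left_mono add_mono) (auto elim!: order_trans intro!: ennreal_leI)
    also have "\<dots> = ennreal (2 powr p * (\<bar>C\<bar> + Cv))" using Cv by (simp flip: ennreal_plus ennreal_mult)
    finally show ?case .
  qed
  have small: "((\<lambda>e. ?N S (\<lambda>z. increment a z - tangent b z) e) \<longlongrightarrow> 0) (at_right 0)" if "strong_Lp_grad p a b" for S a b
    by (rule tendsto_sandwich[OF _ _ tendsto_const increment_minus_tangent_tendsto[OF that]]) (auto intro!: always_eventually NUNIV)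
  have T1: "((\<lambda>e. \<integral>z. indicator ?S z * ((duality_map p (increment u z) - duality_map p (tangent g z)) * increment (vv e) z) \<partial>Q e) \<longlongrightarrow> 0) (at_right 0)"
    by (rule tendsto_duality_map_diff_times[OF _ _ _ _ _ _ vS small[OF su]]) (use uN tN in \<open>auto intro!: always_eventually\<close>)
  have T2: "((\<lambda>e. ?I ?S (tangent g) (\<lambda>z. increment v z - tangent g' z) e) \<longlongrightarrow> 0) (at_right 0)"
    by (rule tendsto_duality_map_times_small_right[OF _ _ _ _ small[OF sv]]) (use tN in \<open>auto intro!: always_eventually\<close>)
  have T3: "((\<lambda>e. ?I ?S (tangent g) (tangent g') e) \<longlongrightarrow> ?L) (at_right 0)"
    unfolding tangent_pairing[OF \<open>\<Omega> \<in> sets borel\<close> um(2,4) gfin]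
    using tendsto_mult[OF tendsto_const near_moment_tendsto_1, of ?L] by simp
  have T4: "((\<lambda>e. ?I ?S (tangent g) (increment (w e)) e) \<longlongrightarrow> 0) (at_right 0)"
    using loc by (intro weak_limit_vector[OF \<Omega> wm wS _ um(2) gfin(1)]) (simp add: w_def)
  have int: "integrable (Q e) (\<lambda>z. indicator S z * (duality_map p (a z) * b z))"
    if [measurable]: "a \<in> borel_measurable (borel \<Otimes>\<^sub>M borel)" "b \<in> borel_measurable (borel \<Otimes>\<^sub>M borel)" "S \<in> sets (borel \<Otimes>\<^sub>M borel)"
      and "?N S a e \<le> ennreal x" "?N S b e \<le> ennreal y" for S a b e x y
    using that(4,5) by (intro integrable_duality_map_times) (auto intro: le_less_trans)
  have split: "\<forall>\<^sub>F e in at_right 0. (\<integral>z. indicator ?S z * ((duality_map p (increment u z) - duality_map p (tangent g z)) * increment (vv e) z) \<partial>Q e)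
      + ?I ?S (tangent g) (\<lambda>z. increment v z - tangent g' z) e + ?I ?S (tangent g) (tangent g') e + ?I ?S (tangent g) (increment (w e)) e = ?I ?S (increment u) (increment (vv e)) e"
    using vS wS
  proof eventually_elim
    case (elim e)
    have i1: "integrable (Q e) (\<lambda>z. indicator ?S z * (duality_map p (increment u z) * increment (vv e) z))" by (rule int[OF _ _ _ uN elim(1)]) auto
    have i2: "integrable (Q e) (\<lambda>z. indicator ?S z * (duality_map p (tangent g z) * increment (vv e) z))" by (rule int[OF _ _ _ tN elim(1)]) auto
    have i3: "integrable (Q e) (\<lambda>z. indicator ?S z * (duality_map p (tangent g z) * increment v z))" by (rule int[OF _ _ _ tN vN]) auto
    have i4: "integrable (Q e) (\<lambda>z. indicator ?S z * (duality_map p (tangent g z) * tangent g' z))" by (rule int[OF _ _ _ tN tN']) auto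
    have i5: "integrable (Q e) (\<lambda>z. indicator ?S z * (duality_map p (tangent g z) * increment (w e) z))" by (rule int[OF _ _ _ tN elim(2)]) auto
    have e1: "(\<integral>z. indicator ?S z * ((duality_map p (increment u z) - duality_map p (tangent g z)) * increment (vv e) z) \<partial>Q e) 
       = ?I ?S (increment u) (increment (vv e)) e - ?I ?S (tangent g) (increment (vv e)) e"
      by (subst Bochner_Integration.integral_diff[OF i1 i2, symmetric]) (simp add: algebra_simps)
    have e2: "?I ?S (tangent g) (\<lambda>z. increment v z - tangent g' z) e = ?I ?S (tangent g) (increment v) e - ?I ?S (tangent g) (tangent g') e"
      by (subst Bochner_Integration.integral_diff[OF i3 i4, symmetric]) (simp add: algebra_simps)
    have "?I ?S (tangent g) (increment v) e + ?I ?S (tangent g) (increment (w e)) e = (\<integral>z. indicator ?S z * (duality_map p (tangent g z) * increment v z) + indicator ?S z * (duality_map p (tangent g z) * increment (w e) z) \<partial>Q e)"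
      by (rule Bochner_Integration.integral_add[OF i3 i5, symmetric])
    also have "\<dots> = ?I ?S (tangent g) (increment (vv e)) e"
      by (intro Bochner_Integration.integral_cong) (simp_all add: increment_def w_def algebra_simps)
    finally show ?case unfolding e1 e2 by linarith
  qed
  have "((\<lambda>e. (\<integral>z. indicator ?S z * ((duality_map p (increment u z) - duality_map p (tangent g z)) * increment (vv e) z) \<partial>Q e)
      + ?I ?S (tangent g) (\<lambda>z. increment v z - tangent g' z) e + ?I ?S (tangent g) (tangent g') e + ?I ?S (tangent g) (increment (w e)) e) \<longlongrightarrow> 0 + 0 + ?L + 0) (at_right 0)"
    by (intro tendsto_add T1 T2 T3 T4)
  then have "((\<lambda>e. (\<integral>z. indicator ?S z * ((duality_map p (increment u z) - duality_map p (tangent g z)) * increment (vv e) z) \<partial>Q e)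
      + ?I ?S (tangent g) (\<lambda>z. increment v z - tangent g' z) e + ?I ?S (tangent g) (tangent g') e + ?I ?S (tangent g) (increment (w e)) e) \<longlongrightarrow> ?L) (at_right 0)"
    by simp
  from this split show R: "((\<lambda>e. ?I ?S (increment u) (increment (vv e)) e) \<longlongrightarrow> ?L) (at_right 0)" by (rule Lim_transform_eventually)
  have T5: "((\<lambda>e. ?I (outer \<Omega>) (increment u) (increment (vv e)) e) \<longlongrightarrow> 0) (at_right 0)"
    by (rule tendsto_duality_map_times_small_left[OF _ _ _ vO outer_increment_tendsto_0[OF \<Omega> su]]) auto
  have "\<forall>\<^sub>F e in at_right 0. ?I ?S (increment u) (increment (vv e)) e + ?I (outer \<Omega>) (increment u) (increment (vv e)) e
      = ?I (?S \<union> outer \<Omega>) (increment u) (increment (vv e)) e"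
    using vS vO
  proof eventually_elim
    case (elim e)
    have i1: "integrable (Q e) (\<lambda>z. indicator ?S z * (duality_map p (increment u z) * increment (vv e) z))" by (rule int[OF _ _ _ uN elim(1)]) auto
    have i2: "integrable (Q e) (\<lambda>z. indicator (outer \<Omega>) z * (duality_map p (increment u z) * increment (vv e) z))" by (rule int[OF _ _ _ uN elim(2)]) auto
    have "?S \<inter> outer \<Omega> = {}" by (auto simp: outer_def)
    then have "indicator (?S \<union> outer \<Omega>) z = (indicator ?S z + indicator (outer \<Omega>) z :: real)" for z by (auto simp: indicator_def)
    then show ?case by (subst Bochner_Integration.integral_add[OF i1 i2, symmetric]) (simp add: distrib_right)
  qed
  from Lim_transform_eventually[OF tendsto_add[OF R T5] this] 
  show "((\<lambda>e. ?I (?S \<union> outer \<Omega>) (increment u) (increment (vv e)) e) \<longlongrightarrow> ?L) (at_right 0)" by simp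
qed

end

section \<open>From Lebesgue integrals of the forms to shear coordinates\<close>

text \<open>Sections of the three preimages of a null set are null sets: projections and the subtraction map are
  nonsingular.\<close>

lemma AE_lborel_prod_fst_snd_diff:
  assumes "AE x in (lborel :: 'a::euclidean_space measure). R x"
  shows "AE z in (lborel :: ('a \<times> 'a) measure). R (fst z)"
    and "AE z in (lborel :: ('a \<times> 'a) measure). R (snd z)"
    and "AE z in (lborel :: ('a \<times> 'a) measure). R (fst z - snd z)"
proof -
  obtain N where N: "N \<in> null_sets lborel" "{x. \<not> R x} \<subseteq> N" 
    using assms by (rule AE_E) (auto intro!: that null_setsI)
  have [measurable]: "N \<in> sets borel" using N(1) by auto
  have n1: "AE x in lborel. x \<notin> N" using N(1) by (rule AE_not_in)
  have nd: "AE y in lborel. x - y \<notin> N" for x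
  proof -
    have "(\<integral>\<^sup>+y. indicator N (x - y) \<partial>lborel) = 0"
      using nn_integral_lborel_reflect[of "indicator N" x] N(1) by auto
    then have "AE y in lborel. indicator N (x - y) = (0::ennreal)" by (subst (asm) nn_integral_0_iff_AE) auto
    then show ?thesis by eventually_elim (auto simp: indicator_def split: if_splits)
  qed
  have 1: "AE z in lborel \<Otimes>\<^sub>M lborel. fst z \<notin> N"
    by (rule lborel_pair.AE_pair_measure) (measurable, use n1 in auto)
  have 2: "AE z in lborel \<Otimes>\<^sub>M lborel. snd z \<notin> N"
    by (rule lborel_pair.AE_pair_measure) (measurable, use n1 in auto)
  have 3: "AE z in lborel \<Otimes>\<^sub>M lborel. fst z - snd z \<notin> N"
    by (rule lborel_pair.AE_pair_measure) (measurable, use nd in auto)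
  show "AE z in (lborel :: ('a \<times> 'a) measure). R (fst z)"
    using 1 unfolding lborel_prod by eventually_elim (use N(2) in auto)
  show "AE z in (lborel :: ('a \<times> 'a) measure). R (snd z)"
    using 2 unfolding lborel_prod by eventually_elim (use N(2) in auto)
  show "AE z in (lborel :: ('a \<times> 'a) measure). R (fst z - snd z)"
    using 3 unfolding lborel_prod by eventually_elim (use N(2) in auto)
qed

lemma lborel_shear:
  "distr (lborel \<Otimes>\<^sub>M lborel) borel (\<lambda>z. (fst z, fst z - snd z)) = (lborel :: ('a::euclidean_space \<times> 'a) measure)"
proof (rule measure_eqI)
  fix A :: "('a \<times> 'a) set" assume "A \<in> sets (distr (lborel \<Otimes>\<^sub>M lborel) borel (\<lambda>z. (fst z, fst z - snd z)))"
  then have Ab: "A \<in> sets borel" by simp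
  then have [measurable]: "A \<in> sets (borel \<Otimes>\<^sub>M borel)" by (simp only: borel_prod)
  have T: "(\<lambda>z. (fst z, fst z - snd z)) \<in> measurable (lborel \<Otimes>\<^sub>M lborel) (borel :: ('a \<times> 'a) measure)"
    unfolding borel_prod[symmetric] by measurable
  have "emeasure (distr (lborel \<Otimes>\<^sub>M lborel) borel (\<lambda>z. (fst z, fst z - snd z))) A 
     = (\<integral>\<^sup>+z. indicator A z \<partial>distr (lborel \<Otimes>\<^sub>M lborel) borel (\<lambda>z. (fst z, fst z - snd z)))" using Ab by simp
  also have "\<dots> = (\<integral>\<^sup>+z. indicator A (fst z, fst z - snd z) \<partial>(lborel \<Otimes>\<^sub>M lborel))"
    using Ab by (intro nn_integral_distr T) auto
  also have "\<dots> = (\<integral>\<^sup>+x. \<integral>\<^sup>+h. indicator A (x, x - h) \<partial>lborel \<partial>lborel)"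
    by (subst lborel.nn_integral_fst[symmetric]) auto
  also have "\<dots> = (\<integral>\<^sup>+x. \<integral>\<^sup>+y. indicator A (x, y) \<partial>lborel \<partial>lborel)"
    by (intro nn_integral_cong nn_integral_lborel_reflect) measurable
  also have "\<dots> = (\<integral>\<^sup>+z. indicator A z \<partial>(lborel \<Otimes>\<^sub>M lborel))"
    by (subst lborel.nn_integral_fst[symmetric]) auto
  also have "\<dots> = emeasure lborel A" using Ab by (simp add: lborel_prod)
  finally show "emeasure (distr (lborel \<Otimes>\<^sub>M lborel) borel (\<lambda>z. (fst z, fst z - snd z))) A = emeasure lborel A" .
qed simp

text \<open>Change \<open>u\<close>, \<open>v\<close> and the kernel on null sets to pass to Borel functions, shear by \<open>(x, h) \<mapsto> (x, x - h)\<close>, and move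
  the kernel from the integrand into the measure.\<close>

lemma form_integral_transfer:
  fixes u v u' v' :: "'a::euclidean_space \<Rightarrow> real" and \<nu> :: "'a \<Rightarrow> real" and r :: "real \<Rightarrow> real" and p :: real
  assumes [measurable]: "u' \<in> borel_measurable borel" "v' \<in> borel_measurable borel" "r \<in> borel_measurable borel"
    and r: "\<And>t. 0 \<le> r t"
    and u: "AE x in lborel. u x = u' x" and v: "AE x in lborel. v x = v' x" and \<nu>: "AE h in lborel. \<nu> h = r (norm h)"
    and S: "S \<in> sets borel" and S'[measurable]: "S' \<in> sets (borel \<Otimes>\<^sub>M borel)" and SS': "\<And>x h. (x, x - h) \<in> S \<longleftrightarrow> (x, h) \<in> S'"
  defines "M \<equiv> lborel \<Otimes>\<^sub>M density lborel (\<lambda>h. ennreal (r (norm h)))"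
    and "f \<equiv> \<lambda>z. indicator S' z * (duality_map p (u' (fst z) - u' (fst z - snd z)) * (v' (fst z) - v' (fst z - snd z)))"
  shows "set_integrable lebesgue S (form_integrand p \<nu> u v) \<longleftrightarrow> integrable M f"
    and "(LINT z:S|lebesgue. form_integrand p \<nu> u v z) = (\<integral>z. f z \<partial>M)"
proof -
  define F where "F z = indicator S z * (duality_map p (u' (fst z) - u' (snd z)) * (v' (fst z) - v' (snd z)) * r (norm (fst z - snd z)))" for z
  have Fm: "F \<in> borel_measurable borel"
  proof -
    have [measurable]: "S \<in> sets (borel \<Otimes>\<^sub>M borel)" using S by (simp only: borel_prod)
    have "F \<in> borel_measurable (borel \<Otimes>\<^sub>M borel)" unfolding F_def by measurable
    then show ?thesis by (simp only: borel_prod)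
  qed
  have fm[measurable]: "f \<in> borel_measurable (borel \<Otimes>\<^sub>M borel)" unfolding f_def by measurable
  have ae: "AE z in lborel. indicator S z *\<^sub>R form_integrand p \<nu> u v z = F z"
    using AE_lborel_prod_fst_snd_diff(1)[OF u] AE_lborel_prod_fst_snd_diff(2)[OF u] AE_lborel_prod_fst_snd_diff(1)[OF v] 
      AE_lborel_prod_fst_snd_diff(2)[OF v] AE_lborel_prod_fst_snd_diff(3)[OF \<nu>]
    by eventually_elim (simp add: F_def form_integrand_def duality_map_def case_prod_unfold)
  let ?T = "\<lambda>z. (fst z, fst z - snd z) :: 'a \<times> 'a"
  have T: "?T \<in> measurable (lborel \<Otimes>\<^sub>M lborel) borel" unfolding borel_prod[symmetric] by measurable
  have sf: "sigma_finite_measure (density lborel (\<lambda>h::'a. ennreal (r (norm h))))"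
    by (subst sigma_finite_measure.sigma_finite_iff_density_finite[OF sigma_finite_lborel]) auto
  have M: "M = density (lborel \<Otimes>\<^sub>M lborel) (\<lambda>z. ennreal (r (norm (snd z))))"
    using pair_measure_density[of "\<lambda>_. 1" "lborel :: 'a measure" "\<lambda>h. ennreal (r (norm h))" "lborel :: 'a measure"] sf
    by (simp add: M_def density_1 case_prod_unfold sigma_finite_lborel)
  have FT: "F (?T z) = r (norm (snd z)) *\<^sub>R f z" for z
    using SS'[of "fst z" "snd z"] by (simp add: F_def f_def indicator_def)
  have I: "integrable lborel F \<longleftrightarrow> integrable (lborel \<Otimes>\<^sub>M lborel) (\<lambda>z. F (?T z))"
    using integrable_distr_eq[OF T, of F] Fm unfolding lborel_shear by simp
  have E: "integral\<^sup>L lborel F = (\<integral>z. F (?T z) \<partial>(lborel \<Otimes>\<^sub>M lborel))"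
    using integral_distr[OF T, of F] Fm unfolding lborel_shear by simp
  show "set_integrable lebesgue S (form_integrand p \<nu> u v) \<longleftrightarrow> integrable M f"
    unfolding set_integrable_def lebesgue_borel_transfer(1)[OF Fm ae] I FT M
    by (rule integrable_density[symmetric]) (use r in auto)
  show "(LINT z:S|lebesgue. form_integrand p \<nu> u v z) = (\<integral>z. f z \<partial>M)"
    unfolding set_lebesgue_integral_def lebesgue_borel_transfer(2)[OF Fm ae] E FT M
    by (rule integral_density[symmetric]) (use r in auto)
qed

lemma radial_kernels_concentrate:
  fixes r :: "real \<Rightarrow> real \<Rightarrow> real" and k :: "'d::finite"
  assumes p: "1 < p" and rm[measurable]: "\<And>e. r e \<in> borel_measurable borel" and r: "\<And>e t. 0 \<le> r e t"
    and mass: "\<And>e. has_bochner_integral lborel (\<lambda>h :: real ^ 'd. min 1 (norm h powr p) * r e (norm h)) 1"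
    and conc: "\<And>d. 0 < d \<Longrightarrow> ((\<lambda>e. \<integral>h. indicator {h :: real ^ 'd. d < norm h} h * r e (norm h) \<partial>lborel) \<longlongrightarrow> 0) (at_right 0)"
  shows "concentrating_kernels p (\<lambda>e. density lborel (\<lambda>h :: real ^ 'd. ennreal (r e (norm h)))) (K_const p k)"
proof (rule concentrating_kernels.intro)
  show "1 < p" by fact
  fix e
  show "sets (density lborel (\<lambda>h :: real ^ 'd. ennreal (r e (norm h)))) = sets borel" by simp
  show "sigma_finite_measure (density lborel (\<lambda>h :: real ^ 'd. ennreal (r e (norm h))))"
    by (subst sigma_finite_measure.sigma_finite_iff_density_finite[OF sigma_finite_lborel]) auto
  have mi: "integrable lborel (\<lambda>h :: real ^ 'd. min 1 (norm h powr p) * r e (norm h))" 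
    and m1: "(\<integral>h. min 1 (norm h powr p) * r e (norm h) \<partial>(lborel :: (real ^ 'd) measure)) = 1" for e
    using mass[of e] by (auto simp: has_bochner_integral_iff)
  show "(\<integral>\<^sup>+h. ennreal (min 1 (norm h powr p)) \<partial>density lborel (\<lambda>h :: real ^ 'd. ennreal (r e (norm h)))) = 1"
  proof -
    have "(\<integral>\<^sup>+h. ennreal (min 1 (norm h powr p)) \<partial>density lborel (\<lambda>h :: real ^ 'd. ennreal (r e (norm h)))) 
      = (\<integral>\<^sup>+h. ennreal (min 1 (norm h powr p) * r e (norm h)) \<partial>(lborel :: (real ^ 'd) measure))"
      by (subst nn_integral_density) (auto simp: r mult.commute intro!: nn_integral_cong simp flip: ennreal_mult)
    also have "\<dots> = 1" using nn_integral_eq_integral[OF mi] m1 r by simp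
    finally show ?thesis .
  qed
  have bnd: "integrable lborel (\<lambda>h :: real ^ 'd. norm h powr p * (indicator {..1} (norm h) * r e (norm h)))"
  proof (rule Bochner_Integration.integrable_bound[OF mi])
    show "AE h :: real ^ 'd in lborel. norm (norm h powr p * (indicator {..1} (norm h) * r e (norm h))) \<le> norm (min 1 (norm h powr p) * r e (norm h))"
    proof (rule AE_I2)
      fix h :: "real ^ 'd"
      show "norm (norm h powr p * (indicator {..1} (norm h) * r e (norm h))) \<le> norm (min 1 (norm h powr p) * r e (norm h))"
        using p r[of e "norm h"] powr_mono2[of p "norm h" 1] by (cases "norm h \<le> 1") (auto simp: min_def abs_mult)
    qed
  qed measurable
  fix a b :: "real ^ 'd"
  let ?w = "\<lambda>t. indicator {..1} t * r e t"
  have "(\<integral>h. duality_map p (a \<bullet> h) * (b \<bullet> h) * ?w (norm h) \<partial>lborel) 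
     = K_const p k * (norm a powr (p - 2) * (a \<bullet> b)) * (\<integral>h. norm h powr p * ?w (norm h) \<partial>(lborel :: (real ^ 'd) measure))"
    by (rule radial_duality_moment[OF p _ _ bnd]) (auto simp: r)
  moreover have "(\<integral>h. duality_map p (a \<bullet> h) * (b \<bullet> h) * indicator (cball 0 1) h \<partial>density lborel (\<lambda>h :: real ^ 'd. ennreal (r e (norm h)))) 
     = (\<integral>h. duality_map p (a \<bullet> h) * (b \<bullet> h) * ?w (norm h) \<partial>lborel)"
    by (subst integral_density) (auto simp: r indicator_def intro!: Bochner_Integration.integral_cong)
  moreover have "(\<integral>h. norm h powr p * indicator (cball 0 1) h \<partial>density lborel (\<lambda>h :: real ^ 'd. ennreal (r e (norm h)))) 
     = (\<integral>h. norm h powr p * ?w (norm h) \<partial>(lborel :: (real ^ 'd) measure))"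
    by (subst integral_density) (auto simp: r indicator_def intro!: Bochner_Integration.integral_cong)
  ultimately show "(\<integral>h. duality_map p (a \<bullet> h) * (b \<bullet> h) * indicator (cball 0 1) h \<partial>density lborel (\<lambda>h :: real ^ 'd. ennreal (r e (norm h)))) 
    = K_const p k * (norm a powr (p - 2) * (a \<bullet> b)) * (\<integral>h. norm h powr p * indicator (cball 0 1) h \<partial>density lborel (\<lambda>h :: real ^ 'd. ennreal (r e (norm h))))"
    by simp
next
  fix d :: real assume d: "0 < d"
  have mi: "integrable lborel (\<lambda>h :: real ^ 'd. min 1 (norm h powr p) * r e (norm h))" for e
    using mass[of e] by (auto simp: has_bochner_integral_iff)
  have [measurable]: "{h :: real ^ 'd. d < norm h} \<in> sets borel" by measurable
  have "emeasure (density lborel (\<lambda>h :: real ^ 'd. ennreal (r e (norm h)))) {h. d < norm h} = ennreal (\<integral>h. indicator {h :: real ^ 'd. d < norm h} h * r e (norm h) \<partial>lborel)" for e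
  proof -
    have m0: "0 < min 1 (d powr p)" using d by simp
    have int: "integrable lborel (\<lambda>h :: real ^ 'd. indicator {h. d < norm h} h * r e (norm h))"
    proof (rule Bochner_Integration.integrable_bound)
      show "integrable lborel (\<lambda>h :: real ^ 'd. (1 / min 1 (d powr p)) * (min 1 (norm h powr p) * r e (norm h)))" by (intro integrable_mult_right mi)
      show "AE h :: real ^ 'd in lborel. norm (indicator {h. d < norm h} h * r e (norm h)) \<le> norm ((1 / min 1 (d powr p)) * (min 1 (norm h powr p) * r e (norm h)))"
      proof (rule AE_I2)
        fix h :: "real ^ 'd"
        show "norm (indicator {h. d < norm h} h * r e (norm h)) \<le> norm ((1 / min 1 (d powr p)) * (min 1 (norm h powr p) * r e (norm h)))"
        proof (cases "d < norm h")
          case True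
          have "min 1 (d powr p) \<le> min 1 (norm h powr p)" using True d p powr_mono2[of p d "norm h"] by (intro min.mono) auto
          then have "1 \<le> min 1 (norm h powr p) / min 1 (d powr p)" using m0 by (simp add: le_divide_eq)
          then have "1 * r e (norm h) \<le> (min 1 (norm h powr p) / min 1 (d powr p)) * r e (norm h)" using r by (intro mult_right_mono) auto
          then show ?thesis using True r[of e "norm h"] m0 by (simp add: abs_mult)
        qed simp
      qed
    qed measurable
    have "emeasure (density lborel (\<lambda>h :: real ^ 'd. ennreal (r e (norm h)))) {h. d < norm h} = (\<integral>\<^sup>+h. ennreal (indicator {h :: real ^ 'd. d < norm h} h * r e (norm h)) \<partial>lborel)"
      by (subst emeasure_density) (auto simp: indicator_def intro!: nn_integral_cong)
    also have "\<dots> = ennreal (\<integral>h. indicator {h :: real ^ 'd. d < norm h} h * r e (norm h) \<partial>lborel)"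
      by (rule nn_integral_eq_integral[OF int]) (simp add: r)
    finally show ?thesis .
  qed
  then show "((\<lambda>e. emeasure (density lborel (\<lambda>h :: real ^ 'd. ennreal (r e (norm h)))) {h. d < norm h}) \<longlongrightarrow> 0) (at_right 0)"
    using tendsto_ennrealI[OF conc[OF d]] by simp
qed

text \<open>On a set of finite measure, \<open>|f| \<le> s + s\<^sup>1\<^sup>-\<^sup>p |f|\<^sup>p\<close> with \<open>s\<close> small.\<close>

lemma Lp_to_L1_tendsto_on:
  fixes f :: "'e \<Rightarrow> 'a::euclidean_space \<Rightarrow> real"
  assumes p: "1 < p" and [measurable]: "\<And>e. f e \<in> borel_measurable borel" "K \<in> sets borel" and K: "emeasure lborel K < \<infinity>"
    and lim: "((\<lambda>e. \<integral>\<^sup>+x. indicator K x * ennreal (\<bar>f e x\<bar> powr p) \<partial>lborel) \<longlongrightarrow> 0) F"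
  shows "((\<lambda>e. \<integral>\<^sup>+x. indicator K x * ennreal \<bar>f e x\<bar> \<partial>lborel) \<longlongrightarrow> 0) F"
  unfolding tendsto_0_ennreal_iff
proof safe
  fix \<tau> :: real assume \<tau>: "0 < \<tau>"
  obtain m where m: "emeasure lborel K = ennreal m" "m \<ge> 0" using K by (cases "emeasure lborel K") auto
  define s where "s = \<tau> / 2 / (m + 1)"
  have s: "s > 0" using \<tau> m by (simp add: s_def)
  define c where "c = s powr (1 - p)"
  have c: "c > 0" using s by (simp add: c_def)
  have "\<forall>\<^sub>F e in F. (\<integral>\<^sup>+x. indicator K x * ennreal (\<bar>f e x\<bar> powr p) \<partial>lborel) \<le> ennreal (\<tau> / 2 / c)"
    using lim \<tau> c by (simp add: tendsto_0_ennreal_iff)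
  then show "\<forall>\<^sub>F e in F. (\<integral>\<^sup>+x. indicator K x * ennreal \<bar>f e x\<bar> \<partial>lborel) \<le> ennreal \<tau>"
  proof eventually_elim
    case (elim e)
    have "(\<integral>\<^sup>+x. indicator K x * ennreal \<bar>f e x\<bar> \<partial>lborel) \<le> (\<integral>\<^sup>+x. ennreal s * indicator K x + ennreal c * (indicator K x * ennreal (\<bar>f e x\<bar> powr p)) \<partial>lborel)"
    proof (rule nn_integral_mono)
      fix x
      have "\<bar>f e x\<bar> \<le> s + c * \<bar>f e x\<bar> powr p" using young_scaled[OF p s, of 1 "\<bar>f e x\<bar>"] by (simp add: c_def)
      then show "indicator K x * ennreal \<bar>f e x\<bar> \<le> ennreal s * indicator K x + ennreal c * (indicator K x * ennreal (\<bar>f e x\<bar> powr p))"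
        using s c by (cases "x \<in> K") (simp_all add: ennreal_leI flip: ennreal_plus ennreal_mult)
    qed
    also have "\<dots> = ennreal s * ennreal m + ennreal c * (\<integral>\<^sup>+x. indicator K x * ennreal (\<bar>f e x\<bar> powr p) \<partial>lborel)"
      by (simp add: nn_integral_add nn_integral_cmult nn_integral_cmult_indicator m)
    also have "\<dots> \<le> ennreal s * ennreal m + ennreal c * ennreal (\<tau> / 2 / c)" using elim by (intro add_left_mono mult_left_mono) auto
    also have "\<dots> = ennreal (s * m + \<tau> / 2)" using s c m \<tau> by (simp flip: ennreal_mult ennreal_plus)
    also have "\<dots> \<le> ennreal \<tau>"
    proof (rule ennreal_leI)
      have "s * m \<le> \<tau> / 2" unfolding s_def using \<tau> m by (intro mult_divide_Suc_le) auto
      then show "s * m + \<tau> / 2 \<le> \<tau>" by simp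
    qed
    finally show ?case .
  qed
qed

section \<open>Convergence of the nonlocal forms\<close>

theorem theorem2p16:
  fixes p :: real
    and \<nu> :: "real \<Rightarrow> real ^ 'd \<Rightarrow> real"
    and \<Omega> :: "(real ^ 'd) set"
    and u v :: "real ^ 'd \<Rightarrow> real"
    and v\<epsilon> :: "real \<Rightarrow> real ^ 'd \<Rightarrow> real"
    and k :: 'd
  assumes "1 < p"
    and "kernel_family p \<nu>"
    and "open \<Omega>"
    and "u \<in> W1p p UNIV"
    and "v \<in> W1p p UNIV"
    and "\<And>\<epsilon>. \<epsilon> > 0 \<Longrightarrow> v\<epsilon> \<epsilon> \<in> W_nu p (\<nu> \<epsilon>) \<Omega>"
    and "Lp_loc_tendsto p \<Omega> v\<epsilon> v"
    and "bdd_above ((\<lambda>\<epsilon>. (LINT x:\<Omega>|lebesgue. \<bar>v\<epsilon> \<epsilon> x\<bar> powr p)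
                          + form_E p (\<nu> \<epsilon>) \<Omega> (v\<epsilon> \<epsilon>) (v\<epsilon> \<epsilon>)) ` {0<..})"
    and "W1p_extension_domain p \<Omega>
         \<or> (frontier \<Omega> = frontier (closure \<Omega>) \<and> W1p_extension_domain p (- closure \<Omega>))
         \<or> u \<in> W1p0 p \<Omega>"
  shows "((\<lambda>\<epsilon>. form_E p (\<nu> \<epsilon>) \<Omega> u (v\<epsilon> \<epsilon>)) \<longlongrightarrow> K_const p k * form_E0 p \<Omega> u v) (at_right 0)
       \<and> ((\<lambda>\<epsilon>. form_E_plus p (\<nu> \<epsilon>) \<Omega> u (v\<epsilon> \<epsilon>)) \<longlongrightarrow> K_const p k * form_E0 p \<Omega> u v) (at_right 0)"
proof -
  note p = assms(1) and kf = assms(2) and \<Omega> = assms(3) and ve = assms(6)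
  have \<Omega>b[measurable]: "\<Omega> \<in> sets borel" using \<Omega> by (rule borel_open)

  have "\<exists>\<rho>. \<rho> \<in> borel_measurable borel \<and> (\<forall>t. 0 \<le> \<rho> t) \<and> (AE h in lborel. \<nu> e h = \<rho> (norm h))" if "0 < e" for e
  proof -
    have a1: "\<nu> e \<in> borel_measurable (lebesgue_on (UNIV - {0}))" using kf that unfolding kernel_family_def by blast
    have a2: "0 \<le> \<nu> e h" if "h \<noteq> 0" for h using kf \<open>0 < e\<close> that unfolding kernel_family_def by blast
    have a3: "\<nu> e h = \<nu> e k" if "h \<noteq> 0" "k \<noteq> 0" "norm h = norm k" for h k using kf \<open>0 < e\<close> that unfolding kernel_family_def by blast
    show ?thesis by (rule radial_ex_borel_profile[OF a1 a2 a3]) blast+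
  qed
  then obtain r0 where r0: "\<And>e. 0 < e \<Longrightarrow> r0 e \<in> borel_measurable borel" "\<And>e t. 0 < e \<Longrightarrow> 0 \<le> r0 e t"
    "\<And>e. 0 < e \<Longrightarrow> AE h in lborel. \<nu> e h = r0 e (norm h)" by metis
  \<comment> \<open>The profiles exist for positive parameters only; any of them serves as a default value for the others.\<close>
  define r where "r e = r0 (if 0 < e then e else 1)" for e
  have rm[measurable]: "r e \<in> borel_measurable borel" for e using r0(1) by (simp add: r_def)
  have rnn: "0 \<le> r e t" for e t using r0(2) by (simp add: r_def)
  have \<nu>r: "AE h in lborel. \<nu> e h = r e (norm h)" if "0 < e" for e using r0(3)[OF that] that by (simp add: r_def)
  define P where "P e = density lborel (\<lambda>h :: real ^ 'd. ennreal (r e (norm h)))" for e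

  have mass: "has_bochner_integral lborel (\<lambda>h :: real ^ 'd. min 1 (norm h powr p) * r e (norm h)) 1" for e
  proof -
    define e' where "e' = (if 0 < e then e else 1)"
    have e': "0 < e'" by (simp add: e'_def)
    have re: "r e' = r e" by (simp add: r_def e'_def)
    have m: "(\<lambda>h :: real ^ 'd. min 1 (norm h powr p) * r e' (norm h)) \<in> borel_measurable borel" by measurable
    have ae: "AE h in lborel. min 1 (norm h powr p) * \<nu> e' h = min 1 (norm h powr p) * r e' (norm h)" using \<nu>r[OF e'] by eventually_elim simp
    have "has_bochner_integral lebesgue (\<lambda>h. min 1 (norm h powr p) * \<nu> e' h) 1" using kf e' unfolding kernel_family_def by blast
    then show ?thesis unfolding has_bochner_integral_iff lebesgue_borel_transfer[OF m ae] re .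
  qed
  have conc: "((\<lambda>e. \<integral>h. indicator {h :: real ^ 'd. d < norm h} h * r e (norm h) \<partial>lborel) \<longlongrightarrow> 0) (at_right 0)" if d: "0 < d" for d
  proof -
    have "((\<lambda>e. LINT h:{h. norm h > d}|lebesgue. \<nu> e h) \<longlongrightarrow> 0) (at_right 0)" using kf d unfolding kernel_family_def by blast
    moreover have "\<forall>\<^sub>F e in at_right 0. (LINT h:{h. norm h > d}|lebesgue. \<nu> e h) = (\<integral>h. indicator {h :: real ^ 'd. d < norm h} h * r e (norm h) \<partial>lborel)"
      using eventually_at_right_less
    proof eventually_elim
      case (elim e)
      have [measurable]: "{h :: real ^ 'd. d < norm h} \<in> sets borel" by measurable
      show ?case unfolding set_lebesgue_integral_def
        by (rule lebesgue_borel_transfer(2)) (measurable, use \<nu>r[OF elim] in eventually_elim, simp)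
    qed
    ultimately show ?thesis by (rule Lim_transform_eventually)
  qed
  interpret concentrating_kernels p P "K_const p k"
    unfolding P_def[abs_def] by (rule radial_kernels_concentrate[OF p rm rnn mass conc])

  obtain u' g where su: "strong_Lp_grad p u' g" and uae: "AE x in lborel. u x = u' x"
    and gae: "\<And>\<Omega>. open \<Omega> \<Longrightarrow> AE x in lborel. x \<in> \<Omega> \<longrightarrow> weak_grad \<Omega> u x = g x"
    by (rule W1p_strong_Lp_grad[OF p assms(4)]) (rule that)
  obtain v' g' where sv: "strong_Lp_grad p v' g'" and vae: "AE x in lborel. v x = v' x"
    and g'ae: "\<And>\<Omega>. open \<Omega> \<Longrightarrow> AE x in lborel. x \<in> \<Omega> \<longrightarrow> weak_grad \<Omega> v x = g' x"
    by (rule W1p_strong_Lp_grad[OF p assms(5)]) (rule that)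
  have [measurable]: "u' \<in> borel_measurable borel" "g \<in> borel_measurable borel" "v' \<in> borel_measurable borel" "g' \<in> borel_measurable borel"
    using su sv by (auto simp: strong_Lp_grad_def)

  have "\<exists>f. f \<in> borel_measurable borel \<and> (0 < e \<longrightarrow> (AE x in lborel. v\<epsilon> e x = f x))" for e
  proof (cases "0 < e")
    case True
    then have "v\<epsilon> e \<in> borel_measurable lebesgue" using ve by (simp add: W_nu_def)
    then show ?thesis by (rule lebesgue_ex_borel) auto
  qed (auto intro!: exI[of _ "\<lambda>_. 0"])
  then obtain vv where vm[measurable]: "\<And>e. vv e \<in> borel_measurable borel" and vvae: "\<And>e. 0 < e \<Longrightarrow> AE x in lborel. v\<epsilon> e x = vv e x" by metis

  let ?S1 = "\<Omega> \<times> (UNIV :: (real ^ 'd) set)" and ?S2 = "- ((- \<Omega>) \<times> (- \<Omega>))"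
  let ?T2 = "\<Omega> \<times> UNIV \<union> outer \<Omega>"
  have S1: "?S1 \<in> sets borel" "?S1 \<in> sets (borel \<Otimes>\<^sub>M borel)" unfolding borel_prod[symmetric] by auto
  have "?S2 = \<Omega> \<times> UNIV \<union> UNIV \<times> \<Omega>" by auto
  then have S2: "?S2 \<in> sets borel" unfolding borel_prod[symmetric] by auto
  have T2: "?T2 \<in> sets (borel \<Otimes>\<^sub>M borel)" using S1(2) outer_borel[OF \<Omega>] by auto
  have ST1: "(x, x - h) \<in> ?S1 \<longleftrightarrow> (x, h) \<in> ?S1" for x h by auto
  have ST2: "(x, x - h) \<in> ?S2 \<longleftrightarrow> (x, h) \<in> ?T2" for x h by (auto simp: outer_def)

  have incr: "increment a z = a (fst z) - a (fst z - snd z)" for a z by (simp add: increment_def)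
  \<comment> \<open>\<open>?S2\<close> is the complement of \<open>\<Omega>\<^sup>c \<times> \<Omega>\<^sup>c\<close>, and \<open>?T2\<close> is its preimage under the shear.\<close>
  have E: "form_E p (\<nu> e) \<Omega> u (v\<epsilon> e) = (\<integral>z. indicator ?T2 z * (duality_map p (increment u' z) * increment (vv e) z) \<partial>Q e)" if "0 < e" for e
    unfolding form_E_def incr P_def
    by (rule form_integral_transfer(2)[OF _ _ _ rnn uae vvae[OF that] \<nu>r[OF that] S2 T2 ST2]) measurable
  have Ep: "form_E_plus p (\<nu> e) \<Omega> u (v\<epsilon> e) = (\<integral>z. indicator ?S1 z * (duality_map p (increment u' z) * increment (vv e) z) \<partial>Q e)" if "0 < e" for e
    unfolding form_E_plus_def incr P_def
    by (rule form_integral_transfer(2)[OF _ _ _ rnn uae vvae[OF that] \<nu>r[OF that] S1 ST1]) measurable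

  obtain C where C: "\<And>e. 0 < e \<Longrightarrow> (LINT x:\<Omega>|lebesgue. \<bar>v\<epsilon> e x\<bar> powr p) + form_E p (\<nu> e) \<Omega> (v\<epsilon> e) (v\<epsilon> e) \<le> C"
    using assms(8) by (auto simp: bdd_above_def)
  have bd: "\<forall>\<^sub>F e in at_right 0. energy e ?T2 (increment (vv e)) \<le> ennreal C"
    using eventually_at_right_less
  proof eventually_elim
    case (elim e)
    let ?f = "\<lambda>z. indicator ?T2 z * (duality_map p (increment (vv e) z) * increment (vv e) z)"
    note tr = form_integral_transfer[OF vm vm rm rnn vvae[OF elim] vvae[OF elim] \<nu>r[OF elim] S2 T2 ST2, of p, folded incr P_def]
    have int: "integrable (Q e) ?f" using ve[OF elim] unfolding W_nu_def tr(1)[symmetric] by simp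
    \<comment> \<open>Both summands in the hypothesis on the supremum are nonnegative, so each is bounded by it.\<close>
    have "0 \<le> (LINT x:\<Omega>|lebesgue. \<bar>v\<epsilon> e x\<bar> powr p)" unfolding set_lebesgue_integral_def by (intro integral_nonneg_AE) auto
    then have "(\<integral>z. ?f z \<partial>Q e) \<le> C" using C[OF elim] unfolding form_E_def tr(2) by linarith
    moreover have "energy e ?T2 (increment (vv e)) = ennreal (\<integral>z. ?f z \<partial>Q e)"
    proof -
      have "energy e ?T2 (increment (vv e)) = (\<integral>\<^sup>+z. ennreal (?f z) \<partial>Q e)"
        by (simp add: duality_map_mult_self ennreal_indicator_mult)
      also have "\<dots> = ennreal (\<integral>z. ?f z \<partial>Q e)" by (rule nn_integral_eq_integral[OF int]) (simp add: duality_map_mult_self)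
      finally show ?thesis .
    qed
    ultimately show ?case by (simp add: ennreal_leI)
  qed

  have loc: "((\<lambda>e. \<integral>\<^sup>+x. indicator K x * ennreal \<bar>vv e x - v' x\<bar> \<partial>lborel) \<longlongrightarrow> 0) (at_right 0)" if K: "compact K" "K \<subseteq> \<Omega>" for K
  proof (rule Lp_to_L1_tendsto_on[OF p])
    show Kb[measurable]: "K \<in> sets borel" using K(1) by (rule borel_compact)
    show "emeasure lborel K < \<infinity>" using emeasure_compact_finite[OF K(1)] by simp
    have lim: "((\<lambda>e. LINT x:K|lebesgue. \<bar>v\<epsilon> e x - v x\<bar> powr p) \<longlongrightarrow> 0) (at_right 0)"
      using assms(7) K by (auto simp: Lp_loc_tendsto_def)
    have "\<forall>\<^sub>F e in at_right 0. ennreal (LINT x:K|lebesgue. \<bar>v\<epsilon> e x - v x\<bar> powr p) = (\<integral>\<^sup>+x. indicator K x * ennreal (\<bar>vv e x - v' x\<bar> powr p) \<partial>lborel)"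
      using eventually_at_right_less
    proof eventually_elim
      case (elim e)
      have "(LINT x:K|lebesgue. \<bar>v\<epsilon> e x - v x\<bar> powr p) = (\<integral>x. indicator K x * \<bar>vv e x - v' x\<bar> powr p \<partial>lborel)"
        unfolding set_lebesgue_integral_def
        by (rule lebesgue_borel_transfer(2)) (measurable, use vvae[OF elim] vae in eventually_elim, simp)
      moreover have "integrable lborel (\<lambda>x. indicator K x * \<bar>vv e x - v' x\<bar> powr p)"
      proof (rule Bochner_Integration.integrable_bound)
        have "set_integrable lebesgue \<Omega> (\<lambda>x. \<bar>v\<epsilon> e x\<bar> powr p)" using ve[OF elim] by (simp add: W_nu_def Lp_on_def)
        moreover have "integrable lebesgue (\<lambda>x. indicator \<Omega> x *\<^sub>R \<bar>v\<epsilon> e x\<bar> powr p) \<longleftrightarrow> integrable lborel (\<lambda>x. indicator \<Omega> x *\<^sub>R \<bar>vv e x\<bar> powr p)"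
          by (rule lebesgue_borel_transfer(1)) (measurable, use vvae[OF elim] in eventually_elim, simp)
        ultimately have i1: "integrable lborel (\<lambda>x. indicator \<Omega> x *\<^sub>R \<bar>vv e x\<bar> powr p)" by (simp add: set_integrable_def)
        have i2: "integrable lborel (\<lambda>x. \<bar>v' x\<bar> powr p)"
          using sv by (intro integrableI_bounded) (auto simp: strong_Lp_grad_def)
        show "integrable lborel (\<lambda>x. 2 powr p * (indicator \<Omega> x *\<^sub>R \<bar>vv e x\<bar> powr p + \<bar>v' x\<bar> powr p))"
          by (intro integrable_mult_right Bochner_Integration.integrable_add i1 i2)
        show "AE x in lborel. norm (indicator K x * \<bar>vv e x - v' x\<bar> powr p) \<le> norm (2 powr p * (indicator \<Omega> x *\<^sub>R \<bar>vv e x\<bar> powr p + \<bar>v' x\<bar> powr p))"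
        proof (rule AE_I2)
          fix x
          show "norm (indicator K x * \<bar>vv e x - v' x\<bar> powr p) \<le> norm (2 powr p * (indicator \<Omega> x *\<^sub>R \<bar>vv e x\<bar> powr p + \<bar>v' x\<bar> powr p))"
            using norm_diff_powr_le[of p "vv e x" "v' x"] p K(2) by (cases "x \<in> K") auto
        qed
      qed measurable
      ultimately have "ennreal (LINT x:K|lebesgue. \<bar>v\<epsilon> e x - v x\<bar> powr p) = (\<integral>\<^sup>+x. ennreal (indicator K x * \<bar>vv e x - v' x\<bar> powr p) \<partial>lborel)"
        by (simp add: nn_integral_eq_integral)
      then show ?case by (simp add: ennreal_indicator_mult)
    qed
    moreover have "((\<lambda>e. ennreal (LINT x:K|lebesgue. \<bar>v\<epsilon> e x - v x\<bar> powr p)) \<longlongrightarrow> 0) (at_right 0)"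
      using tendsto_ennrealI[OF lim] by simp
    ultimately show "((\<lambda>e. \<integral>\<^sup>+x. indicator K x * ennreal (\<bar>vv e x - v' x\<bar> powr p) \<partial>lborel) \<longlongrightarrow> 0) (at_right 0)"
      by (rule Lim_transform_eventually[rotated])
  qed measurable

  have E0: "form_E0 p \<Omega> u v = (\<integral>x. indicator \<Omega> x * (norm (g x) powr (p - 2) * (g x \<bullet> g' x)) \<partial>lborel)"
    unfolding form_E0_def set_lebesgue_integral_def
  proof (rule lebesgue_borel_transfer(2))
    show "AE x in lborel. indicator \<Omega> x *\<^sub>R (norm (weak_grad \<Omega> u x) powr (p - 2) * (weak_grad \<Omega> u x \<bullet> weak_grad \<Omega> v x))
       = indicator \<Omega> x * (norm (g x) powr (p - 2) * (g x \<bullet> g' x))"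
      using gae[OF \<Omega>] g'ae[OF \<Omega>] by eventually_elim (simp add: indicator_def)
  qed measurable

  have "\<forall>\<^sub>F e in at_right 0. (\<integral>z. indicator ?T2 z * (duality_map p (increment u' z) * increment (vv e) z) \<partial>Q e) = form_E p (\<nu> e) \<Omega> u (v\<epsilon> e)"
    using eventually_at_right_less by eventually_elim (simp add: E)
  from Lim_transform_eventually[OF forms_converge(2)[OF \<Omega> su sv vm bd loc] this]
  have 1: "((\<lambda>\<epsilon>. form_E p (\<nu> \<epsilon>) \<Omega> u (v\<epsilon> \<epsilon>)) \<longlongrightarrow> K_const p k * form_E0 p \<Omega> u v) (at_right 0)" by (simp add: E0)
  have "\<forall>\<^sub>F e in at_right 0. (\<integral>z. indicator ?S1 z * (duality_map p (increment u' z) * increment (vv e) z) \<partial>Q e) = form_E_plus p (\<nu> e) \<Omega> u (v\<epsilon> e)"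
    using eventually_at_right_less by eventually_elim (simp add: Ep)
  from Lim_transform_eventually[OF forms_converge(1)[OF \<Omega> su sv vm bd loc] this]
  have 2: "((\<lambda>\<epsilon>. form_E_plus p (\<nu> \<epsilon>) \<Omega> u (v\<epsilon> \<epsilon>)) \<longlongrightarrow> K_const p k * form_E0 p \<Omega> u v) (at_right 0)" by (simp add: E0)
  from 1 2 show ?thesis by blast
qed

end
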